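(* The generalized Lehman algorithm (the specific algorithm spelled out in the context) takes as input two integers $N>1$ and $r$ with $1<r\le \lg N$, and returns a nontrivial factor of $N$ or proves that $N$ is $r$-power free. The algorithm finishes after $$O\left(N^{1/(r+2)}(\log N)^2\log\log N\right)$$ bit operations.
   Context: $\lg x$ denotes the logarithm of $x$ to base $2$. An integer $N$ is $r$-power free if it cannot be written as $N=p^rq$ with integers $p>1$ and $q$. A nontrivial factor of $N$ is a divisor $d$ of $N$ with $1<d<N$. Running times are worst-case and count bit operations in the standard model for integer arithmetic, using that two $n$-bit integers can be multiplied in $O(n\log n)$ bit operations; the implied constant may depend on $r$. The generalized Lehman algorithm, on input $(N,r)$, is the following deterministic procedure. (1) Test whether $N$ is an $r$-th power by testing whether $\lfloor N^{1/r}\rfloor^r=N$; if so, this gives the nontrivial factor $\lfloor N^{1/r}\rfloor$, which is returned. (2) For $n=2,\dots,\lfloor N^{1/(r+2)}\rfloor$: if $n\mid N$, return $n$. (3) For $j=0,\dots,\lfloor \frac{1}{r(r+2)}\lg N\rfloor$, for $a=1,\dots,\lceil 2^{(r+2)j/3+r+1}\rceil$, and for $b=1,\dots,\lfloor N^{1/(r+2)}2^{-(2r+1)j/3}\rfloor$: let $G=(r+1)(ab^rN)^{1/(r+1)}$ and $U=r^{r+3/2}N^{1/(2(r+2))}2^{-(r-1)j/6-1}(ab)^{-1/2}$, and run through the integers $u$ with $0\le u-G\le U$. For each such $u$, determine whether $u=aq+rbp$ for some $p,q$ with $N=p^rq$, by testing whether the polynomial $f_r(x)=x^{r+1}-ux^r+r^rab^rN$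 has an integer root having a nontrivial gcd with $N$ (if $N=p^rq$ and $u=aq+rbp$, then $rbp$ is a root of $f_r$). The test computes the positive roots of $f_r$ to the nearest integer by bisection on the intervals $[\frac{ru}{r+1}-L,\frac{ru}{r+1}]$ and $[\frac{ru}{r+1},\frac{ru}{r+1}+L]$, where $L=\frac{r}{r+1}N^{1/4}2^{-j/3}$, and then computes the gcd with $N$ of any integer root found. If successful, recover $p$ and $q$ (a nontrivial factor of $N$) and return. (4) If nothing has been returned, return "$N$ is $r$-power free". *)

theory Defs
  imports
    Complex_Main
    "HOL-Library.Landau_Symbols"
    "HOL-Library.Log_Nat"
    "HOL-Library.Monad_Syntax"
begin

section \<open>Factors and power-free integers\<close>

definition nontrivial_factor :: "int \<Rightarrow> int \<Rightarrow> bool" where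
  "nontrivial_factor d N \<longleftrightarrow> d dvd N \<and> 1 < d \<and> d < N"

definition power_free :: "nat \<Rightarrow> int \<Rightarrow> bool" where
  "power_free r N \<longleftrightarrow> \<not> (\<exists>p q. 1 < p \<and> N = p ^ r * q)"


section \<open>The generalized Lehman algorithm, as a procedure on numbers\<close>

text \<open>
  The procedure below fixes what is enumerated, in which order, and what is returned.
  A result \<open>Some d\<close> means that the factor \<open>d\<close> is returned, and \<open>None\<close> means that
  ``\<open>N\<close> is \<open>r\<close>-power free'' is returned.
\<close>

fun first_some :: "('a \<Rightarrow> 'b option) \<Rightarrow> 'a list \<Rightarrow> 'b option" where
  "first_some f [] = None"
| "first_some f (x # xs) = (case f x of None \<Rightarrow> first_some f xs | Some y \<Rightarrow> Some y)"

definition lehman_poly :: "int \<Rightarrow> nat \<Rightarrow> int \<Rightarrow> int \<Rightarrow> int \<Rightarrow> int \<Rightarrow> int" where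
  "lehman_poly N r a b u x = x ^ (r + 1) - u * x ^ r + int r ^ r * a * b ^ r * N"

definition lehman_G :: "int \<Rightarrow> nat \<Rightarrow> int \<Rightarrow> int \<Rightarrow> real" where
  "lehman_G N r a b = (real r + 1) * (real_of_int (a * b ^ r * N)) powr (1 / (real r + 1))"

definition lehman_U :: "int \<Rightarrow> nat \<Rightarrow> int \<Rightarrow> int \<Rightarrow> int \<Rightarrow> real" where
  "lehman_U N r j a b =
     real r powr (real r + 3/2) * real_of_int N powr (1 / (2 * (real r + 2)))
     * 2 powr (- (real r - 1) * real_of_int j / 6 - 1) * real_of_int (a * b) powr (- 1/2)"

definition lehman_L :: "int \<Rightarrow> nat \<Rightarrow> int \<Rightarrow> real" where
  "lehman_L N r j = real r / (real r + 1) * real_of_int N powr (1/4) * 2 powr (- real_of_int j / 3)"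

text \<open>
  The union of the two bisection intervals is \<open>[c - L, c + L]\<close> with \<open>c = r u / (r + 1)\<close>.
  Only positive roots are looked for (\<open>c - L\<close> can be negative), the smaller one first.
\<close>

definition lehman_test :: "int \<Rightarrow> nat \<Rightarrow> int \<Rightarrow> int \<Rightarrow> int \<Rightarrow> int \<Rightarrow> int option" where
  "lehman_test N r j a b u =
     (let c = real r * real_of_int u / (real r + 1); L = lehman_L N r j in
      map_option (\<lambda>x. gcd x N)
        (find (\<lambda>x. 0 < x \<and> lehman_poly N r a b u x = 0 \<and> nontrivial_factor (gcd x N) N)
           [\<lceil>c - L\<rceil>..\<lfloor>c + L\<rfloor>]))"

text \<open>
  The integers \<open>u\<close> with \<open>0 \<le> u - G \<le> U\<close> are those from \<open>\<lceil>G\<rceil>\<close> to \<open>\<lfloor>G + U\<rfloor>\<close>.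
\<close>

definition lehman_main :: "int \<Rightarrow> nat \<Rightarrow> int option" where
  "lehman_main N r =
     first_some (\<lambda>j.
       first_some (\<lambda>a.
         first_some (\<lambda>b.
           first_some (\<lambda>u. lehman_test N r j a b u)
             [\<lceil>lehman_G N r a b\<rceil>..\<lfloor>lehman_G N r a b + lehman_U N r j a b\<rfloor>])
           [1..\<lfloor>real_of_int N powr (1 / (real r + 2))
                * 2 powr (- (2 * real r + 1) * real_of_int j / 3)\<rfloor>])
         [1..\<lceil>2 powr ((real r + 2) * real_of_int j / 3 + real r + 1)\<rceil>])
       [0..\<lfloor>1 / (real r * (real r + 2)) * log 2 (real_of_int N)\<rfloor>]"

definition lehman :: "int \<Rightarrow> nat \<Rightarrow> int option" where
  "lehman N r =
     (let s = \<lfloor>real_of_int N powr (1 / real r)\<rfloor> in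
      if s ^ r = N then Some s
      else case find (\<lambda>n. n dvd N) [2..\<lfloor>real_of_int N powr (1 / (real r + 2))\<rfloor>] of
             Some n \<Rightarrow> Some n
           | None \<Rightarrow> lehman_main N r)"


section \<open>Counting bit operations\<close>

text \<open>
  A computation is a pair of its value and the number of bit operations it uses. Only the
  elementary operations on integers in binary carry a charge: addition, subtraction,
  comparison and shifting are charged linearly in the bit length, and a multiplication of
  integers of at most \<open>n\<close> bits is charged \<open>M n\<close>, where \<open>M\<close> is a parameter. Everything
  else (powers, division, greatest common divisors, roots, bisection) is programmed from
  these operations.

  Natural numbers are used for bit lengths, shift distances and counters of bit positions.
  They have \<open>O(log log N)\<close> bits for fixed \<open>r\<close>; incrementing, decrementing or adding them is
  dominated by the charged operation on integers in the same step and is not charged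
  separately. Quantities that depend on \<open>r\<close> only are constants.
\<close>

type_synonym 'a costed = "'a \<times> nat"

definition return :: "'a \<Rightarrow> 'a costed" where
  "return x = (x, 0)"

definition bind_costed :: "'a costed \<Rightarrow> ('a \<Rightarrow> 'b costed) \<Rightarrow> 'b costed" where
  "bind_costed m f = (case m of (x, c) \<Rightarrow> case f x of (y, d) \<Rightarrow> (y, c + d))"

adhoc_overloading Monad_Syntax.bind \<rightleftharpoons> bind_costed

lemma bind_costed_cong [fundef_cong]:
  assumes "m = m'" and "\<And>x. x = fst m' \<Longrightarrow> f x = f' x"
  shows "bind_costed m f = bind_costed m' f'"
  using assms by (auto simp: bind_costed_def split: prod.split)

abbreviation result :: "'a costed \<Rightarrow> 'a" where "result \<equiv> fst"
abbreviation bit_operations :: "'a costed \<Rightarrow> nat" where "bit_operations \<equiv> snd"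

definition bits :: "int \<Rightarrow> nat" where
  "bits x = max 1 (floorlog 2 (nat \<bar>x\<bar>))"

definition iadd :: "int \<Rightarrow> int \<Rightarrow> int costed" where
  "iadd x y = (x + y, max (bits x) (bits y))"

definition isub :: "int \<Rightarrow> int \<Rightarrow> int costed" where
  "isub x y = (x - y, max (bits x) (bits y))"

definition ileq :: "int \<Rightarrow> int \<Rightarrow> bool costed" where
  "ileq x y = (x \<le> y, max (bits x) (bits y))"

definition ieq :: "int \<Rightarrow> int \<Rightarrow> bool costed" where
  "ieq x y = (x = y, max (bits x) (bits y))"

definition ishl :: "int \<Rightarrow> nat \<Rightarrow> int costed" where
  "ishl x k = (x * 2 ^ k, bits x + k)"

definition ishr :: "int \<Rightarrow> nat \<Rightarrow> int costed" where
  "ishr x k = (x div 2 ^ k, bits x)"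

definition ilen :: "int \<Rightarrow> nat costed" where
  "ilen x = (bits x, bits x)"

definition imul :: "(nat \<Rightarrow> nat) \<Rightarrow> int \<Rightarrow> int \<Rightarrow> int costed" where
  "imul M x y = (x * y, M (max (bits x) (bits y)))"


lemma result_bind_costed [simp]: "result (bind_costed m f) = result (f (result m))"
  by (simp add: bind_costed_def split: prod.split)

lemma bit_operations_bind_costed [simp]:
  "bit_operations (bind_costed m f) = bit_operations m + bit_operations (f (result m))"
  by (simp add: bind_costed_def split: prod.split)


section \<open>Integer arithmetic programmed from the elementary operations\<close>

primrec ipow :: "(nat \<Rightarrow> nat) \<Rightarrow> int \<Rightarrow> nat \<Rightarrow> int costed" where
  "ipow M x 0 = return 1"
| "ipow M x (Suc k) = do { y \<leftarrow> ipow M x k; imul M y x }"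

text \<open>
  Schoolbook division of \<open>x \<ge> 0\<close> by \<open>y > 0\<close>. It runs through the possible positions of
  bits of the quotient only, which makes the Euclidean algorithm quadratic.
\<close>

primrec idivmod_loop :: "nat \<Rightarrow> int \<Rightarrow> int \<Rightarrow> int \<Rightarrow> (int \<times> int) costed" where
  "idivmod_loop 0 y q m = return (q, m)"
| "idivmod_loop (Suc i) y q m = do {
     s \<leftarrow> ishl y i;
     le \<leftarrow> ileq s m;
     if le then do { m' \<leftarrow> isub m s; t \<leftarrow> ishl 1 i; q' \<leftarrow> iadd q t; idivmod_loop i y q' m' }
     else idivmod_loop i y q m
   }"

definition idivmod :: "int \<Rightarrow> int \<Rightarrow> (int \<times> int) costed" where
  "idivmod x y = do { k \<leftarrow> ilen x; l \<leftarrow> ilen y; idivmod_loop (k - l + 1) y 0 x }"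

lemma idivmod_loop_less:
  "m < y * 2 ^ i \<Longrightarrow> snd (result (idivmod_loop i y q m)) < y"
proof (induction i arbitrary: q m)
  case 0
  then show ?case by (simp add: return_def)
next
  case (Suc i)
  show ?case
  proof (cases "y * 2 ^ i \<le> m")
    case True
    have "m - y * 2 ^ i < y * 2 ^ i" using Suc.prems by simp
    from Suc.IH[OF this] True show ?thesis
      by (simp add: ishl_def ileq_def isub_def iadd_def)
  next
    case False
    then have "m < y * 2 ^ i" by simp
    from Suc.IH[OF this] False show ?thesis
      by (simp add: ishl_def ileq_def)
  qed
qed

lemma less_two_power_bits: "x < 2 ^ bits x"
proof (cases "x \<le> 0")
  case True
  then show ?thesis by (smt (verit) zero_less_power)
next
  case False
  then have "nat x < 2 ^ floorlog 2 (nat x)" using floorlog_bounds[of "nat x" 2] by simp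
  also have "\<dots> \<le> 2 ^ bits x" using False by (intro power_increasing) (auto simp: bits_def)
  finally show ?thesis using False by (simp add: nat_less_iff)
qed

lemma two_power_bits_le: "0 < y \<Longrightarrow> 2 ^ (bits y - 1) \<le> y"
proof -
  assume y: "0 < y"
  then have *: "2 ^ (floorlog 2 (nat y) - 1) \<le> nat y" using floorlog_bounds[of "nat y" 2] by simp
  have "bits y - 1 = floorlog 2 (nat y) - 1" using y by (auto simp: bits_def)
  then have "2 ^ (bits y - 1) \<le> nat y" using * by simp
  then show ?thesis using y by (simp add: le_nat_iff)
qed

lemma idivmod_less:
  assumes "0 < y"
  shows "snd (result (idivmod x y)) < y"
proof -
  let ?k = "bits x - bits y + 1"
  have "x < 2 ^ bits x" by (rule less_two_power_bits)
  also have "(2::int) ^ bits x \<le> 2 ^ (bits y - 1 + ?k)"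
    by (intro power_increasing) auto
  also have "\<dots> = 2 ^ (bits y - 1) * 2 ^ ?k" by (rule power_add)
  also have "\<dots> \<le> y * 2 ^ ?k" using two_power_bits_le[OF assms] by (intro mult_right_mono) auto
  finally have "x < y * 2 ^ ?k" .
  then show ?thesis
    by (simp add: idivmod_def ilen_def idivmod_loop_less del: idivmod_loop.simps)
qed

function igcd :: "int \<Rightarrow> int \<Rightarrow> int costed" where
  "igcd x y = do {
     done \<leftarrow> ileq y 0;
     if done then return x
     else do { qm \<leftarrow> idivmod x y; igcd y (snd qm) }
   }"
  by auto
termination
  by (relation "measure (\<lambda>(x, y). nat y)") (auto simp: ileq_def intro: idivmod_less)

declare igcd.simps [simp del]

text \<open>For \<open>n \<ge> 0\<close>: \<open>\<lfloor>n\<^bsup>1/k\<^esup>\<rfloor>\<close> and \<open>\<lceil>n\<^bsup>1/k\<^esup>\<rceil>\<close>, determined bit by bit.\<close>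

primrec floor_root_loop :: "(nat \<Rightarrow> nat) \<Rightarrow> nat \<Rightarrow> int \<Rightarrow> nat \<Rightarrow> int \<Rightarrow> int costed" where
  "floor_root_loop M k n 0 x = return x"
| "floor_root_loop M k n (Suc i) x = do {
     t \<leftarrow> ishl 1 i;
     y \<leftarrow> iadd x t;
     z \<leftarrow> ipow M y k;
     le \<leftarrow> ileq z n;
     if le then floor_root_loop M k n i y else floor_root_loop M k n i x
   }"

definition floor_root :: "(nat \<Rightarrow> nat) \<Rightarrow> nat \<Rightarrow> int \<Rightarrow> int costed" where
  "floor_root M k n = do { l \<leftarrow> ilen n; floor_root_loop M k n l 0 }"

definition ceiling_root :: "(nat \<Rightarrow> nat) \<Rightarrow> nat \<Rightarrow> int \<Rightarrow> int costed" where
  "ceiling_root M k n = do {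
     s \<leftarrow> floor_root M k n;
     t \<leftarrow> ipow M s k;
     exact \<leftarrow> ieq t n;
     if exact then return s else iadd s 1
   }"

text \<open>
  \<open>bisect right lo hi\<close> halves the interval until its end points differ by at most \<open>1\<close>;
  \<open>right x\<close> decides whether to continue to the right of \<open>x\<close>. If a real root is enclosed,
  then the integer nearest to it is one of the two end points returned.
\<close>

function bisect :: "(int \<Rightarrow> bool costed) \<Rightarrow> int \<Rightarrow> int \<Rightarrow> (int \<times> int) costed" where
  "bisect right lo hi = do {
     d \<leftarrow> isub hi lo;
     short \<leftarrow> ileq d 1;
     if short then return (lo, hi)
     else do {
       s \<leftarrow> iadd lo hi;
       mid \<leftarrow> ishr s 1;
       right_of_mid \<leftarrow> right mid;
       if right_of_mid then bisect right mid hi else bisect right lo mid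
     }
   }"
  by auto
termination
  by (relation "measure (\<lambda>(right, lo, hi). nat (hi - lo))")
    (auto simp: isub_def ileq_def iadd_def ishr_def)

declare bisect.simps [simp del]

function for_loop :: "int \<Rightarrow> int \<Rightarrow> (int \<Rightarrow> 'a option costed) \<Rightarrow> 'a option costed" where
  "for_loop i hi body = do {
     le \<leftarrow> ileq i hi;
     if le then do {
       res \<leftarrow> body i;
       case res of
         Some y \<Rightarrow> return (Some y)
       | None \<Rightarrow> do { i' \<leftarrow> iadd i 1; for_loop i' hi body }
     }
     else return None
   }"
  by auto
termination
  by (relation "measure (\<lambda>(i, hi, body). nat (hi + 1 - i))") (auto simp: ileq_def iadd_def)

declare for_loop.simps [simp del]


section \<open>The generalized Lehman algorithm, at the level of bit operations\<close>

text \<open>\<open>K\<close> stands for \<open>r\<^sup>r a b\<^sup>r N\<close>, so this evaluates \<^const>\<open>lehman_poly\<close>.\<close>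

definition eval_poly :: "(nat \<Rightarrow> nat) \<Rightarrow> nat \<Rightarrow> int \<Rightarrow> int \<Rightarrow> int \<Rightarrow> int costed" where
  "eval_poly M r u K x = do { y \<leftarrow> ipow M x r; z \<leftarrow> isub x u; v \<leftarrow> imul M y z; iadd v K }"

definition try_candidate ::
  "(nat \<Rightarrow> nat) \<Rightarrow> int \<Rightarrow> nat \<Rightarrow> int \<Rightarrow> int \<Rightarrow> int \<Rightarrow> int option costed" where
  "try_candidate M N r u K x = do {
     v \<leftarrow> eval_poly M r u K x;
     is_root \<leftarrow> ieq v 0;
     if is_root then do {
       g \<leftarrow> igcd N x;
       le1 \<leftarrow> ileq g 1;
       geN \<leftarrow> ileq N g;
       return (if le1 \<or> geN then None else Some g)
     }
     else return None
   }"

definition try_interval ::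
  "(nat \<Rightarrow> nat) \<Rightarrow> int \<Rightarrow> nat \<Rightarrow> int \<Rightarrow> int \<Rightarrow> (int \<Rightarrow> bool costed) \<Rightarrow> int \<Rightarrow> int \<Rightarrow> int option costed"
  where
  "try_interval M N r u K right lo hi = do {
     nonempty \<leftarrow> ileq lo hi;
     if nonempty then do {
       xy \<leftarrow> bisect right lo hi;
       res \<leftarrow> try_candidate M N r u K (fst xy);
       case res of
         Some d \<Rightarrow> return (Some d)
       | None \<Rightarrow> try_candidate M N r u K (snd xy)
     }
     else return None
   }"

text \<open>
  Here \<open>F\<close> stands for \<open>\<lfloor>r N\<^bsup>1/4\<^esup> 2\<^bsup>-j/3\<^esup>\<rfloor> = \<lfloor>(r + 1) L\<rfloor>\<close>, so an integer \<open>x\<close> satisfies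
  \<open>c - L \<le> x \<le> c + L\<close> if and only if \<open>r u - F \<le> (r + 1) x \<le> r u + F\<close>. For \<open>u \<ge> G\<close> the polynomial
  is decreasing on \<open>[0, c]\<close> and increasing from \<open>c\<close> on. The left end of the first interval is
  cut off at \<open>0\<close>.
\<close>

definition test_u ::
  "(nat \<Rightarrow> nat) \<Rightarrow> int \<Rightarrow> nat \<Rightarrow> int \<Rightarrow> int \<Rightarrow> int \<Rightarrow> int option costed" where
  "test_u M N r F K u = do {
     t \<leftarrow> imul M (int r) u;
     d \<leftarrow> isub t F;
     neg \<leftarrow> ileq d 0;
     lo \<leftarrow> (if neg then return 0
           else do { d' \<leftarrow> iadd d (int r); qm \<leftarrow> idivmod d' (int r + 1); return (fst qm) });
     cm \<leftarrow> idivmod t (int r + 1);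
     exact \<leftarrow> ieq (snd cm) 0;
     c' \<leftarrow> (if exact then return (fst cm) else iadd (fst cm) 1);
     e \<leftarrow> iadd t F;
     hm \<leftarrow> idivmod e (int r + 1);
     res \<leftarrow> try_interval M N r u K
              (\<lambda>x. do { v \<leftarrow> eval_poly M r u K x; ileq 1 v }) lo (fst cm);
     case res of
       Some g \<Rightarrow> return (Some g)
     | None \<Rightarrow> try_interval M N r u K
              (\<lambda>x. do { v \<leftarrow> eval_poly M r u K x; ileq v (-1) }) c' (fst hm)
   }"

text \<open>
  Computes \<open>\<lfloor>G + U\<rfloor>\<close> from \<open>A = G\<^bsup>r+1\<^esup>\<close> and \<open>U\<^bsup>6(r+2)\<^esup> = P / Q\<close> with
  \<open>P = r\<^bsup>3(r+2)(2r+3)\<^esup> N\<^sup>3\<close> and \<open>Q = 2\<^bsup>(r-1)(r+2)j + 6(r+2)\<^esup> (a b)\<^bsup>3(r+2)\<^esup>\<close>, namely as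
  \<open>\<lfloor>(\<lfloor>2\<^sup>k G\<rfloor> + \<lfloor>2\<^sup>k U\<rfloor> + 1) / 2\<^sup>k\<rfloor>\<close>. This can only be wrong if \<open>G + U\<close> is less than \<open>2\<^bsup>-k\<^esup>\<close>
  below an integer \<open>u\<close>. But \<open>Q (u - G - U)\<close> is an algebraic integer of degree at most
  \<open>6(r+1)(r+2)\<close>, so if it is nonzero, its norm bounds it away from \<open>0\<close> by a power of \<open>N\<close>
  whose exponent depends on \<open>r\<close> only; \<open>precision r l\<close> (for an \<open>l\<close>-bit integer \<open>N\<close>) is
  chosen generously above this bound.
\<close>

definition precision :: "nat \<Rightarrow> nat \<Rightarrow> nat" where
  "precision r l = 1000 * (r + 2) ^ 4 * l"

definition upper_end ::
  "(nat \<Rightarrow> nat) \<Rightarrow> int \<Rightarrow> nat \<Rightarrow> int \<Rightarrow> int \<Rightarrow> int \<Rightarrow> int \<Rightarrow> int costed" where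
  "upper_end M N r j a b A = do {
     l \<leftarrow> ilen N;
     let k = precision r l;
     A' \<leftarrow> ishl A (k * (r + 1));
     g \<leftarrow> floor_root M (r + 1) A';
     N3 \<leftarrow> ipow M N 3;
     r' \<leftarrow> ipow M (int r) (3 * (r + 2) * (2 * r + 3));
     P \<leftarrow> imul M r' N3;
     P' \<leftarrow> ishl P (6 * (r + 2) * k);
     e \<leftarrow> imul M (int ((r - 1) * (r + 2))) j;
     ab \<leftarrow> imul M a b;
     ab' \<leftarrow> ipow M ab (3 * (r + 2));
     Q \<leftarrow> ishl ab' (nat e + 6 * (r + 2));
     wm \<leftarrow> idivmod P' Q;
     v \<leftarrow> floor_root M (6 * (r + 2)) (fst wm);
     s \<leftarrow> iadd g v;
     s' \<leftarrow> iadd s 1;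
     ishr s' k
   }"

definition search_ab ::
  "(nat \<Rightarrow> nat) \<Rightarrow> int \<Rightarrow> nat \<Rightarrow> int \<Rightarrow> int \<Rightarrow> int \<Rightarrow> int \<Rightarrow> int option costed" where
  "search_ab M N r j F a b = do {
     b' \<leftarrow> ipow M b r;
     ab' \<leftarrow> imul M a b';
     ab'N \<leftarrow> imul M ab' N;
     r' \<leftarrow> ipow M (int r) r;
     K \<leftarrow> imul M r' ab'N;
     s \<leftarrow> ipow M (int r + 1) (r + 1);
     A \<leftarrow> imul M s ab'N;
     lo \<leftarrow> ceiling_root M (r + 1) A;
     hi \<leftarrow> upper_end M N r j a b A;
     for_loop lo hi (\<lambda>u. test_u M N r F K u)
   }"

text \<open>
  The bounds of the loops are roots of integers or rationals:
  \<open>\<lfloor>(r + 1) L\<rfloor> = \<lfloor>(r\<^bsup>12\<^esup> N\<^sup>3 / 2\<^bsup>4j\<^esup>)\<^bsup>1/12\<^esup>\<rfloor>\<close>, the bound on \<open>a\<close> is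
  \<open>\<lceil>(2\<^bsup>(r+2)j + 3(r+1)\<^esup>)\<^bsup>1/3\<^esup>\<rceil>\<close>, and the bound on \<open>b\<close> is
  \<open>\<lfloor>(N\<^sup>3 / 2\<^bsup>(2r+1)(r+2)j\<^esup>)\<^bsup>1/(3(r+2))\<^esup>\<rfloor>\<close>.
\<close>

definition search_j :: "(nat \<Rightarrow> nat) \<Rightarrow> int \<Rightarrow> nat \<Rightarrow> int \<Rightarrow> int option costed" where
  "search_j M N r j = do {
     N3 \<leftarrow> ipow M N 3;
     r' \<leftarrow> ipow M (int r) 12;
     x \<leftarrow> imul M r' N3;
     e1 \<leftarrow> imul M 4 j;
     x' \<leftarrow> ishr x (nat e1);
     F \<leftarrow> floor_root M 12 x';
     e2 \<leftarrow> imul M (int (r + 2)) j;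
     y \<leftarrow> ishl 1 (nat e2 + 3 * (r + 1));
     amax \<leftarrow> ceiling_root M 3 y;
     e3 \<leftarrow> imul M (int ((2 * r + 1) * (r + 2))) j;
     z \<leftarrow> ishr N3 (nat e3);
     bmax \<leftarrow> floor_root M (3 * (r + 2)) z;
     for_loop 1 amax (\<lambda>a. for_loop 1 bmax (\<lambda>b. search_ab M N r j F a b))
   }"

definition lehman_program :: "(nat \<Rightarrow> nat) \<Rightarrow> int \<Rightarrow> nat \<Rightarrow> int option costed" where
  "lehman_program M N r = do {
     s \<leftarrow> floor_root M r N;
     t \<leftarrow> ipow M s r;
     is_power \<leftarrow> ieq t N;
     if is_power then return (Some s)
     else do {
       nmax \<leftarrow> floor_root M (r + 2) N;
       small \<leftarrow> for_loop 2 nmax (\<lambda>n. do {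
                  qm \<leftarrow> idivmod N n;
                  divides \<leftarrow> ieq (snd qm) 0;
                  return (if divides then Some n else None) });
       case small of
         Some n \<Rightarrow> return (Some n)
       | None \<Rightarrow> do {
           l \<leftarrow> ilen N;
           jm \<leftarrow> idivmod (int l - 1) (int (r * (r + 2)));
           for_loop 0 (fst jm) (\<lambda>j. search_j M N r j)
         }
     }
   }"

end

theory Submission
  imports "Jordan_Normal_Form.Char_Poly" Defs
begin

text \<open>
  Write \<open>X = N\<^bsup>1/(r+2)\<^esup>\<close>. Why the search cannot miss a factor: suppose that \<open>N = p\<^sup>r q\<close> with
  \<open>p > 1\<close>, that \<open>N\<close> is not an \<open>r\<close>-th power and that trial division up to \<open>X\<close> has failed. Then \<open>p\<close> and \<open>q\<close>
  both exceed \<open>X\<close>, so \<open>X 2\<^sup>j \<le> p < X 2\<^bsup>j+1\<^esup>\<close> for some \<open>j\<close> in the range of the outer loop. By Dirichlet's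
  theorem there is a fraction \<open>a/b\<close> close to \<open>p/q\<close> whose denominator respects the bound on \<open>b\<close>, and then the
  numerator respects the bound on \<open>a\<close>. The number \<open>u = a q + r b p\<close> is \<open>r + 1\<close> times the arithmetic mean of
  \<open>a q\<close> and \<open>r\<close> copies of \<open>b p\<close>, and \<open>G\<close> is \<open>r + 1\<close> times their geometric mean. As \<open>a q\<close> and \<open>b p\<close> are nearly
  equal, the two means differ by so little that \<open>0 \<le> u - G \<le> U\<close>. The root \<open>r b p\<close> of the polynomial belonging
  to \<open>u\<close> lies within \<open>L\<close> of \<open>r u / (r + 1)\<close>, and its gcd with \<open>N\<close> is neither \<open>1\<close> nor \<open>N\<close>
  (\<open>lehman_main_finds_factor\<close>).

  Why the program computes the same value: the quantities that it rounds are, with one exception, roots or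
  logarithms of integers or rationals, which it rounds exactly, and since the polynomial is strictly
  monotone on either side of \<open>r u / (r + 1)\<close>, bisection isolates its only root there (\<open>result_test_u\<close>). The
  exception is the end \<open>\<lfloor>G + U\<rfloor>\<close> of the loop over \<open>u\<close>, which is computed from approximations of \<open>G\<close> and \<open>U\<close>
  and would be wrong if \<open>G + U\<close> were only just below an integer \<open>u\<close>. Let \<open>G\<^sup>n = A\<close> and \<open>U\<^sup>m = P/Q\<close>. The
  product of \<open>Q (u - z)\<^sup>m - P\<close> over all complex \<open>z\<close> with \<open>z\<^sup>n = A\<close> is the determinant of an integer matrix,
  hence an integer. If \<open>u > G + U\<close>, then \<open>\<bar>u - z\<bar> \<ge> u - G > U\<close>, so no factor vanishes and the product is at
  least \<open>1\<close> in absolute value. All factors are bounded by a power of \<open>N\<close>, so the factor at \<open>z = G\<close>, which is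
  small if \<open>u - (G + U)\<close> is small, cannot be too small (\<open>root_sum_separation\<close>).

  Why the running time is as claimed: for fixed \<open>r\<close> all integers have \<open>O(log N)\<close> bits, and every pair \<open>(a, b)\<close>
  and every \<open>u\<close> cost \<open>O(log N)\<close> multiplications of such integers. For given \<open>j\<close>, the bounds on \<open>a\<close> and \<open>b\<close>
  multiply to \<open>O(X 2\<^bsup>-(r-1)j/3\<^esup>)\<close>, which bounds the number of pairs. A pair has at most \<open>U + 1\<close> values of \<open>u\<close>, and \<open>U\<close>
  is proportional to \<open>(a b)\<^bsup>-1/2\<^esup>\<close>, so that the sum of \<open>U\<close> over all pairs is of the same order
  (\<open>sum_pairs_le\<close>). The sum over \<open>j\<close> is a geometric series.
\<close>

(* The short name eval_poly is to denote the evaluation procedure of the program. *)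
hide_const (open) Ring_Hom_Poly.eval_poly

section \<open>Correctness of the search\<close>

lemma first_some_eq_None_iff: "first_some f xs = None \<longleftrightarrow> (\<forall>x\<in>set xs. f x = None)"
  by (induction xs) (auto split: option.splits)

lemma first_some_SomeE:
  assumes "first_some f xs = Some y"
  obtains x where "x \<in> set xs" "f x = Some y"
  using assms by (induction xs) (auto split: option.splits)

text \<open>
  Pigeonhole: the fractional parts of \<open>0, \<alpha>, \<dots>, n \<alpha>\<close> fall into \<open>n + 1\<close> boxes of width \<open>1/(n + 1)\<close>. Either two
  share a box, or the last box is hit, and its points are within \<open>1/(n + 1)\<close> of the next integer. The error
  bound \<open>1/(n + 1)\<close> instead of \<open>1/n\<close> matters: for \<open>n = \<lfloor>B\<rfloor>\<close> it is below \<open>1/B\<close>.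
\<close>

lemma dirichlet_approximation:
  fixes \<alpha> :: real and n :: nat
  assumes "1 \<le> n"
  obtains b a :: int where "1 \<le> b" "b \<le> int n" "\<bar>of_int b * \<alpha> - of_int a\<bar> \<le> 1 / (real n + 1)"
proof -
  define g where "g i = nat \<lfloor>(real n + 1) * frac (real i * \<alpha>)\<rfloor>" for i :: nat
  have g_floor: "real (g i) \<le> (real n + 1) * frac (real i * \<alpha>)"
    "(real n + 1) * frac (real i * \<alpha>) < real (g i) + 1" for i
  proof -
    have "0 \<le> (real n + 1) * frac (real i * \<alpha>)" by (simp add: frac_ge_0)
    then have "real (g i) = of_int \<lfloor>(real n + 1) * frac (real i * \<alpha>)\<rfloor>" by (simp add: g_def)
    then show "real (g i) \<le> (real n + 1) * frac (real i * \<alpha>)"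
      "(real n + 1) * frac (real i * \<alpha>) < real (g i) + 1" by linarith+
  qed
  have g_le: "g i \<le> n" for i
  proof -
    have "(real n + 1) * frac (real i * \<alpha>) < (real n + 1) * 1"
      by (intro mult_strict_left_mono frac_lt_1) auto
    then have "real (g i) < (real n + 1) * 1" using g_floor(1)[of i] by (rule le_less_trans[rotated])
    then have "real (g i) < real n + 1" by (simp only: mult_1_right)
    then show ?thesis by linarith
  qed
  show thesis
  proof (cases "inj_on g {0..n}")
    case True
    have "g ` {0..n} = {0..n}" using True g_le by (intro endo_inj_surj) auto
    then obtain i where i: "i \<le> n" "g i = n" by (metis atLeastAtMost_iff imageE le0 order_refl)
    have "i \<noteq> 0" using i(2) assms by (intro notI) (simp add: g_def)
    have "real n \<le> (real n + 1) * frac (real i * \<alpha>)" using g_floor(1)[of i] i by simp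
    then have "1 - 1 / (real n + 1) \<le> frac (real i * \<alpha>)" by (simp add: field_simps)
    moreover have "frac (real i * \<alpha>) < 1" by (rule frac_lt_1)
    ultimately have "\<bar>real i * \<alpha> - of_int (\<lfloor>real i * \<alpha>\<rfloor> + 1)\<bar> \<le> 1 / (real n + 1)"
      by (simp add: frac_def abs_if)
    with \<open>i \<noteq> 0\<close> i(1) show thesis by (intro that[of "int i" "\<lfloor>real i * \<alpha>\<rfloor> + 1"]) auto
  next
    case False
    then obtain i j where ij: "i < j" "j \<le> n" "g i = g j"
      by (auto simp: inj_on_def) (metis linorder_neqE_nat)
    have "\<bar>(real n + 1) * frac (real j * \<alpha>) - (real n + 1) * frac (real i * \<alpha>)\<bar> \<le> 1"
      using g_floor[of i] g_floor[of j] ij(3) by auto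
    then have "(real n + 1) * \<bar>frac (real j * \<alpha>) - frac (real i * \<alpha>)\<bar> \<le> 1"
      by (simp flip: right_diff_distrib add: abs_mult)
    then have "\<bar>frac (real j * \<alpha>) - frac (real i * \<alpha>)\<bar> \<le> 1 / (real n + 1)"
      by (simp add: field_simps)
    then have "\<bar>of_int (int j - int i) * \<alpha> - of_int (\<lfloor>real j * \<alpha>\<rfloor> - \<lfloor>real i * \<alpha>\<rfloor>)\<bar> \<le> 1 / (real n + 1)"
      by (simp add: frac_def algebra_simps)
    with ij show thesis by (intro that[of "int j - int i" "\<lfloor>real j * \<alpha>\<rfloor> - \<lfloor>real i * \<alpha>\<rfloor>"]) auto
  qed
qed

text \<open>
  Two-term weighted inequality of arithmetic and geometric means, in logarithmic form. It follows from
  \<open>exp x \<ge> 1 + x\<close>, applied to the deviations from the weighted mean of \<open>u\<close> and \<open>v\<close>.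
\<close>

lemma exp_weighted_mean_le:
  fixes s t u v :: real
  assumes "0 \<le> s" "0 \<le> t" "s + t = 1"
  shows "exp (s * u + t * v) \<le> s * exp u + t * exp v"
proof -
  define m where "m = s * u + t * v"
  have "1 = s * (1 + (u - m)) + t * (1 + (v - m))"
  proof -
    have "s * (1 + (u - m)) + t * (1 + (v - m)) = (s + t) * (1 - m) + m" by (simp add: m_def algebra_simps)
    then show ?thesis using assms(3) by simp
  qed
  also have "\<dots> \<le> s * exp (u - m) + t * exp (v - m)"
    using assms exp_ge_add_one_self by (intro add_mono mult_left_mono) auto
  finally have "exp m * 1 \<le> exp m * (s * exp (u - m) + t * exp (v - m))" by (intro mult_left_mono) auto
  also have "\<dots> = s * exp u + t * exp v" by (simp add: algebra_simps flip: exp_add)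
  finally show ?thesis by (simp add: m_def)
qed

text \<open>
  How far the arithmetic mean of \<open>y\<close> and \<open>r\<close> copies of \<open>x\<close> can be above the geometric mean. The gap is at
  most \<open>r (\<surd>x - \<surd>y)\<^sup>2\<close>, and \<open>\<surd>x - \<surd>y = (x - y)/(\<surd>x + \<surd>y)\<close>. The first bound again is an instance of the weighted inequality of means, now with \<open>y\<close> and the
  geometric mean \<open>h\<close> as the two terms, whose weighted geometric mean is \<open>\<surd>(x y)\<close>.
\<close>

lemma am_gm_gap:
  fixes x y :: real and r :: nat
  assumes "0 < x" "0 < y" "1 \<le> r"
  defines "g \<equiv> (real r + 1) * (y * x ^ r) powr (1 / (real r + 1))"
  shows "g \<le> y + real r * x"
    and "y + real r * x - g \<le> real r * (y - x)\<^sup>2 / (4 * sqrt (x * y))"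
proof -
  define u v where "u = ln x" and "v = ln y"
  have xy: "x = exp u" "y = exp v" using assms by (auto simp: u_def v_def)
  define h where "h = exp ((v + real r * u) / (real r + 1))"
  have g: "g = (real r + 1) * h"
  proof -
    have "y * x ^ r = exp (v + real r * u)"
      by (simp add: xy exp_add exp_of_nat_mult)
    then show ?thesis unfolding g_def h_def by (simp add: powr_def)
  qed
  have "exp (real r / (real r + 1) * u + 1 / (real r + 1) * v)
      \<le> real r / (real r + 1) * x + 1 / (real r + 1) * y"
    unfolding xy by (intro exp_weighted_mean_le) (auto simp: field_simps)
  then have "h \<le> (real r * x + y) / (real r + 1)"
    by (simp add: h_def add_divide_distrib add.commute)
  then show "g \<le> y + real r * x" unfolding g by (simp add: field_simps)
  define s where "s = exp ((u + v) / 2)"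
  have s: "sqrt (x * y) = s" "s > 0" "s\<^sup>2 = x * y"
    by (auto simp: s_def xy exp_add [symmetric] power2_eq_square intro!: real_sqrt_unique)
  have "exp ((real r - 1) / (2 * real r) * v + (real r + 1) / (2 * real r) * ((v + real r * u) / (real r + 1)))
      \<le> (real r - 1) / (2 * real r) * y + (real r + 1) / (2 * real r) * h"
    unfolding xy h_def using assms(3) by (intro exp_weighted_mean_le) (auto simp: field_simps)
  also have "(real r - 1) / (2 * real r) * v + (real r + 1) / (2 * real r) * ((v + real r * u) / (real r + 1))
      = (u + v) / 2" using assms(3) by (simp add: divide_simps) (simp add: algebra_simps)
  also have "(real r - 1) / (2 * real r) * y + (real r + 1) / (2 * real r) * h
     = ((real r - 1) * y + g) / (2 * real r)" using assms(3) by (simp add: g field_simps)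
  finally have "2 * real r * s \<le> (real r - 1) * y + g"
    using assms(3) by (simp add: s_def field_simps)
  then have "y + real r * x - g \<le> real r * (x + y - 2 * s)" by (simp add: algebra_simps)
  also have "x + y - 2 * s \<le> (y - x)\<^sup>2 / (4 * s)"
  proof -
    have "(x + y - 2 * s) * (x + y + 2 * s) = (y - x)\<^sup>2" using s(3) by (simp add: power2_eq_square algebra_simps)
    moreover have nonneg: "0 \<le> x + y - 2 * s"
    proof -
      have "(2 * s)\<^sup>2 \<le> (x + y)\<^sup>2"
      proof -
        have "(x + y)\<^sup>2 - (2 * s)\<^sup>2 = (x - y)\<^sup>2" using s(3) by (simp add: power2_eq_square algebra_simps)
        then show ?thesis by (metis diff_ge_0_iff_ge zero_le_power2)
      qed
      then have "2 * s \<le> x + y" using assms(1,2) by (intro power2_le_imp_le[of "2 * s" "x + y"]) auto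
      then show ?thesis by simp
    qed
    moreover have "(x + y - 2 * s) * (4 * s) \<le> (x + y - 2 * s) * (x + y + 2 * s)"
      using nonneg by (intro mult_left_mono) auto
    ultimately show ?thesis using s(2) by (simp add: field_simps)
  qed
  finally show "y + real r * x - g \<le> real r * (y - x)\<^sup>2 / (4 * sqrt (x * y))"
    using assms(3) s(1) by simp
qed

text \<open>
  Otherwise \<open>p\<^bsup>r-1\<^esup> q \<le> r b < r p\<close>, but \<open>q \<ge> 2\<close> and \<open>r \<le> 2\<^bsup>r-1\<^esup> \<le> 2 p\<^bsup>r-2\<^esup>\<close>.
\<close>

lemma not_dvd_linear_multiple:
  fixes p q b :: int and r :: nat
  assumes "1 < r" "1 < p" "1 < q" "0 < b" "b < p"
  shows "\<not> p ^ r * q dvd int r * b * p"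
proof
  assume "p ^ r * q dvd int r * b * p"
  then have "p ^ r * q \<le> int r * b * p" using assms by (intro zdvd_imp_le) auto
  moreover have "int r * b * p < int r * p * p" using assms by simp
  moreover have "int r \<le> 2 ^ (r - 1)"
  proof -
    have "r - 1 < 2 ^ (r - 1)" by (rule less_exp)
    then have "r \<le> 2 ^ (r - 1)" using assms(1) by linarith
    then have "int r \<le> int (2 ^ (r - 1))" by (simp only: of_nat_le_iff)
    then show ?thesis by simp
  qed
  moreover have "(2::int) ^ (r - 1) * p * p \<le> p ^ r * q"
  proof -
    define k where "k = r - 2"
    have k: "r = Suc (Suc k)" using assms(1) by (simp add: k_def)
    have "(2::int) ^ k \<le> p ^ k" using assms by (intro power_mono) auto
    then have "2 ^ k * 2 \<le> p ^ k * q" using assms by (intro mult_mono) auto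
    then have "(2 ^ k * 2) * (p * p) \<le> (p ^ k * q) * (p * p)" using assms by (intro mult_right_mono) auto
    then show ?thesis by (simp add: k algebra_simps)
  qed
  moreover have "int r * p * p \<le> 2 ^ (r - 1) * p * p"
    using assms calculation(3) by (intro mult_right_mono) auto
  ultimately show False by linarith
qed

lemma two_powr_eq_exp: "2 powr y = exp (y * ln 2)" for y :: real
  by (simp add: powr_def)

text \<open>
  The heart of the correctness proof. All quantities are written as exponentials in \<open>x = ln X\<close>,
  \<open>t = (j ln 2)/6\<close> and \<open>d = ln p - x - 6 t \<in> [0, ln 2]\<close>; this makes the estimates linear in
  \<open>x\<close>, \<open>t\<close>, \<open>d\<close>, \<open>r t\<close> and \<open>r d\<close>.
\<close>

lemma lehman_main_finds_factor:
  fixes N p q :: int and r :: nat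
  assumes N: "N = p ^ r * q" and r: "1 < r" and p1: "1 < p" and q1: "1 < q"
  assumes pX: "of_int N powr (1 / (real r + 2)) < of_int p"
    and qX: "of_int N powr (1 / (real r + 2)) < of_int q"
  shows "lehman_main N r \<noteq> None"
proof -
  have N0: "N > 1"
  proof -
    have "1 < p ^ r" using p1 r by (intro one_less_power) auto
    then show ?thesis unfolding N using q1 by (rule less_1_mult)
  qed
  define x where "x = ln (real_of_int N) / (real r + 2)"
  have X: "real_of_int N powr (1 / (real r + 2)) = exp x" using N0 by (simp add: powr_def x_def)
  have lnN: "ln (real_of_int N) = (real r + 2) * x" by (simp add: x_def)
  have x0: "0 < x" unfolding x_def using N0 by simp
  \<comment> \<open>the \<open>j\<close> with \<open>X 2\<^sup>j \<le> p < X 2\<^bsup>j+1\<^esup>\<close>\<close>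
  define J where "J = \<lfloor>log 2 (of_int p / exp x)\<rfloor>"
  define t where "t = real_of_int J * ln 2 / 6"
  define d where "d = ln (real_of_int p) - x - 6 * t"
  have log_p: "log 2 (of_int p / exp x) * ln 2 = ln (of_int p) - x"
    using p1 by (simp add: log_def ln_div)
  have p_gt: "ln (of_int p) > x" using pX p1 unfolding X by (metis dual_order.strict_trans exp_gt_zero exp_less_cancel_iff exp_ln)
  then have logpos: "0 < log 2 (of_int p / exp x)" using log_p
    by (smt (verit) ln_gt_zero zero_less_mult_pos2)
  then have J0: "0 \<le> J" by (simp add: J_def)
  then have t0: "0 \<le> t" by (simp add: t_def)
  have d0: "0 \<le> d" and d1: "d \<le> ln 2"
  proof -
    have "of_int J * ln 2 \<le> log 2 (of_int p / exp x) * ln 2" by (simp add: J_def)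
    then show "0 \<le> d" by (simp add: d_def t_def log_p)
    have "log 2 (of_int p / exp x) * ln 2 \<le> (of_int J + 1) * ln 2"
      by (intro mult_right_mono) (auto simp: J_def)
    then show "d \<le> ln 2" unfolding log_p by (simp add: d_def t_def algebra_simps)
  qed
  have lnp: "ln (of_int p) = x + 6 * t + d" by (simp add: d_def)
  have "real r * ln (of_int p) + ln (of_int q) = ln (real_of_int N)"
    unfolding N using p1 q1 by (simp add: ln_mult ln_realpow)
  then have lnq: "ln (of_int q) = 2 * x - 6 * (real r * t) - real r * d"
    by (simp add: lnp lnN algebra_simps)
  have p: "of_int p = exp (x + 6 * t + d)" unfolding lnp[symmetric] using p1 by simp
  have q: "of_int q = exp (2 * x - 6 * (real r * t) - real r * d)" unfolding lnq[symmetric] using q1 by simp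
  \<comment> \<open>this is \<open>q > X\<close>; it bounds \<open>j\<close> and gives \<open>B \<ge> 1\<close>\<close>
  have rt: "6 * (real r * t) + real r * d < x" using qX unfolding X q by simp
  have rd0: "0 \<le> real r * d" using d0 by simp
  have rd1: "real r * d \<le> real r * ln 2" using d1 by (intro mult_left_mono) auto
  have rt2: "2 * t \<le> real r * t" using t0 r by (intro mult_right_mono) auto
  have rx2: "2 * x \<le> real r * x" using x0 r by (intro mult_right_mono) auto
  have J_mem: "J \<in> set [0..\<lfloor>1 / (real r * (real r + 2)) * log 2 (real_of_int N)\<rfloor>]"
  proof -
    have "1 / (real r * (real r + 2)) * log 2 (real_of_int N) = x / (real r * ln 2)"
      using r by (simp add: log_def lnN)
    moreover have "of_int J * (real r * ln 2) \<le> x"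
      using rt rd0 by (simp add: t_def algebra_simps)
    then have "of_int J \<le> x / (real r * ln 2)" using r by (simp add: field_simps)
    ultimately show ?thesis using J0 by (simp add: le_floor_iff)
  qed
  define B where "B = real_of_int N powr (1 / (real r + 2)) * 2 powr (- (2 * real r + 1) * real_of_int J / 3)"
  have B: "B = exp (x - (4 * (real r * t) + 2 * t))"
    unfolding B_def X two_powr_eq_exp exp_add [symmetric] by (simp add: t_def field_simps)
  have B1: "1 \<le> B" unfolding B using rt rt2 rd0 t0 by simp
  define n where "n = nat \<lfloor>B\<rfloor>"
  have n1: "1 \<le> n" using B1 unfolding n_def by (simp add: le_nat_floor)
  have nB: "real n \<le> B" "B < real n + 1" using B1 by (auto simp: n_def)
  \<comment> \<open>\<open>B\<close> is the bound on \<open>b\<close> before rounding\<close>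
  obtain b a :: int where b1: "1 \<le> b" and bn: "b \<le> int n"
    and ba: "\<bar>of_int b * (of_int p / of_int q) - of_int a\<bar> \<le> 1 / (real n + 1)"
    using dirichlet_approximation[OF n1] by metis
  \<comment> \<open>\<open>r \<bar>e\<bar> / (r + 1)\<close> is the distance of the root from the centre, and \<open>e\<^sup>2\<close> controls \<open>u - G\<close>\<close>
  define e where "e = a * q - b * p"
  have n1B: "1 / (real n + 1) < 1 / B" using nB B1 by (intro divide_strict_left_mono) auto
  have bB: "of_int b \<le> B" using bn nB by linarith
  have ratio: "of_int p / of_int q = exp (- x + 6 * t + d + 6 * (real r * t) + real r * d)"
    unfolding p q exp_diff[symmetric] by (simp add: algebra_simps)
  have a1: "1 \<le> a"
  proof -
    have "1 / B \<le> of_int p / of_int q"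
      unfolding ratio B exp_minus[symmetric] inverse_eq_divide[symmetric] using t0 rt2 d0 rd0 by simp
    also have "\<dots> \<le> of_int b * (of_int p / of_int q)" using b1 p1 q1 by (simp add: field_simps)
    finally have "0 < real_of_int a" using ba n1B by linarith
    then show ?thesis by simp
  qed
  define T where "T = 2 powr ((real r + 2) * real_of_int J / 3 + real r + 1)"
  have "a \<le> \<lceil>T\<rceil>"
  proof -
    have "of_int b * (of_int p / of_int q) \<le> B * (of_int p / of_int q)"
      using bB p1 q1 by (intro mult_right_mono) auto
    also have "\<dots> = exp (4 * t + d + 2 * (real r * t) + real r * d)"
      unfolding ratio B exp_add[symmetric] by (simp add: algebra_simps)
    also have "\<dots> \<le> exp (2 * (real r * t) + 4 * t + real r * ln 2 + ln 2)"
      using rd1 d1 by simp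
    also have "\<dots> = T" unfolding T_def two_powr_eq_exp by (simp add: t_def field_simps)
    finally have "of_int a \<le> T + 1 / (real n + 1)" using ba by linarith
    also have "\<dots> < T + 1" using n1 by simp
    finally show ?thesis by linarith
  qed
  then have a_mem: "a \<in> set [1..\<lceil>2 powr ((real r + 2) * real_of_int J / 3 + real r + 1)\<rceil>]"
    using a1 by (simp add: T_def)
  have b_mem: "b \<in> set [1..\<lfloor>real_of_int N powr (1 / (real r + 2))
                * 2 powr (- (2 * real r + 1) * real_of_int J / 3)\<rfloor>]"
    using b1 bB unfolding B_def by (simp only: set_upto atLeastAtMost_iff le_floor_iff)
  have e: "\<bar>of_int e\<bar> \<le> of_int q / B"
  proof -
    have "of_int e = - (of_int q * (of_int b * (of_int p / of_int q) - real_of_int a))"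
      using q1 by (simp add: e_def field_simps)
    then have "\<bar>real_of_int e\<bar> = of_int q * \<bar>of_int b * (of_int p / of_int q) - real_of_int a\<bar>"
      using q1 by (simp add: abs_mult)
    also have "\<dots> \<le> of_int q * (1 / B)" using ba n1B q1 by (intro mult_left_mono) auto
    finally show ?thesis by simp
  qed
  have qB: "of_int q / B = exp (x - 2 * (real r * t) + 2 * t - real r * d)"
    unfolding q B exp_diff[symmetric] by (simp add: algebra_simps)
  define u where "u = a * q + int r * (b * p)"
  have pos: "0 < real_of_int (b * p)" "0 < real_of_int (a * q)" using a1 b1 p1 q1 by auto
  have G: "lehman_G N r a b = (real r + 1) * (real_of_int (a * q) * real_of_int (b * p) ^ r) powr (1 / (real r + 1))"
    unfolding lehman_G_def N by (simp add: power_mult_distrib algebra_simps)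
  have r1: "1 \<le> r" using r by simp
  note gap = am_gm_gap[OF pos r1, folded G]
  have uG: "lehman_G N r a b \<le> of_int u" using gap(1) by (simp add: u_def)
  have uU: "of_int u \<le> lehman_G N r a b + lehman_U N r J a b"
  proof -
    have "of_int u - lehman_G N r a b \<le> real r * (of_int e)\<^sup>2 / (4 * sqrt (of_int (b * p) * of_int (a * q)))"
      using gap(2) by (simp add: u_def e_def)
    also have "\<dots> \<le> real r * (of_int q / B)\<^sup>2 / (4 * sqrt (of_int (b * p) * of_int (a * q)))"
    proof (intro divide_right_mono mult_left_mono)
      have "\<bar>real_of_int e\<bar>\<^sup>2 \<le> (of_int q / B)\<^sup>2" using e by (intro power_mono) auto
      then show "(real_of_int e)\<^sup>2 \<le> (of_int q / B)\<^sup>2" by simp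
    qed (use pos in auto)
    also have "\<dots> = real r / 4 * ((of_int q / B)\<^sup>2 * (of_int p * of_int q) powr (- 1/2)) * of_int (a * b) powr (- 1/2)"
      using a1 b1 p1 q1 by (simp add: powr_half_sqrt powr_minus real_sqrt_mult field_simps)
    also have "(of_int q / B)\<^sup>2 * (of_int p * of_int q) powr (- 1/2)
       = exp (x / 2 - real r * t + t - d / 2 - 3 / 2 * (real r * d))"
    proof -
      have "(of_int p * of_int q) powr (- 1/2) = exp (- (x + 6 * t + d + (2 * x - 6 * (real r * t) - real r * d)) / 2)"
        unfolding p q exp_add[symmetric] powr_def by (simp add: field_simps)
      moreover have "(of_int q / B)\<^sup>2 = exp (2 * (x - 2 * (real r * t) + 2 * t - real r * d))"
        unfolding qB by (rule exp_double[symmetric])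
      ultimately show ?thesis by (simp add: exp_add[symmetric] field_simps)
    qed
    also have "\<dots> \<le> exp (x / 2 - real r * t + t)" unfolding exp_le_cancel_iff using d0 rd0 by linarith
    also have "\<dots> = real_of_int N powr (1 / (2 * (real r + 2))) * (2 * 2 powr (- (real r - 1) * real_of_int J / 6 - 1))"
    proof -
      have "real_of_int N powr (1 / (2 * (real r + 2))) = exp (x / 2)"
        using N0 by (simp add: powr_def x_def)
      moreover have "2 * 2 powr (- (real r - 1) * real_of_int J / 6 - 1) = exp (- (real r * t) + t)"
      proof -
        have "- (real r - 1) * real_of_int J / 6 * ln 2 = - (real r * t) + t"
          by (simp add: t_def field_simps)
        then show ?thesis by (simp add: powr_diff two_powr_eq_exp)
      qed
      ultimately show ?thesis by (simp add: exp_add[symmetric])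
    qed
    finally have "of_int u - lehman_G N r a b \<le> real r / 2 * (real_of_int N powr (1 / (2 * (real r + 2))) * 2 powr (- (real r - 1) * real_of_int J / 6 - 1)
       * of_int (a * b) powr (- 1/2))"
      using r1 by (simp add: mult_left_mono mult_right_mono mult_ac)
    also have "\<dots> \<le> real r powr (real r + 3/2) * (real_of_int N powr (1 / (2 * (real r + 2))) * 2 powr (- (real r - 1) * real_of_int J / 6 - 1)
       * of_int (a * b) powr (- 1/2))"
    proof (intro mult_right_mono)
      have "real r / 2 \<le> real r powr 1" using r1 by simp
      also have "\<dots> \<le> real r powr (real r + 3/2)" using r1 by (intro powr_mono) auto
      finally show "real r / 2 \<le> real r powr (real r + 3/2)" .
    qed auto
    finally show ?thesis by (simp add: lehman_U_def mult_ac)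
  qed
  have u_mem: "u \<in> set [\<lceil>lehman_G N r a b\<rceil>..\<lfloor>lehman_G N r a b + lehman_U N r J a b\<rfloor>]"
    using uG uU by (simp add: ceiling_le_iff le_floor_iff)
  define z where "z = int r * b * p"
  define c where "c = real r * real_of_int u / (real r + 1)"
  have zc: "\<bar>of_int z - c\<bar> \<le> lehman_L N r J"
  proof -
    have "of_int z - c = - (real r / (real r + 1) * of_int e)"
      by (simp add: c_def z_def u_def e_def field_simps)
    then have "\<bar>of_int z - c\<bar> = real r / (real r + 1) * \<bar>of_int e\<bar>" by (simp add: abs_mult)
    also have "\<dots> \<le> real r / (real r + 1) * (of_int N powr (1/4) * 2 powr (- real_of_int J / 3))"
    proof (intro mult_left_mono)
      have "\<bar>real_of_int e\<bar> \<le> exp (x - 2 * (real r * t) + 2 * t - real r * d)" using e qB by simp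
      also have "\<dots> \<le> exp ((real r + 2) * x / 4 - 2 * t)"
        using rt2 rd0 rx2 by (simp add: algebra_simps)
      also have "\<dots> = of_int N powr (1/4) * 2 powr (- real_of_int J / 3)"
        unfolding two_powr_eq_exp using N0 by (simp add: powr_def lnN t_def exp_add[symmetric])
      finally show "\<bar>real_of_int e\<bar> \<le> of_int N powr (1/4) * 2 powr (- real_of_int J / 3)" .
    qed auto
    finally show ?thesis by (simp add: lehman_L_def mult_ac)
  qed
  have z_mem: "z \<in> set [\<lceil>c - lehman_L N r J\<rceil>..\<lfloor>c + lehman_L N r J\<rfloor>]"
    unfolding set_upto atLeastAtMost_iff ceiling_le_iff le_floor_iff using zc by linarith
  have z0: "0 < z" using r b1 p1 by (simp add: z_def)
  have root: "lehman_poly N r a b u z = 0"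
    by (simp add: lehman_poly_def z_def u_def N power_mult_distrib algebra_simps)
  have "nontrivial_factor (gcd z N) N"
  proof -
    have "p dvd N" using r unfolding N by (intro dvd_mult2 dvd_power) auto
    then have "p dvd gcd z N" by (simp add: z_def)
    then have "1 < gcd z N" using z0 p1 by (smt (verit) gcd_pos_int zdvd_imp_le)
    moreover have "gcd z N \<noteq> N"
    proof
      assume "gcd z N = N"
      then have "N dvd z" by (metis gcd_dvd1)
      moreover have "b < p"
      proof -
        have "of_int b \<le> B" by (rule bB)
        also have "\<dots> \<le> exp x" unfolding B exp_le_cancel_iff using t0 rt2 by linarith
        also have "\<dots> < of_int p" using pX X by simp
        finally show ?thesis by simp
      qed
      ultimately show False using not_dvd_linear_multiple[of r p q b] r p1 q1 b1 by (simp add: N z_def)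
    qed
    moreover have "gcd z N \<le> N" using N0 by (simp add: zdvd_imp_le)
    ultimately show ?thesis by (simp add: nontrivial_factor_def)
  qed
  then have found: "lehman_test N r J a b u \<noteq> None"
    using z_mem z0 root by (auto simp: lehman_test_def Let_def find_None_iff c_def)
  show ?thesis
  proof
    assume "lehman_main N r = None"
    note this[unfolded lehman_main_def first_some_eq_None_iff, rule_format, OF J_mem a_mem b_mem u_mem]
    with found show False by contradiction
  qed
qed

lemma floor_powr_of_power:
  fixes p :: int and r :: nat
  assumes "0 < p" "0 < r"
  shows "\<lfloor>real_of_int (p ^ r) powr (1 / real r)\<rfloor> = p"
proof -
  have "real_of_int (p ^ r) powr (1 / real r) = real_of_int p"
    using assms by (simp add: powr_powr flip: powr_realpow)
  then show ?thesis by simp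
qed

lemma lehman_correct:
  fixes N :: int and r :: nat
  assumes r: "1 < r" and N: "1 < N"
  shows "case lehman N r of Some d \<Rightarrow> nontrivial_factor d N | None \<Rightarrow> power_free r N"
proof -
  define s where "s = \<lfloor>real_of_int N powr (1 / real r)\<rfloor>"
  define X where "X = real_of_int N powr (1 / (real r + 2))"
  have lehman_eq: "lehman N r = (if s ^ r = N then Some s
      else case find (\<lambda>n. n dvd N) [2..\<lfloor>X\<rfloor>] of Some n \<Rightarrow> Some n | None \<Rightarrow> lehman_main N r)"
    unfolding lehman_def Let_def s_def X_def by (rule refl)
  show ?thesis
  proof (cases "lehman N r")
    case (Some d)
    consider (power) "s ^ r = N" "d = s"
      | (small) "find (\<lambda>n. n dvd N) [2..\<lfloor>X\<rfloor>] = Some d"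
      | (main) "lehman_main N r = Some d"
      using Some unfolding lehman_eq
      by (cases "s ^ r = N"; cases "find (\<lambda>n. n dvd N) [2..\<lfloor>X\<rfloor>]") auto
    then have "nontrivial_factor d N"
    proof cases
      case power
      have "0 \<le> s" by (simp add: s_def)
      moreover have "s \<noteq> 0" "s \<noteq> 1" using power(1) N r by (auto simp: power_0_left)
      ultimately have s1: "1 < s" by linarith
      then have "s ^ 1 < s ^ r" using r by (intro power_strict_increasing) auto
      moreover have "s dvd s ^ r" using r by (intro dvd_power) auto
      ultimately show ?thesis using power s1 by (auto simp: nontrivial_factor_def)
    next
      case small
      then have d: "d dvd N" "2 \<le> d" "d \<le> \<lfloor>X\<rfloor>"
        by (auto simp: find_Some_iff dest!: nth_mem)
      have "X < real_of_int N powr 1" unfolding X_def using N by (intro powr_less_mono) auto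
      then have "X < real_of_int N" using N by simp
      then have "d < N" using d(3) by linarith
      with d show ?thesis by (simp add: nontrivial_factor_def)
    next
      case main
      then show ?thesis
        by (auto simp: lehman_main_def lehman_test_def Let_def find_Some_iff elim!: first_some_SomeE)
    qed
    with Some show ?thesis by simp
  next
    case None
    then have no_power: "s ^ r \<noteq> N" unfolding lehman_eq by auto
    with None have no_small: "find (\<lambda>n. n dvd N) [2..\<lfloor>X\<rfloor>] = None"
      unfolding lehman_eq by (cases "find (\<lambda>n. n dvd N) [2..\<lfloor>X\<rfloor>]") auto
    with None no_power have no_main: "lehman_main N r = None" unfolding lehman_eq by simp
    have large: "X < real_of_int d" if "d dvd N" "1 < d" for d
    proof (rule ccontr)
      assume "\<not> X < real_of_int d"
      then have "d \<in> set [2..\<lfloor>X\<rfloor>]" using that(2) by (simp add: le_floor_iff)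
      with no_small that(1) show False by (auto simp: find_None_iff)
    qed
    have "power_free r N"
      unfolding power_free_def
    proof (intro notI, elim exE conjE)
      fix p q assume p: "1 < p" and Npq: "N = p ^ r * q"
      have "0 < p ^ r" using p by simp
      with N Npq have q: "0 < q" using zero_less_mult_pos[of "p ^ r" q] by simp
      show False
      proof (cases "q = 1")
        case True
        then have "s = p" using floor_powr_of_power[of p r] p r by (simp add: s_def Npq)
        with no_power True Npq show False by simp
      next
        case False
        have "p dvd N" using r unfolding Npq by (intro dvd_mult2 dvd_power) auto
        with p have "X < real_of_int p" by (intro large)
        moreover have "X < real_of_int q" using q False by (intro large) (auto simp: Npq)
        ultimately show False
          using lehman_main_finds_factor[OF Npq r p] q False no_main by (simp add: X_def)
      qed
    qed
    with None show ?thesis by simp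
  qed
qed

section \<open>Values computed by the arithmetic subroutines\<close>

lemma result_return [simp]: "result (return x) = x"
  by (simp add: return_def)

lemma result_elementary [simp]:
  "result (iadd x y) = x + y" "result (isub x y) = x - y"
  "result (ileq x y) = (x \<le> y)" "result (ieq x y) = (x = y)"
  "result (ishl x k) = x * 2 ^ k" "result (ishr x k) = x div 2 ^ k"
  "result (ilen x) = bits x" "result (imul M x y) = x * y"
  by (simp_all add: iadd_def isub_def ileq_def ieq_def ishl_def ishr_def ilen_def imul_def)

lemma result_ipow [simp]: "result (ipow M x k) = x ^ k"
  by (induction k) (simp_all add: mult.commute)

lemma result_idivmod_loop:
  assumes "0 < y" "0 \<le> m" "m < y * 2 ^ i"
  shows "result (idivmod_loop i y q m) = (q + m div y, m mod y)"
  using assms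
proof (induction i arbitrary: q m)
  case 0
  then show ?case by (simp add: div_pos_pos_trivial)
next
  case (Suc i)
  show ?case
  proof (cases "y * 2 ^ i \<le> m")
    case True
    have "result (idivmod_loop i y (q + 2 ^ i) (m - y * 2 ^ i))
        = (q + 2 ^ i + (m - y * 2 ^ i) div y, (m - y * 2 ^ i) mod y)"
      using Suc.prems True by (intro Suc.IH) auto
    moreover have "(m - y * 2 ^ i) div y = m div y - 2 ^ i"
      using Suc.prems(1) div_mult_self2[of y m "- (2 ^ i)"] by simp
    moreover have "(m - y * 2 ^ i) mod y = m mod y"
      using mod_mult_self2[of m y "- (2 ^ i)"] by simp
    ultimately show ?thesis using True by simp
  next
    case False
    then show ?thesis using Suc by simp
  qed
qed

lemma less_shifted_divisor:
  assumes "0 < y"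
  shows "x < y * 2 ^ (bits x - bits y + 1)"
proof -
  let ?k = "bits x - bits y + 1"
  have "x < 2 ^ bits x" by (rule less_two_power_bits)
  also have "(2::int) ^ bits x \<le> 2 ^ (bits y - 1 + ?k)"
    by (intro power_increasing) auto
  also have "\<dots> = 2 ^ (bits y - 1) * 2 ^ ?k" by (rule power_add)
  also have "\<dots> \<le> y * 2 ^ ?k" using two_power_bits_le[OF assms] by (intro mult_right_mono) auto
  finally show ?thesis .
qed

lemma result_idivmod:
  assumes "0 \<le> x" "0 < y"
  shows "result (idivmod x y) = (x div y, x mod y)"
  using result_idivmod_loop[OF assms(2,1) less_shifted_divisor[OF assms(2)], of 0]
  by (simp add: idivmod_def del: idivmod_loop.simps)

lemma igcd_unfold:
  "igcd x y = (if y \<le> 0 then bind_costed (ileq y 0) (\<lambda>_. return x)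
     else bind_costed (ileq y 0) (\<lambda>_. bind_costed (idivmod x y) (\<lambda>qm. igcd y (snd qm))))"
  by (subst igcd.simps) (simp add: bind_costed_def ileq_def)

lemma result_igcd:
  assumes "0 \<le> x" "0 \<le> y"
  shows "result (igcd x y) = gcd x y"
  using assms
proof (induction "nat y" arbitrary: x y rule: less_induct)
  case less
  show ?case
  proof (cases "y = 0")
    case True
    then show ?thesis using less.prems by (subst igcd_unfold) simp
  next
    case False
    then have y: "0 < y" using less.prems by simp
    have "result (igcd y (x mod y)) = gcd y (x mod y)"
      using y less.prems by (intro less.hyps) (auto simp: nat_less_iff)
    also have "\<dots> = gcd x y" by (metis gcd.commute gcd_red_int)
    finally show ?thesis using y less.prems by (subst igcd_unfold) (simp add: result_idivmod)
  qed
qed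

lemma result_floor_root_loop:
  assumes "0 < k" "0 \<le> x" "x ^ k \<le> n" "n < (x + 2 ^ i) ^ k"
  shows "0 \<le> result (floor_root_loop M k n i x) \<and> result (floor_root_loop M k n i x) ^ k \<le> n
    \<and> n < (result (floor_root_loop M k n i x) + 1) ^ k"
  using assms(2-4)
proof (induction i arbitrary: x)
  case (Suc i)
  show ?case
  proof (cases "(x + 2 ^ i) ^ k \<le> n")
    case True
    have "n < (x + 2 ^ i + 2 ^ i) ^ k" using Suc.prems(3) by (simp add: add.assoc)
    from Suc.IH[OF _ True this] show ?thesis using Suc.prems(1) True by simp
  next
    case False
    then show ?thesis using Suc.IH[of x] Suc.prems by simp
  qed
qed simp

lemma result_floor_root_bounds:
  assumes "0 < k" "0 \<le> n"
  shows "0 \<le> result (floor_root M k n)" "result (floor_root M k n) ^ k \<le> n"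
    "n < (result (floor_root M k n) + 1) ^ k"
proof -
  have "n < 2 ^ bits n" by (rule less_two_power_bits)
  also have "\<dots> \<le> (0 + 2 ^ bits n) ^ k" using assms(1) by (simp add: self_le_power)
  finally have "0 \<le> result (floor_root_loop M k n (bits n) 0) \<and>
      result (floor_root_loop M k n (bits n) 0) ^ k \<le> n \<and>
      n < (result (floor_root_loop M k n (bits n) 0) + 1) ^ k"
    using assms by (intro result_floor_root_loop) (auto simp: zero_power)
  then show "0 \<le> result (floor_root M k n)" "result (floor_root M k n) ^ k \<le> n"
    "n < (result (floor_root M k n) + 1) ^ k"
    by (simp_all add: floor_root_def)
qed

text \<open>
  Stated with \<open>\<lfloor>y\<^sup>k\<rfloor>\<close> so that it covers roots of rationals: \<open>\<lfloor>y\<rfloor>\<close> depends only on \<open>\<lfloor>y\<^sup>k\<rfloor>\<close>.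
\<close>

lemma result_floor_root:
  fixes y :: real
  assumes "0 < k" "0 \<le> y" "n = \<lfloor>y ^ k\<rfloor>"
  shows "result (floor_root M k n) = \<lfloor>y\<rfloor>"
proof -
  define z where "z = result (floor_root M k n)"
  have "0 \<le> n" using assms by simp
  note b = result_floor_root_bounds[OF assms(1) this, of M, folded z_def]
  have "real_of_int (z ^ k) \<le> y ^ k" using b(2) assms(3) by (metis le_floor_iff)
  then have "real_of_int z \<le> y" using assms(1,2)
    by (metis of_int_power power_mono_iff b(1) of_int_0_le_iff)
  moreover have "y ^ k < real_of_int ((z + 1) ^ k)" using b(3) assms(3) by (metis floor_less_iff)
  then have "y < real_of_int (z + 1)"
    using b(1) by (intro power_less_imp_less_base[of y k]) auto
  ultimately show ?thesis unfolding z_def[symmetric] by (intro floor_unique[symmetric]) auto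
qed

lemma result_ceiling_root:
  fixes y :: real
  assumes "0 < k" "0 \<le> y" "real_of_int n = y ^ k"
  shows "result (ceiling_root M k n) = \<lceil>y\<rceil>"
proof -
  have fl: "result (floor_root M k n) = \<lfloor>y\<rfloor>"
    using assms by (intro result_floor_root) (auto simp flip: assms(3))
  have "\<lfloor>y\<rfloor> ^ k = n \<longleftrightarrow> real_of_int \<lfloor>y\<rfloor> ^ k = y ^ k"
    unfolding assms(3)[symmetric] by (metis of_int_eq_iff of_int_power)
  also have "\<dots> \<longleftrightarrow> real_of_int \<lfloor>y\<rfloor> = y"
    using assms(1,2) by (intro power_eq_iff_eq_base) auto
  finally have *: "\<lfloor>y\<rfloor> ^ k = n \<longleftrightarrow> real_of_int \<lfloor>y\<rfloor> = y" .
  show ?thesis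
  proof (cases "real_of_int \<lfloor>y\<rfloor> = y")
    case True
    then have "\<lceil>y\<rceil> = \<lfloor>y\<rfloor>" by (metis ceiling_of_int)
    with True * fl show ?thesis by (simp add: ceiling_root_def)
  next
    case False
    then have "\<lceil>y\<rceil> = \<lfloor>y\<rfloor> + 1" by (intro ceiling_unique) (linarith, linarith)
    with False * fl show ?thesis by (simp add: ceiling_root_def)
  qed
qed

lemma bisect_unfold:
  "result (bisect right lo hi) = (if hi - lo \<le> 1 then (lo, hi)
     else if result (right ((lo + hi) div 2)) then result (bisect right ((lo + hi) div 2) hi)
     else result (bisect right lo ((lo + hi) div 2)))"
  by (subst bisect.simps) simp

text \<open>
  The hypothesis says that \<open>right\<close> never sends the search away from a point satisfying \<open>P\<close>; then no such point
  is lost, and the final interval has no integers besides its end points.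
\<close>

lemma result_bisect:
  assumes "lo \<le> hi"
    and "\<And>z x. lo \<le> z \<Longrightarrow> z \<le> hi \<Longrightarrow> P z \<Longrightarrow> lo < x \<Longrightarrow> x < hi \<Longrightarrow> if result (right x) then x \<le> z else z \<le> x"
  shows "lo \<le> fst (result (bisect right lo hi)) \<and> fst (result (bisect right lo hi)) \<le> snd (result (bisect right lo hi))
    \<and> snd (result (bisect right lo hi)) \<le> hi
    \<and> (\<forall>z. lo \<le> z \<and> z \<le> hi \<and> P z \<longrightarrow> z = fst (result (bisect right lo hi)) \<or> z = snd (result (bisect right lo hi)))"
  using assms
proof (induction "nat (hi - lo)" arbitrary: lo hi rule: less_induct)
  case less
  show ?case
  proof (cases "hi - lo \<le> 1")
    case True
    then show ?thesis using less.prems(1) by (subst (1 2 3 4 5 6) bisect_unfold) auto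
  next
    case False
    define mid where "mid = (lo + hi) div 2"
    have mid: "lo < mid" "mid < hi" using False by (auto simp: mid_def)
    show ?thesis
    proof (cases "result (right mid)")
      case True
      have eq: "result (bisect right lo hi) = result (bisect right mid hi)"
        using False True by (subst bisect_unfold) (simp add: mid_def)
      have "mid \<le> z" if "lo \<le> z" "z \<le> hi" "P z" for z
        using less.prems(2)[OF that mid] True by simp
      moreover have "mid \<le> fst (result (bisect right mid hi)) \<and> fst (result (bisect right mid hi)) \<le> snd (result (bisect right mid hi))
    \<and> snd (result (bisect right mid hi)) \<le> hi
    \<and> (\<forall>z. mid \<le> z \<and> z \<le> hi \<and> P z \<longrightarrow> z = fst (result (bisect right mid hi)) \<or> z = snd (result (bisect right mid hi)))"
      proof (rule less.hyps)
        show "nat (hi - mid) < nat (hi - lo)" "mid \<le> hi" using mid by auto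
        show "if result (right x) then x \<le> z else z \<le> x"
          if "mid \<le> z" "z \<le> hi" "P z" "mid < x" "x < hi" for z x
          using that mid by (intro less.prems(2)) auto
      qed
      ultimately show ?thesis unfolding eq using mid by (elim conjE, intro conjI allI impI) auto
    next
      case right: False
      have eq: "result (bisect right lo hi) = result (bisect right lo mid)"
        using False right by (subst bisect_unfold) (simp add: mid_def)
      have "z \<le> mid" if "lo \<le> z" "z \<le> hi" "P z" for z
        using less.prems(2)[OF that mid] right by simp
      moreover have "lo \<le> fst (result (bisect right lo mid)) \<and> fst (result (bisect right lo mid)) \<le> snd (result (bisect right lo mid))
    \<and> snd (result (bisect right lo mid)) \<le> mid
    \<and> (\<forall>z. lo \<le> z \<and> z \<le> mid \<and> P z \<longrightarrow> z = fst (result (bisect right lo mid)) \<or> z = snd (result (bisect right lo mid)))"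
      proof (rule less.hyps)
        show "nat (mid - lo) < nat (hi - lo)" "lo \<le> mid" using mid by auto
        show "if result (right x) then x \<le> z else z \<le> x"
          if "lo \<le> z" "z \<le> mid" "P z" "lo < x" "x < mid" for z x
          using that mid by (intro less.prems(2)) auto
      qed
      ultimately show ?thesis unfolding eq using mid by (elim conjE, intro conjI allI impI) auto
    qed
  qed
qed

lemma for_loop_unfold:
  "result (for_loop i hi body) = (if i \<le> hi then (case result (body i) of
      Some y \<Rightarrow> Some y | None \<Rightarrow> result (for_loop (i + 1) hi body)) else None)"
  by (subst for_loop.simps) (simp split: option.split)

lemma result_for_loop: "result (for_loop i hi body) = first_some (\<lambda>i. result (body i)) [i..hi]"
proof (induction "nat (hi + 1 - i)" arbitrary: i)
  case 0
  then show ?case by (subst for_loop_unfold) simp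
next
  case (Suc n)
  then show ?case by (subst for_loop_unfold, subst upto.simps) (simp split: option.split)
qed

lemma first_some_cong: "(\<And>x. x \<in> set xs \<Longrightarrow> f x = g x) \<Longrightarrow> first_some f xs = first_some g xs"
  by (induction xs) (auto split: option.splits)

lemma find_upto_eq_Some_iff:
  "find P [lo..hi] = Some x \<longleftrightarrow> lo \<le> x \<and> x \<le> hi \<and> P x \<and> (\<forall>y. lo \<le> y \<and> y < x \<longrightarrow> \<not> P y)"
proof (induction "nat (hi + 1 - lo)" arbitrary: lo)
  case 0
  then show ?case by auto
next
  case (Suc n)
  then have "find P [lo + 1..hi] = Some x \<longleftrightarrow> lo + 1 \<le> x \<and> x \<le> hi \<and> P x \<and> (\<forall>y. lo + 1 \<le> y \<and> y < x \<longrightarrow> \<not> P y)"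
    by (intro Suc.hyps) auto
  moreover have "lo \<le> hi" using Suc.hyps(2) by simp
  then have "[lo..hi] = lo # [lo + 1..hi]" by (subst upto.simps) simp
  moreover have "(\<forall>y. lo \<le> y \<and> y < x \<longrightarrow> \<not> P y)
      \<longleftrightarrow> (lo < x \<longrightarrow> \<not> P lo) \<and> (\<forall>y. lo + 1 \<le> y \<and> y < x \<longrightarrow> \<not> P y)"
    by (metis add1_zle_eq order_le_less)
  moreover have "lo < x \<longleftrightarrow> lo + 1 \<le> x" "lo \<le> x \<longleftrightarrow> x = lo \<or> lo + 1 \<le> x" by auto
  ultimately show ?case using \<open>lo \<le> hi\<close> by (cases "P lo"; cases "x = lo") auto
qed

lemma find_upto_eq_None_iff: "find P [lo..hi] = None \<longleftrightarrow> (\<forall>x. lo \<le> x \<and> x \<le> hi \<longrightarrow> \<not> P x)"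
  by (auto simp: find_None_iff)

lemma result_eval_poly [simp]: "result (eval_poly M r u K x) = x ^ r * (x - u) + K"
  by (simp add: Defs.eval_poly_def)

lemma result_try_candidate:
  assumes "1 < N" "0 \<le> x"
  shows "result (try_candidate M N r u K x) =
    (if x ^ r * (x - u) + K = 0 \<and> nontrivial_factor (gcd x N) N then Some (gcd x N) else None)"
proof -
  have "gcd x N \<le> N" using assms by (intro zdvd_imp_le) auto
  then have "nontrivial_factor (gcd x N) N \<longleftrightarrow> \<not> (gcd x N \<le> 1 \<or> N \<le> gcd x N)"
    by (auto simp: nontrivial_factor_def)
  then show ?thesis using assms by (simp add: try_candidate_def result_igcd gcd.commute)
qed

text \<open>
  Where the polynomial has at most one integer root, testing the two end points left by bisection
  amounts to a linear search.
\<close>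

lemma result_try_interval:
  fixes N u K lo hi :: int and r :: nat
  assumes N: "1 < N" and lo: "0 \<le> lo"
  defines "f \<equiv> \<lambda>x. x ^ r * (x - u) + K"
  assumes right: "\<And>z x. lo \<le> z \<Longrightarrow> z \<le> hi \<Longrightarrow> f z = 0 \<Longrightarrow> lo < x \<Longrightarrow> x < hi \<Longrightarrow>
      if result (right x) then x \<le> z else z \<le> x"
    and unique: "\<And>x y. lo \<le> x \<Longrightarrow> x < y \<Longrightarrow> y \<le> hi \<Longrightarrow> f x = 0 \<Longrightarrow> f y \<noteq> 0"
  shows "result (try_interval M N r u K right lo hi) =
    map_option (\<lambda>x. gcd x N) (find (\<lambda>x. f x = 0 \<and> nontrivial_factor (gcd x N) N) [lo..hi])"
proof (cases "lo \<le> hi")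
  case False
  then show ?thesis by (simp add: try_interval_def)
next
  case True
  define good where "good x \<longleftrightarrow> f x = 0 \<and> nontrivial_factor (gcd x N) N" for x
  define a b where "a = fst (result (bisect right lo hi))" and "b = snd (result (bisect right lo hi))"
  have ab: "lo \<le> a" "a \<le> b" "b \<le> hi"
    and root: "\<And>z. lo \<le> z \<Longrightarrow> z \<le> hi \<Longrightarrow> f z = 0 \<Longrightarrow> z = a \<or> z = b"
    using result_bisect[where P = "\<lambda>z. f z = 0" and right = right, OF True right]
    unfolding a_def b_def by blast+
  have candidate: "result (try_candidate M N r u K x) = (if good x then Some (gcd x N) else None)" if "lo \<le> x" for x
    using result_try_candidate[OF N, of x M r u K] lo that by (simp add: good_def f_def)
  have eq: "result (try_interval M N r u K right lo hi) =
      (if good a then Some (gcd a N) else if good b then Some (gcd b N) else None)"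
    using True ab candidate[of a] candidate[of b] by (simp add: try_interval_def a_def b_def)
  have find: "find good [lo..hi] = (if good a then Some a else if good b then Some b else None)"
  proof -
    consider "good a" | "\<not> good a" "good b" | "\<not> good a" "\<not> good b" by blast
    then show ?thesis
    proof cases
      case 1
      then have "find good [lo..hi] = Some a"
        using ab unique[of _ a] unfolding find_upto_eq_Some_iff good_def by auto
      with 1 show ?thesis by simp
    next
      case 2
      then have "find good [lo..hi] = Some b"
        using ab unique[of _ b] unfolding find_upto_eq_Some_iff good_def by auto
      with 2 show ?thesis by simp
    next
      case 3
      then have "find good [lo..hi] = None"
        using root unfolding find_upto_eq_None_iff good_def by blast
      with 3 show ?thesis by simp
    qed
  qed
  show ?thesis unfolding eq good_def[symmetric, abs_def] find by simp
qed

lemma trinomial_has_derivative: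
  fixes t u K :: real and r :: nat
  assumes "1 \<le> r"
  shows "((\<lambda>t. t ^ r * (t - u) + K) has_real_derivative
    t ^ (r - 1) * ((real r + 1) * t - real r * u)) (at t)"
proof -
  have "((\<lambda>t. t ^ r * (t - u) + K) has_real_derivative
      (real r * t ^ (r - 1) * (t - u) + t ^ r)) (at t)"
    by (auto intro!: derivative_eq_intros)
  also have "real r * t ^ (r - 1) * (t - u) + t ^ r = t ^ (r - 1) * ((real r + 1) * t - real r * u)"
    using assms by (cases r) (auto simp: algebra_simps)
  finally show ?thesis .
qed

lemma trinomial_decreasing:
  fixes x y u K :: real and r :: nat
  assumes r: "1 \<le> r" and xy: "0 \<le> x" "x < y" "(real r + 1) * y \<le> real r * u"
  shows "y ^ r * (y - u) + K < x ^ r * (x - u) + K"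
proof (rule DERIV_neg_imp_decreasing_open[OF xy(2)])
  fix t assume t: "x < t" "t < y"
  have "((\<lambda>t. t ^ r * (t - u) + K) has_real_derivative
      t ^ (r - 1) * ((real r + 1) * t - real r * u)) (at t)" using r by (rule trinomial_has_derivative)
  moreover have "t ^ (r - 1) * ((real r + 1) * t - real r * u) < 0"
  proof (rule mult_pos_neg)
    show "0 < t ^ (r - 1)" using t xy by simp
    have "(real r + 1) * t < (real r + 1) * y" using t by simp
    with xy(3) show "(real r + 1) * t - real r * u < 0" by linarith
  qed
  ultimately show "\<exists>d. ((\<lambda>t. t ^ r * (t - u) + K) has_real_derivative d) (at t) \<and> d < 0" by blast
qed (auto intro!: continuous_intros)

lemma trinomial_increasing:
  fixes x y u K :: real and r :: nat
  assumes r: "1 \<le> r" and xy: "0 \<le> x" "x < y" "real r * u \<le> (real r + 1) * x"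
  shows "x ^ r * (x - u) + K < y ^ r * (y - u) + K"
proof (rule DERIV_pos_imp_increasing_open[OF xy(2)])
  fix t assume t: "x < t" "t < y"
  have "((\<lambda>t. t ^ r * (t - u) + K) has_real_derivative
      t ^ (r - 1) * ((real r + 1) * t - real r * u)) (at t)" using r by (rule trinomial_has_derivative)
  moreover have "t ^ (r - 1) * ((real r + 1) * t - real r * u) > 0"
  proof (rule mult_pos_pos)
    show "0 < t ^ (r - 1)" using t xy by simp
    have "(real r + 1) * x < (real r + 1) * t" using t by simp
    with xy(3) show "(real r + 1) * t - real r * u > 0" by linarith
  qed
  ultimately show "\<exists>d. ((\<lambda>t. t ^ r * (t - u) + K) has_real_derivative d) (at t) \<and> d > 0" by blast
qed (auto intro!: continuous_intros)

text \<open>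
  The derivative of \<open>x\<^sup>r (x - u) + K\<close> changes its sign on the positive axis only at \<open>r u / (r + 1)\<close>.
\<close>

lemma trinomial_monotone_int:
  fixes x y u K :: int and r :: nat
  assumes "1 \<le> r" "0 \<le> x" "x < y"
  shows "(int r + 1) * y \<le> int r * u \<Longrightarrow> y ^ r * (y - u) + K < x ^ r * (x - u) + K"
    and "int r * u \<le> (int r + 1) * x \<Longrightarrow> x ^ r * (x - u) + K < y ^ r * (y - u) + K"
proof -
  assume "(int r + 1) * y \<le> int r * u"
  then have "real_of_int ((int r + 1) * y) \<le> real_of_int (int r * u)" by (simp only: of_int_le_iff)
  then have "real_of_int (y ^ r * (y - u) + K) < real_of_int (x ^ r * (x - u) + K)"
    using trinomial_decreasing[of r "of_int x" "of_int y" "of_int u" "of_int K"] assms by simp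
  then show "y ^ r * (y - u) + K < x ^ r * (x - u) + K" by (simp only: of_int_less_iff)
next
  assume "int r * u \<le> (int r + 1) * x"
  then have "real_of_int (int r * u) \<le> real_of_int ((int r + 1) * x)" by (simp only: of_int_le_iff)
  then have "real_of_int (x ^ r * (x - u) + K) < real_of_int (y ^ r * (y - u) + K)"
    using trinomial_increasing[of r "of_int x" "of_int y" "of_int u" "of_int K"] assms by simp
  then show "x ^ r * (x - u) + K < y ^ r * (y - u) + K" by (simp only: of_int_less_iff)
qed

lemma le_div_iff_int: "0 < k \<Longrightarrow> x \<le> n div k \<longleftrightarrow> k * x \<le> n" for k n x :: int
proof -
  assume k: "0 < k"
  have "n div k = \<lfloor>real_of_int n / real_of_int k\<rfloor>" by (rule floor_divide_of_int_eq[symmetric])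
  then have "x \<le> n div k \<longleftrightarrow> real_of_int x \<le> real_of_int n / real_of_int k"
    by (simp only: le_floor_iff)
  also have "\<dots> \<longleftrightarrow> real_of_int (k * x) \<le> real_of_int n" using k by (simp add: field_simps)
  finally show ?thesis by (simp only: of_int_le_iff)
qed

text \<open>
  Multiplying by \<open>r + 1\<close> turns the conditions \<open>c - L \<le> x\<close> and \<open>x \<le> c + L\<close> into comparisons of integers
  with \<open>F\<close>. The hypothesis \<open>0 < K\<close> ensures that \<open>0\<close>, which the program may test, is not a root.
\<close>

lemma result_test_u:
  fixes N F K u a b j :: int and r :: nat
  assumes r: "1 \<le> r" and N: "1 < N" and u: "0 \<le> u"
    and F: "F = \<lfloor>(real r + 1) * lehman_L N r j\<rfloor>"
    and K: "K = int r ^ r * a * b ^ r * N" and K0: "0 < K"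
  shows "result (test_u M N r F K u) = lehman_test N r j a b u"
proof -
  define L where "L = lehman_L N r j"
  have L0: "0 \<le> L" by (simp add: L_def lehman_L_def)
  have F0: "0 \<le> F" unfolding F using L0 by (simp add: L_def)
  define c where "c = real r * real_of_int u / (real r + 1)"
  define f where "f x = x ^ r * (x - u) + K" for x
  define good where "good x \<longleftrightarrow> f x = 0 \<and> nontrivial_factor (gcd x N) N" for x
  define t where "t = int r * u"
  have t0: "0 \<le> t" using u by (simp add: t_def)
  define d where "d = t - F"
  define lo where "lo = (if d \<le> 0 then 0 else (d + int r) div (int r + 1))"
  define cm where "cm = t div (int r + 1)"
  define c' where "c' = (if t mod (int r + 1) = 0 then cm else cm + 1)"
  define hm where "hm = (t + F) div (int r + 1)"
  have lo0: "0 \<le> lo" by (auto simp: lo_def div_int_pos_iff)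
  have lo_iff: "lo \<le> x \<longleftrightarrow> d \<le> (int r + 1) * x" if "0 \<le> x" for x
  proof (cases "d \<le> 0")
    case True
    have "0 \<le> (int r + 1) * x" using that by simp
    then have "d \<le> (int r + 1) * x" using True by (rule order_trans[rotated])
    then show ?thesis using True that by (simp add: lo_def)
  next
    case False
    have "lo \<le> x \<longleftrightarrow> \<not> (x + 1 \<le> (d + int r) div (int r + 1))" using False by (auto simp: lo_def)
    also have "\<dots> \<longleftrightarrow> \<not> ((int r + 1) * (x + 1) \<le> d + int r)" by (subst le_div_iff_int) auto
    also have "\<dots> \<longleftrightarrow> d \<le> (int r + 1) * x" by (auto simp: algebra_simps)
    finally show ?thesis .
  qed
  have cm_iff: "x \<le> cm \<longleftrightarrow> (int r + 1) * x \<le> t" for x unfolding cm_def by (intro le_div_iff_int) auto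
  have hm_iff: "x \<le> hm \<longleftrightarrow> (int r + 1) * x \<le> t + F" for x unfolding hm_def by (intro le_div_iff_int) auto
  have c'_iff: "c' \<le> x \<longleftrightarrow> t \<le> (int r + 1) * x" for x
  proof (cases "t mod (int r + 1) = 0")
    case True
    then have "t = (int r + 1) * cm" unfolding cm_def by (metis add.right_neutral mult_div_mod_eq)
    then show ?thesis using True by (simp add: c'_def)
  next
    case False
    then have "(int r + 1) * x \<noteq> t" by auto
    then show ?thesis using False cm_iff[of x] by (auto simp: c'_def)
  qed
  have scaled: "c - L \<le> of_int x \<longleftrightarrow> d \<le> (int r + 1) * x" "of_int x \<le> c + L \<longleftrightarrow> (int r + 1) * x \<le> t + F" for x
  proof -
    have "c - L \<le> of_int x \<longleftrightarrow> real_of_int (t - (int r + 1) * x) \<le> (real r + 1) * L"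
      by (simp add: c_def t_def field_simps)
    also have "\<dots> \<longleftrightarrow> t - (int r + 1) * x \<le> F" unfolding F L_def by (simp only: le_floor_iff)
    finally show "c - L \<le> of_int x \<longleftrightarrow> d \<le> (int r + 1) * x" by (auto simp: d_def)
    have "of_int x \<le> c + L \<longleftrightarrow> real_of_int ((int r + 1) * x - t) \<le> (real r + 1) * L"
      by (simp add: c_def t_def field_simps)
    also have "\<dots> \<longleftrightarrow> (int r + 1) * x - t \<le> F" unfolding F L_def by (simp only: le_floor_iff)
    finally show "of_int x \<le> c + L \<longleftrightarrow> (int r + 1) * x \<le> t + F" by auto
  qed
  have dec: "f y < f x" if "0 \<le> x" "x < y" "y \<le> cm" for x y
    unfolding f_def using that cm_iff[of y] r by (intro trinomial_monotone_int(1)) (auto simp: t_def)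
  have inc: "f x < f y" if "c' \<le> x" "x < y" for x y
  proof -
    have "t \<le> (int r + 1) * x" using that c'_iff by simp
    moreover from this t0 have "0 \<le> x" by (smt (verit) mult_pos_neg of_nat_0_le_iff)
    ultimately show ?thesis
      unfolding f_def using that r by (intro trinomial_monotone_int(2)) (auto simp: t_def)
  qed
  have c'0: "0 \<le> c'" using c'_iff[of c'] t0 by (smt (verit) mult_pos_neg of_nat_0_le_iff)
  let ?right1 = "\<lambda>x. bind_costed (eval_poly M r u K x) (\<lambda>v. ileq 1 v)"
  let ?right2 = "\<lambda>x. bind_costed (eval_poly M r u K x) (\<lambda>v. ileq v (-1))"
  have first: "result (try_interval M N r u K ?right1 lo cm)
      = map_option (\<lambda>x. gcd x N) (find (\<lambda>x. good x) [lo..cm])"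
    unfolding good_def f_def
  proof (rule result_try_interval[OF N lo0])
    fix z x assume zx: "lo \<le> z" "z \<le> cm" "z ^ r * (z - u) + K = 0" "lo < x" "x < cm"
    show "if result (?right1 x) then x \<le> z else z \<le> x"
      using dec[of x z] dec[of z x] zx lo0 by (fastforce simp: f_def)
  next
    fix x y assume "lo \<le> x" "x < y" "y \<le> cm" "x ^ r * (x - u) + K = 0"
    then show "y ^ r * (y - u) + K \<noteq> 0" using dec[of x y] lo0 by (simp add: f_def)
  qed
  have second: "result (try_interval M N r u K ?right2 c' hm)
      = map_option (\<lambda>x. gcd x N) (find (\<lambda>x. good x) [c'..hm])"
    unfolding good_def f_def
  proof (rule result_try_interval[OF N c'0])
    fix z x assume zx: "c' \<le> z" "z \<le> hm" "z ^ r * (z - u) + K = 0" "c' < x" "x < hm"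
    show "if result (?right2 x) then x \<le> z else z \<le> x"
      using inc[of x z] inc[of z x] zx by (fastforce simp: f_def)
  next
    fix x y assume "c' \<le> x" "x < y" "y \<le> hm" "x ^ r * (x - u) + K = 0"
    then show "y ^ r * (y - u) + K \<noteq> 0" using inc[of x y] by (simp add: f_def)
  qed
  have div1: "result (idivmod (t - F + int r) (int r + 1)) = ((t - F + int r) div (int r + 1), (t - F + int r) mod (int r + 1))"
    if "\<not> t \<le> F" using that by (intro result_idivmod) auto
  have div2: "result (idivmod t (int r + 1)) = (cm, t mod (int r + 1))"
    unfolding cm_def using t0 by (intro result_idivmod) auto
  have div3: "result (idivmod (t + F) (int r + 1)) = (hm, (t + F) mod (int r + 1))"
    unfolding hm_def using t0 F0 by (intro result_idivmod) auto
  have test: "result (test_u M N r F K u) =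
     (case result (try_interval M N r u K ?right1 lo cm) of Some g \<Rightarrow> Some g
      | None \<Rightarrow> result (try_interval M N r u K ?right2 c' hm))"
    unfolding test_u_def
    by (cases "t \<le> F"; cases "t mod (int r + 1) = 0")
      (simp_all add: t_def[symmetric] d_def lo_def c'_def div1 div2 div3 split: option.split)
  have root_pos: "x \<noteq> 0" if "good x" for x
    using that K0 r by (auto simp: good_def f_def power_0_left)
  have poly: "lehman_poly N r a b u x = f x" for x
    by (simp add: lehman_poly_def f_def K algebra_simps)
  define A where "A = \<lceil>c - L\<rceil>"
  define B where "B = \<lfloor>c + L\<rfloor>"
  have A_iff: "A \<le> x \<longleftrightarrow> d \<le> (int r + 1) * x" for x unfolding A_def ceiling_le_iff scaled ..
  have B_iff: "x \<le> B \<longleftrightarrow> (int r + 1) * x \<le> t + F" for x unfolding B_def le_floor_iff scaled ..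
  have find: "find (\<lambda>x. 0 < x \<and> good x) [A..B] =
      (case find good [lo..cm] of Some x \<Rightarrow> Some x | None \<Rightarrow> find good [c'..hm])"
  proof (cases "find good [lo..cm]")
    case (Some x)
    then have x: "lo \<le> x" "x \<le> cm" "good x" "\<And>y. lo \<le> y \<Longrightarrow> y < x \<Longrightarrow> \<not> good y"
      by (auto simp: find_upto_eq_Some_iff)
    have x0: "0 < x" using x(1,3) lo0 root_pos[of x] by linarith
    have 1: "d \<le> (int r + 1) * x" using lo_iff[of x] x(1) x0 by simp
    have 2: "(int r + 1) * x \<le> t + F" using cm_iff[of x] x(2) F0 by linarith
    have 3: "\<not> (0 < y \<and> good y)" if "d \<le> (int r + 1) * y" "y < x" for y
      using lo_iff[of y] x(4)[of y] that by auto
    have "find (\<lambda>x. 0 < x \<and> good x) [A..B] = Some x"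
      unfolding find_upto_eq_Some_iff A_iff B_iff
    proof (intro conjI allI impI)
      show "\<not> (0 < y \<and> good y)" if "d \<le> (int r + 1) * y \<and> y < x" for y
        using that by (intro 3) auto
      show "d \<le> (int r + 1) * x" by (rule 1)
      show "(int r + 1) * x \<le> t + F" by (rule 2)
      show "0 < x" by (rule x0)
      show "good x" by (rule x(3))
    qed
    with Some show ?thesis by simp
  next
    case None
    then have none: "\<not> good x" if "lo \<le> x" "x \<le> cm" for x
      using that by (auto simp: find_upto_eq_None_iff)
    have right: "c' \<le> y" if "A \<le> y" "0 < y" "good y" for y
      using none[of y] that A_iff[of y] lo_iff[of y] cm_iff[of y] c'_iff[of y] by auto
    show ?thesis
    proof (cases "find good [c'..hm]")
      case (Some x)
      then have x: "c' \<le> x" "x \<le> hm" "good x" "\<And>y. c' \<le> y \<Longrightarrow> y < x \<Longrightarrow> \<not> good y"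
        by (auto simp: find_upto_eq_Some_iff)
      have x0: "0 < x" using x(1,3) c'0 root_pos[of x] by linarith
      have "find (\<lambda>x. 0 < x \<and> good x) [A..B] = Some x"
        unfolding find_upto_eq_Some_iff
      proof (intro conjI allI impI)
        have "t \<le> (int r + 1) * x" using c'_iff[of x] x(1) by blast
        then have "d \<le> (int r + 1) * x" using F0 unfolding d_def by linarith
        then show "A \<le> x" using A_iff[of x] by blast
        show "x \<le> B" using B_iff[of x] hm_iff[of x] x(2) by blast
        show "\<not> (0 < y \<and> good y)" if "A \<le> y \<and> y < x" for y using that right[of y] x(4)[of y] by blast
      qed (use x0 x(3) in auto)
      with Some None show ?thesis by simp
    next
      case none2: None
      then have "find (\<lambda>x. 0 < x \<and> good x) [A..B] = None"
        unfolding find_upto_eq_None_iff using right B_iff hm_iff by auto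
      with None none2 show ?thesis by simp
    qed
  qed
  have "lehman_test N r j a b u = map_option (\<lambda>x. gcd x N) (find (\<lambda>x. 0 < x \<and> good x) [A..B])"
    unfolding lehman_test_def Let_def poly good_def A_def B_def c_def L_def ..
  also have "\<dots> = result (test_u M N r F K u)"
    unfolding test first second find by (simp split: option.split)
  finally show ?thesis ..
qed

section \<open>How far a sum of two roots stays from an integer\<close>

text \<open>
  A vector in the kernel of the transposed matrix is the list of coefficients of a polynomial of degree
  below \<open>n\<close> with \<open>n\<close> distinct roots.
\<close>

lemma vandermonde_det_nonzero:
  fixes zs :: "complex list"
  assumes "distinct zs" "length zs = n"
  shows "det (mat n n (\<lambda>(i, k). zs ! k ^ i)) \<noteq> 0"
proof
  define V where "V = mat n n (\<lambda>(i, k). zs ! k ^ i)"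
  have V: "V \<in> carrier_mat n n" by (simp add: V_def)
  assume "det (mat n n (\<lambda>(i, k). zs ! k ^ i)) = 0"
  then have "det (transpose_mat V) = 0" unfolding V_def[symmetric] using det_transpose[OF V] by simp
  then obtain v where v: "v \<in> carrier_vec n" "v \<noteq> 0\<^sub>v n" "transpose_mat V *\<^sub>v v = 0\<^sub>v n"
    using det_0_iff_vec_prod_zero[of "transpose_mat V" n] V by auto
  define p where "p = (\<Sum>i<n. monom (v $ i) i)"
  have coeff_p: "coeff p i = (if i < n then v $ i else 0)" for i
    by (simp add: p_def coeff_sum sum.delta)
  have "p \<noteq> 0"
  proof
    assume "p = 0"
    then have "v $ i = 0" if "i < n" for i using coeff_p[of i] that by simp
    then have "v = 0\<^sub>v n" using v(1) by (intro eq_vecI) auto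
    with v(2) show False by simp
  qed
  have "n \<noteq> 0"
  proof
    assume "n = 0"
    then show False using \<open>p \<noteq> 0\<close> by (simp add: p_def)
  qed
  have "degree p < n"
    using \<open>n \<noteq> 0\<close> coeff_p by (intro degree_lessI) auto
  have "poly p z = 0" if z: "z \<in> set zs" for z
  proof -
    obtain k where k: "k < n" "zs ! k = z" using z assms(2) unfolding in_set_conv_nth by blast
    have "(transpose_mat V *\<^sub>v v) $ k = (\<Sum>i<n. z ^ i * v $ i)"
      using k v(1) V by (simp add: scalar_prod_def V_def lessThan_atLeast0)
    moreover have "(transpose_mat V *\<^sub>v v) $ k = 0" using k v(3) by simp
    ultimately show ?thesis by (simp add: p_def poly_sum poly_monom mult.commute)
  qed
  then have "set zs \<subseteq> {z. poly p z = 0}" by auto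
  then have "card (set zs) \<le> card {z. poly p z = 0}"
    using \<open>p \<noteq> 0\<close> by (intro card_mono poly_roots_finite) auto
  also have "\<dots> \<le> degree p" using \<open>p \<noteq> 0\<close> by (rule card_poly_roots_bound)
  finally show False using \<open>degree p < n\<close> assms by (simp add: distinct_card)
qed

text \<open>
  The eigenvectors form a Vandermonde matrix \<open>V\<close> with \<open>E V = V D\<close> for a diagonal matrix \<open>D\<close>, and \<open>V\<close> is invertible.
\<close>

lemma det_eq_prod_eigenvalues:
  fixes E :: "complex mat" and zs :: "complex list" and e :: "complex \<Rightarrow> complex"
  assumes E: "E \<in> carrier_mat n n" and zs: "distinct zs" "length zs = n"
    and eigen: "\<And>z. z \<in> set zs \<Longrightarrow> E *\<^sub>v vec n (\<lambda>i. z ^ i) = e z \<cdot>\<^sub>v vec n (\<lambda>i. z ^ i)"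
  shows "det E = (\<Prod>z\<in>set zs. e z)"
proof -
  define V where "V = mat n n (\<lambda>(i, k). zs ! k ^ i)"
  define D where "D = mat n n (\<lambda>(i, k). if i = k then e (zs ! k) else 0)"
  have V: "V \<in> carrier_mat n n" and D: "D \<in> carrier_mat n n" by (simp_all add: V_def D_def)
  have "E * V = V * D"
  proof (rule eq_matI)
    fix i k assume ik: "i < dim_row (V * D)" "k < dim_col (V * D)"
    then have i: "i < n" and k: "k < n" by (simp_all add: V_def D_def)
    have colV: "col V k = vec n (\<lambda>i. zs ! k ^ i)" using k by (auto simp: V_def)
    have "(E * V) $$ (i, k) = (E *\<^sub>v col V k) $ i" using i k E V by simp
    also have "\<dots> = e (zs ! k) * zs ! k ^ i"
      unfolding colV using eigen[of "zs ! k"] k i zs(2) by simp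
    also have "\<dots> = (\<Sum>l<n. V $$ (i, l) * (if l = k then e (zs ! k) else 0))"
      using i k by (simp add: V_def if_distrib cong: if_cong)
    also have "\<dots> = (V * D) $$ (i, k)"
      using i k V D by (simp add: scalar_prod_def D_def lessThan_atLeast0)
    finally show "(E * V) $$ (i, k) = (V * D) $$ (i, k)" .
  qed (use E V D in auto)
  then have "det E * det V = det V * det D" using det_mult E V D by metis
  moreover have "det V \<noteq> 0" using vandermonde_det_nonzero[OF zs] by (simp add: V_def)
  ultimately have "det E = det D" by simp
  also have "\<dots> = prod_list (diag_mat D)"
    using D by (intro det_upper_triangular[of _ n]) (auto simp: D_def)
  also have "diag_mat D = map e zs"
    using zs by (intro nth_equalityI) (auto simp: diag_mat_def D_def)
  also have "prod_list (map e zs) = (\<Prod>z\<in>set zs. e z)" using zs(1) by (simp add: prod.distinct_set_conv_list)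
  finally show ?thesis .
qed

lemma cyclic_shift_eigenvector:
  fixes c z :: complex
  assumes "z ^ n = c"
  shows "mat n n (\<lambda>(i, j). if j = Suc i then 1 else if i = n - 1 \<and> j = 0 then c else 0)
    *\<^sub>v vec n (\<lambda>i. z ^ i) = z \<cdot>\<^sub>v vec n (\<lambda>i. z ^ i)"
proof (rule eq_vecI)
  fix i assume "i < dim_vec (z \<cdot>\<^sub>v vec n (\<lambda>i. z ^ i))"
  then have i: "i < n" by simp
  have "(mat n n (\<lambda>(i, j). if j = Suc i then 1 else if i = n - 1 \<and> j = 0 then c else 0)
    *\<^sub>v vec n (\<lambda>i. z ^ i)) $ i = (\<Sum>j<n. (if j = Suc i then 1 else if i = n - 1 \<and> j = 0 then c else 0) * z ^ j)"
    using i by (simp add: scalar_prod_def lessThan_atLeast0)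
  also have "\<dots> = z ^ Suc i"
  proof (cases "i = n - 1")
    case True
    then have "(\<Sum>j<n. (if j = Suc i then 1 else if i = n - 1 \<and> j = 0 then c else 0) * z ^ j)
      = (\<Sum>j<n. if j = 0 then c else 0)" using i by (intro sum.cong) auto
    also have "\<dots> = c" using i by simp
    finally show ?thesis using True i assms by simp
  next
    case False
    then have "(\<Sum>j<n. (if j = Suc i then 1 else if i = n - 1 \<and> j = 0 then c else 0) * z ^ j)
      = (\<Sum>j<n. if j = Suc i then z ^ j else 0)" by (intro sum.cong) auto
    also have "\<dots> = z ^ Suc i" using i False by simp
    finally show ?thesis .
  qed
  finally show "(mat n n (\<lambda>(i, j). if j = Suc i then 1 else if i = n - 1 \<and> j = 0 then c else 0)
    *\<^sub>v vec n (\<lambda>i. z ^ i)) $ i = (z \<cdot>\<^sub>v vec n (\<lambda>i. z ^ i)) $ i" using i by simp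
qed simp

lemma smult_mat_mult_vec:
  fixes X :: "complex mat"
  assumes "X \<in> carrier_mat n n" "v \<in> carrier_vec n"
  shows "(c \<cdot>\<^sub>m X) *\<^sub>v v = c \<cdot>\<^sub>v (X *\<^sub>v v)"
  using assms by (intro eq_vecI) (auto simp: scalar_prod_def sum_distrib_left mult.assoc)

lemma minus_smult_vec:
  fixes v :: "complex vec"
  shows "a \<cdot>\<^sub>v v - b \<cdot>\<^sub>v v = (a - b) \<cdot>\<^sub>v v"
  by (intro eq_vecI) (auto simp: algebra_simps)

text \<open>
  The matrix \<open>B\<close>, the companion matrix of \<open>x\<^sup>n - A\<close>, is integral and has the \<open>n\<close> roots \<open>z\<close> as eigenvalues. Hence
  the factors of the product are the eigenvalues of the integer matrix \<open>Q (u - B)\<^sup>m - P\<close>, and the product is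
  its determinant.
\<close>

lemma prod_over_roots_is_integer:
  fixes A u P Q :: int and n m :: nat
  assumes n: "0 < n" and A: "A \<noteq> 0"
  shows "(\<Prod>z\<in>{z::complex. z ^ n = of_int A}. of_int Q * (of_int u - z) ^ m - of_int P) \<in> \<int>"
proof -
  define S where "S = {z::complex. z ^ n = of_int A}"
  have cardS: "card S = n" unfolding S_def using n A by (intro card_nth_roots) auto
  then have "finite S" using n card_ge_0_finite by metis
  then obtain zs where zs: "set zs = S" "distinct zs" using finite_distinct_list by blast
  then have len: "length zs = n" using cardS by (metis distinct_card)
  define B where "B = mat n n (\<lambda>(i, j). if j = Suc i then 1 else if i = n - 1 \<and> j = 0 then A else 0)"
  define C where "C = of_int u \<cdot>\<^sub>m 1\<^sub>m n - B"
  define E where "E = Q \<cdot>\<^sub>m (C ^\<^sub>m m) - P \<cdot>\<^sub>m 1\<^sub>m n"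
  have B: "B \<in> carrier_mat n n" by (simp add: B_def)
  have C: "C \<in> carrier_mat n n" unfolding C_def using B by (rule minus_carrier_mat)
  have Cm: "C ^\<^sub>m m \<in> carrier_mat n n" using C by simp
  define Cc where "Cc = map_mat complex_of_int C"
  have Cc: "Cc \<in> carrier_mat n n" using C by (simp add: Cc_def)
  have Ec: "map_mat complex_of_int E = of_int Q \<cdot>\<^sub>m (Cc ^\<^sub>m m) - of_int P \<cdot>\<^sub>m (1\<^sub>m n :: complex mat)"
  proof -
    have pw: "map_mat of_int (C ^\<^sub>m m) = (Cc ^\<^sub>m m :: complex mat)"
      unfolding Cc_def using C by (rule of_int_hom.mat_hom_pow)
    have "map_mat complex_of_int E = of_int Q \<cdot>\<^sub>m map_mat of_int (C ^\<^sub>m m) - of_int P \<cdot>\<^sub>m (1\<^sub>m n :: complex mat)"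
      using Cm carrier_matD[OF Cm] unfolding E_def by (intro eq_matI) (auto simp del: pow_mat_dim_square)
    then show ?thesis unfolding pw .
  qed
  have eigen: "map_mat complex_of_int E *\<^sub>v vec n (\<lambda>i. z ^ i) = (of_int Q * (of_int u - z) ^ m - of_int P) \<cdot>\<^sub>v vec n (\<lambda>i. z ^ i)"
    if "z \<in> set zs" for z :: complex
  proof -
    define v where "v = vec n (\<lambda>i. z ^ i)"
    have v: "v \<in> carrier_vec n" by (simp add: v_def)
    have z: "z ^ n = of_int A" using that zs(1) by (simp add: S_def)
    have "map_mat complex_of_int B *\<^sub>v v = z \<cdot>\<^sub>v v"
    proof -
      have "map_mat complex_of_int B = mat n n (\<lambda>(i, j). if j = Suc i then 1 else if i = n - 1 \<and> j = 0 then of_int A else (0::complex))"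
        unfolding B_def by (intro eq_matI) auto
      then show ?thesis unfolding v_def using cyclic_shift_eigenvector[OF z] by simp
    qed
    moreover have "Cc = of_int u \<cdot>\<^sub>m 1\<^sub>m n - map_mat complex_of_int B"
      unfolding Cc_def C_def using B by (intro eq_matI) auto
    ultimately have "Cc *\<^sub>v v = of_int u \<cdot>\<^sub>v v - z \<cdot>\<^sub>v v"
      using B v by (simp add: minus_mult_distrib_mat_vec[of _ n n] smult_mat_mult_vec[of _ n])
    then have Cv: "Cc *\<^sub>v v = (of_int u - z) \<cdot>\<^sub>v v"
      using v by (simp add: minus_smult_vec)
    have "v $ 0 = 1" using n by (simp add: v_def)
    then have "v \<noteq> 0\<^sub>v n" using n by auto
    then have "eigenvector Cc v (of_int u - z)" using Cv v Cc by (simp add: eigenvector_def)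
    from eigenvector_pow[OF Cc this] have "Cc ^\<^sub>m m *\<^sub>v v = (of_int u - z) ^ m \<cdot>\<^sub>v v" .
    then have "map_mat complex_of_int E *\<^sub>v v = of_int Q \<cdot>\<^sub>v ((of_int u - z) ^ m \<cdot>\<^sub>v v) - of_int P \<cdot>\<^sub>v v"
      unfolding Ec using Cc v by (simp add: minus_mult_distrib_mat_vec[of _ n n] smult_mat_mult_vec[of _ n])
    then show ?thesis unfolding v_def[symmetric] using v
      by (simp add: minus_smult_vec smult_smult_assoc)
  qed
  have "of_int (det E) = det (map_mat complex_of_int E :: complex mat)" by (simp add: of_int_hom.hom_det)
  also have "\<dots> = (\<Prod>z\<in>set zs. of_int Q * (of_int u - z) ^ m - of_int P)"
    using C Cm zs(2) len eigen by (intro det_eq_prod_eigenvalues) (auto simp: E_def)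
  finally have "(\<Prod>z\<in>S. of_int Q * (of_int u - z) ^ m - of_int P) = of_int (det E)" using zs(1) by simp
  then show ?thesis unfolding S_def by simp
qed

lemma power_diff_le:
  fixes x y z :: real
  assumes "0 \<le> y" "y \<le> x" "x \<le> z" "1 \<le> z"
  shows "x ^ m - y ^ m \<le> real m * (x - y) * z ^ m"
proof (induction m)
  case (Suc m)
  have "x ^ Suc m - y ^ Suc m = x * (x ^ m - y ^ m) + y ^ m * (x - y)" by (simp add: algebra_simps)
  also have "\<dots> \<le> z * (real m * (x - y) * z ^ m) + z ^ Suc m * (x - y)"
  proof (intro add_mono mult_mono mult_right_mono)
    have "y ^ m \<le> z ^ m" using assms by (intro power_mono) auto
    also have "\<dots> \<le> z ^ Suc m" using assms by (intro power_increasing) auto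
    finally show "y ^ m \<le> z ^ Suc m" .
    show "0 \<le> x ^ m - y ^ m" using assms by (simp add: power_mono)
  qed (use Suc assms in auto)
  also have "\<dots> = real (Suc m) * (x - y) * z ^ Suc m" by (simp add: algebra_simps)
  finally show ?case .
qed simp

text \<open>
  A Liouville-type estimate: an integer \<open>u\<close> above \<open>G + U\<close> cannot be too close to it. The norm-like product over
  all \<open>n\<close>-th roots \<open>z\<close> of \<open>A\<close> is a nonzero integer. The factor at \<open>z = G\<close> is
  \<open>Q ((u - G)\<^sup>m - U\<^sup>m)\<close>, hence at most a multiple of \<open>u - (G + U)\<close>, and the others are at most \<open>2 Q (2 u)\<^sup>m\<close>.
\<close>

lemma root_sum_separation:
  fixes A P Q u :: int and n m :: nat and G U :: real
  assumes n: "0 < n" and m: "0 < m" and A: "0 < A" and Q: "0 < Q"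
    and G: "0 \<le> G" "G ^ n = of_int A" and U: "0 \<le> U" "of_int Q * U ^ m = of_int P"
    and u: "G + U < of_int u"
  shows "1 \<le> real m * (of_int u - (G + U)) * (2 * of_int Q * (2 * of_int u) ^ m) ^ n"
proof -
  define S where "S = {z::complex. z ^ n = of_int A}"
  define e where "e z = of_int Q * (of_int u - z) ^ m - of_int P" for z :: complex
  have "card S = n" unfolding S_def using n A by (intro card_nth_roots) auto
  then have fin: "finite S" using n card_ge_0_finite by metis
  have u0: "0 < real_of_int u" using u G(1) U(1) by linarith
  then have u1: "1 \<le> real_of_int u" by simp
  have two_u: "1 \<le> 2 * real_of_int u" using u0 u1 by linarith
  have norm_z: "cmod z = G" if "z \<in> S" for z
  proof -
    have "cmod z ^ n = G ^ n" using that A G(2) by (simp add: S_def flip: norm_power)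
    then show ?thesis using n G(1) by (metis norm_ge_zero power_eq_iff_eq_base)
  qed
  have G_in: "complex_of_real G \<in> S" using G(2) by (simp add: S_def flip: of_real_power)
  have nonzero: "e z \<noteq> 0" if "z \<in> S" for z
  proof
    assume "e z = 0"
    then have "of_int Q * (of_int u - z) ^ m = of_int P" by (simp add: e_def)
    then have "cmod (of_int Q * (of_int u - z) ^ m) = \<bar>of_int P\<bar>" by simp
    then have "of_int Q * cmod (of_int u - z) ^ m = \<bar>of_int P\<bar>" using Q by (simp add: norm_mult norm_power)
    also have "\<dots> = of_int Q * U ^ m" using U Q by (simp flip: U(2))
    finally have "cmod (of_int u - z) ^ m = U ^ m" using Q by simp
    then have "cmod (of_int u - z) = U" using m U(1) by (metis norm_ge_zero power_eq_iff_eq_base)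
    moreover have "real_of_int u - G \<le> cmod (of_int u - z)"
      using norm_triangle_ineq2[of "of_int u" z] norm_z[OF that] u1 by simp
    ultimately show False using u by simp
  qed
  have bound: "cmod (e z) \<le> 2 * of_int Q * (2 * of_int u) ^ m" if "z \<in> S" for z
  proof -
    have "cmod (e z) \<le> of_int Q * cmod (of_int u - z) ^ m + \<bar>of_int P\<bar>"
      unfolding e_def using norm_triangle_ineq4[of "of_int Q * (of_int u - z) ^ m" "of_int P"] Q
      by (simp add: norm_mult norm_power)
    also have "\<bar>real_of_int P\<bar> = of_int Q * U ^ m" using U Q by (simp flip: U(2))
    also have "cmod (of_int u - z) \<le> 2 * of_int u"
      using norm_triangle_ineq4[of "of_int u" z] norm_z[OF that] u G U by simp
    then have "of_int Q * cmod (of_int u - z) ^ m + of_int Q * U ^ m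
        \<le> of_int Q * (2 * of_int u) ^ m + of_int Q * (2 * of_int u) ^ m"
      using u G U Q by (intro add_mono mult_left_mono power_mono) auto
    finally show ?thesis by (simp only: mult_2 distrib_right)
  qed
  have "(\<Prod>z\<in>S. e z) \<in> \<int>" unfolding S_def e_def using n A by (intro prod_over_roots_is_integer) auto
  then obtain k where k: "(\<Prod>z\<in>S. e z) = of_int k" by (elim Ints_cases)
  have "(\<Prod>z\<in>S. e z) \<noteq> 0" using fin nonzero by simp
  then have "1 \<le> \<bar>k\<bar>" using k by auto
  then have "1 \<le> cmod (\<Prod>z\<in>S. e z)" unfolding k by simp
  also have "(\<Prod>z\<in>S. e z) = e (complex_of_real G) * (\<Prod>z\<in>S - {complex_of_real G}. e z)"
    using fin G_in by (rule prod.remove)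
  also have "cmod \<dots> = cmod (e (complex_of_real G)) * (\<Prod>z\<in>S - {complex_of_real G}. cmod (e z))"
    by (simp add: norm_mult prod_norm)
  also have "\<dots> \<le> (real m * (of_int u - (G + U)) * (2 * of_int Q * (2 * of_int u) ^ m)) * (\<Prod>z\<in>S - {complex_of_real G}. 2 * of_int Q * (2 * of_int u) ^ m)"
  proof (intro mult_mono prod_mono conjI prod_nonneg)
    have "complex_of_int P = complex_of_real (of_int Q * U ^ m)" using U(2) by simp
    then have "e (complex_of_real G) = complex_of_real (of_int Q * ((of_int u - G) ^ m - U ^ m))"
      unfolding e_def by (simp add: right_diff_distrib)
    then have "cmod (e (complex_of_real G)) = \<bar>of_int Q * ((of_int u - G) ^ m - U ^ m)\<bar>"
      by (simp only: norm_of_real)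
    also have "\<dots> = of_int Q * \<bar>(of_int u - G) ^ m - U ^ m\<bar>" using Q by (simp add: abs_mult)
    also have "U ^ m \<le> (of_int u - G) ^ m" using U u by (intro power_mono) auto
    then have "\<bar>(of_int u - G) ^ m - U ^ m\<bar> = (of_int u - G) ^ m - U ^ m" by simp
    also have "of_int Q * \<dots> \<le> of_int Q * (real m * (of_int u - G - U) * (2 * of_int u) ^ m)"
      using U G u u0 two_u Q by (intro mult_left_mono power_diff_le) auto
    also have "\<dots> \<le> 2 * (of_int Q * (real m * (of_int u - G - U) * (2 * of_int u) ^ m))"
    proof -
      have "0 \<le> of_int Q * (real m * (of_int u - G - U) * (2 * of_int u) ^ m)"
        using Q u u0 by (intro mult_nonneg_nonneg) auto
      then show ?thesis by linarith
    qed
    also have "\<dots> = real m * (of_int u - (G + U)) * (2 * of_int Q * (2 * of_int u) ^ m)"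
      by (simp only: diff_diff_eq ac_simps)
    finally show "cmod (e (complex_of_real G)) \<le> real m * (of_int u - (G + U)) * (2 * of_int Q * (2 * of_int u) ^ m)" .
  qed (use bound u u0 Q in \<open>auto simp: prod_nonneg\<close>)
  also have "\<dots> = real m * (of_int u - (G + U)) * (2 * of_int Q * (2 * of_int u) ^ m) ^ n"
  proof -
    have "card (S - {complex_of_real G}) = n - 1" using fin G_in \<open>card S = n\<close> by simp
    then show ?thesis using n by (simp add: power_eq_if)
  qed
  finally show ?thesis .
qed

text \<open>
  The scaled floors determine \<open>2\<^sup>k (G + U)\<close> up to an error of less than \<open>2\<close>. After adding \<open>1\<close> the estimate is
  never too small for rounding down, and it is too large only if an integer lies just above \<open>G + U\<close>.
\<close>

lemma floor_sum_from_scaled_floors: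
  fixes G U :: real and k :: nat
  assumes gap: "\<And>u::int. G + U < of_int u \<Longrightarrow> 1 < 2 ^ k * (of_int u - (G + U))"
  shows "(\<lfloor>2 ^ k * G\<rfloor> + \<lfloor>2 ^ k * U\<rfloor> + 1) div 2 ^ k = \<lfloor>G + U\<rfloor>"
proof -
  define w where "w = \<lfloor>G + U\<rfloor>"
  define s where "s = \<lfloor>2 ^ k * G\<rfloor> + \<lfloor>2 ^ k * U\<rfloor> + 1"
  have s: "2 ^ k * (G + U) - 1 < of_int s" "of_int s \<le> 2 ^ k * (G + U) + 1"
    unfolding s_def distrib_left by linarith+
  have "2 ^ k * real_of_int w \<le> 2 ^ k * (G + U)" by (intro mult_left_mono) (simp_all add: w_def)
  then have "real_of_int (w * 2 ^ k) \<le> 2 ^ k * (G + U)" by (simp add: mult.commute)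
  then have "real_of_int (w * 2 ^ k) < real_of_int s + 1" using s(1) by linarith
  then have lower: "w * 2 ^ k \<le> s" by linarith
  have "1 < 2 ^ k * (of_int (w + 1) - (G + U))" by (intro gap) (simp add: w_def)
  then have "real_of_int s < of_int ((w + 1) * 2 ^ k)" using s(2) by (simp add: algebra_simps)
  then have upper: "s < (w + 1) * 2 ^ k" by (simp only: of_int_less_iff)
  have "s div 2 ^ k = w"
    using lower upper by (intro int_div_pos_eq[of _ _ _ "s - w * 2 ^ k"]) (auto simp: algebra_simps)
  then show ?thesis unfolding s_def w_def .
qed

section \<open>Values computed by the program\<close>

lemma powr_power_eq_power:
  fixes x y :: real
  assumes "0 < x" "y * real n = real k"
  shows "(x powr y) ^ n = x ^ k"
proof -
  have "(x powr y) ^ n = (x powr y) powr real n" using assms(1) by (simp add: powr_realpow)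
  also have "\<dots> = x powr real k" by (simp add: powr_powr assms(2))
  also have "\<dots> = x ^ k" using assms(1) by (simp add: powr_realpow)
  finally show ?thesis .
qed

lemma powr_power_eq_inverse_power:
  fixes x y :: real
  assumes "0 < x" "y * real n = - real k"
  shows "(x powr y) ^ n = 1 / x ^ k"
proof -
  have "(x powr y) ^ n = (x powr y) powr real n" using assms(1) by (simp add: powr_realpow)
  also have "\<dots> = x powr (- real k)" by (simp add: powr_powr assms(2))
  also have "\<dots> = 1 / x ^ k" using assms(1) by (simp add: powr_minus powr_realpow field_simps)
  finally show ?thesis .
qed

lemma floor_log2_eq_bits:
  assumes "0 < N"
  shows "\<lfloor>log 2 (real_of_int N)\<rfloor> = int (bits N) - 1"
proof -
  have "0 \<le> log 2 (real_of_int N)" using assms by simp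
  then show ?thesis using assms by (simp add: bits_def floorlog_def)
qed

text \<open>
  The sizes below are expressed by the bit length \<open>len\<close> of \<open>N\<close>. Since \<open>r \<le> lg N\<close>, it also bounds \<open>r\<close>.
\<close>

locale lehman_input =
  fixes N :: int and r :: nat
  assumes N_gt_1: "1 < N" and r_gt_1: "1 < r" and r_le_lg: "real r \<le> log 2 (real_of_int N)"
begin

abbreviation len :: nat where "len \<equiv> bits N"

lemma r_less_len: "r < len"
proof -
  have "int r \<le> \<lfloor>log 2 (real_of_int N)\<rfloor>" using r_le_lg by (simp add: le_floor_iff)
  then show ?thesis using floor_log2_eq_bits[of N] N_gt_1 by simp
qed

lemma N_less: "N < 2 ^ len"
  by (rule less_two_power_bits)

lemma N_less_real: "real_of_int N < 2 ^ len"
  using N_less by (metis of_int_less_iff of_int_numeral of_int_power)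

definition jmax :: int where
  "jmax = \<lfloor>1 / (real r * (real r + 2)) * log 2 (real_of_int N)\<rfloor>"

definition amax :: "int \<Rightarrow> int" where
  "amax j = \<lceil>2 powr ((real r + 2) * real_of_int j / 3 + real r + 1)\<rceil>"

definition bmax :: "int \<Rightarrow> int" where
  "bmax j = \<lfloor>real_of_int N powr (1 / (real r + 2)) * 2 powr (- (2 * real r + 1) * real_of_int j / 3)\<rfloor>"

lemma amax_nonneg: "0 \<le> amax j" and bmax_nonneg: "0 \<le> bmax j"
proof -
  have "0 < 2 powr ((real r + 2) * real_of_int j / 3 + real r + 1)" by simp
  then show "0 \<le> amax j" unfolding amax_def by linarith
  show "0 \<le> bmax j" by (simp add: bmax_def)
qed

lemma period_pos: "0 < int (r * (r + 2))"
  using r_gt_1 by (simp only: of_nat_0_less_iff) simp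

lemma jmax_eq: "jmax = (int len - 1) div int (r * (r + 2))"
proof -
  have "jmax = \<lfloor>log 2 (real_of_int N) / real_of_int (int (r * (r + 2)))\<rfloor>"
    by (simp add: jmax_def algebra_simps)
  also have "\<dots> = \<lfloor>log 2 (real_of_int N)\<rfloor> div int (r * (r + 2))"
    by (intro floor_divide_real_eq_div) simp
  also have "\<lfloor>log 2 (real_of_int N)\<rfloor> = int len - 1" using N_gt_1 by (intro floor_log2_eq_bits) simp
  finally show ?thesis .
qed

lemma j_small:
  assumes "int j \<le> jmax"
  shows "r * (r + 2) * j \<le> len"
proof -
  have "int (r * (r + 2)) * int j \<le> int len - 1"
    using assms unfolding jmax_eq by (simp only: le_div_iff_int[OF period_pos])
  then have "int (r * (r + 2) * j) \<le> int len" by simp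
  then show ?thesis by (simp only: of_nat_le_iff)
qed

lemma a_small:
  assumes j: "int j \<le> jmax" and a: "a \<le> amax (int j)"
  shows "a \<le> 2 ^ (2 * len)"
proof -
  have "(r + 2) * j \<le> r * ((r + 2) * j)" using r_gt_1 by simp
  also have "\<dots> \<le> len" using j_small[OF j] by (simp add: algebra_simps)
  finally have "(r + 2) * j + (r + 1) \<le> 2 * len" using r_less_len by linarith
  then have "real ((r + 2) * j + (r + 1)) \<le> real (2 * len)" by (simp only: of_nat_le_iff)
  then have "(real r + 2) * real j + (real r + 1) \<le> real (2 * len)" by (simp add: algebra_simps)
  moreover have "(real r + 2) * real j / 3 \<le> (real r + 2) * real j" by simp
  ultimately have "(real r + 2) * real_of_int (int j) / 3 + real r + 1 \<le> real (2 * len)"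
    unfolding of_int_of_nat_eq by linarith
  then have "2 powr ((real r + 2) * real_of_int (int j) / 3 + real r + 1) \<le> 2 powr (real (2 * len))"
    by (intro powr_mono) auto
  also have "\<dots> = real_of_int (2 ^ (2 * len))" by (simp only: powr_realpow zero_less_numeral of_int_power of_int_numeral)
  finally have "amax (int j) \<le> 2 ^ (2 * len)" unfolding amax_def by (simp only: ceiling_le_iff)
  with a show ?thesis by simp
qed

lemma b_small:
  assumes "b \<le> bmax (int j)"
  shows "b \<le> N"
proof -
  have "real_of_int N powr (1 / (real r + 2)) * 2 powr (- (2 * real r + 1) * real_of_int (int j) / 3) \<le> real_of_int N powr 1 * 2 powr 0"
    using N_gt_1 by (intro mult_mono powr_mono) (auto simp: mult_le_0_iff)
  then have "real_of_int N powr (1 / (real r + 2)) * 2 powr (- (2 * real r + 1) * real_of_int (int j) / 3) \<le> real_of_int N"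
    using N_gt_1 by simp
  moreover have "real_of_int b \<le> real_of_int N powr (1 / (real r + 2)) * 2 powr (- (2 * real r + 1) * real_of_int (int j) / 3)"
    using assms unfolding bmax_def by (simp only: le_floor_iff)
  ultimately show ?thesis by linarith
qed

lemma G_small:
  assumes j: "int j \<le> jmax" and a: "1 \<le> a" "a \<le> amax (int j)" and b: "1 \<le> b" "b \<le> bmax (int j)"
  shows "lehman_G N r a b \<le> 2 ^ (4 * len)"
proof -
  have "a * b ^ r * N \<le> 2 ^ (2 * len) * (2 ^ len) ^ r * 2 ^ len"
    using a_small[OF j a(2)] b_small[OF b(2)] N_less N_gt_1 a b by (intro mult_mono power_mono) auto
  also have "\<dots> = 2 ^ (2 * len + len * r + len)" by (simp only: power_add power_mult)
  also have "\<dots> \<le> 2 ^ (3 * len * (r + 1))" by (intro power_increasing) auto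
  finally have "real_of_int (a * b ^ r * N) \<le> real_of_int (2 ^ (3 * len * (r + 1)))" by (simp only: of_int_le_iff)
  then have "real_of_int (a * b ^ r * N) \<le> (2 ^ (3 * len)) ^ (r + 1)"
    by (simp only: of_int_power of_int_numeral power_mult)
  then have "real_of_int (a * b ^ r * N) powr (1 / (real r + 1)) \<le> ((2 ^ (3 * len)) ^ (r + 1)) powr (1 / (real r + 1))"
    using a b N_gt_1 by (intro powr_mono2) auto
  also have "\<dots> = ((2 ^ (3 * len)) powr real (r + 1)) powr (1 / (real r + 1))"
    by (subst powr_realpow) auto
  also have "\<dots> = (2 ^ (3 * len)) powr (real (r + 1) * (1 / (real r + 1)))" by (simp only: powr_powr)
  also have "real (r + 1) * (1 / (real r + 1)) = 1" by (simp add: field_simps)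
  also have "(2 ^ (3 * len)) powr 1 = (2 ^ (3 * len) :: real)" by (simp only: powr_one zero_le_power zero_le_numeral)
  finally have "lehman_G N r a b \<le> (real r + 1) * 2 ^ (3 * len)"
    unfolding lehman_G_def by (intro mult_left_mono) auto
  also have "\<dots> \<le> 2 ^ len * 2 ^ (3 * len)"
  proof (intro mult_right_mono)
    have "r + 1 \<le> len" using r_less_len by simp
    also have "len \<le> 2 ^ len" by (simp add: less_imp_le)
    finally have "real (r + 1) \<le> real (2 ^ len)" by (simp only: of_nat_le_iff)
    then show "real r + 1 \<le> 2 ^ len" by simp
  qed auto
  also have "\<dots> = 2 ^ (len + 3 * len)" by (simp only: power_add)
  also have "len + 3 * len = 4 * len" by simp
  finally show ?thesis .
qed

lemma U_small:
  assumes a: "1 \<le> a" and b: "1 \<le> b"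
  shows "lehman_U N r (int j) a b \<le> 2 ^ ((r + 3) * len)"
proof -
  have 1: "real r powr (real r + 3/2) \<le> 2 ^ ((r + 2) * len)"
  proof -
    have "real r powr (real r + 3/2) \<le> real r powr (real (r + 2))" using r_gt_1 by (intro powr_mono) auto
    also have "\<dots> = real r ^ (r + 2)" using r_gt_1 by (subst powr_realpow) auto
    also have "\<dots> \<le> (2 ^ len) ^ (r + 2)"
    proof (intro power_mono)
      have "r \<le> len" using r_less_len by simp
      also have "len \<le> 2 ^ len" by (simp add: less_imp_le)
      finally have "real r \<le> real (2 ^ len)" by (simp only: of_nat_le_iff)
      then show "real r \<le> 2 ^ len" by simp
    qed auto
    finally show ?thesis by (simp only: power_mult[symmetric] mult.commute[of len])
  qed
  have 2: "real_of_int N powr (1 / (2 * (real r + 2))) \<le> 2 ^ len"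
  proof -
    have "real_of_int N powr (1 / (2 * (real r + 2))) \<le> real_of_int N powr 1"
      using N_gt_1 by (intro powr_mono) auto
    also have "\<dots> = real_of_int N" using N_gt_1 by simp
    finally show ?thesis using N_less_real by linarith
  qed
  have 3: "2 powr (- (real r - 1) * real_of_int (int j) / 6 - 1) \<le> 1"
  proof -
    have "0 \<le> (real r - 1) * real j" using r_gt_1 by simp
    then have "- (real r - 1) * real_of_int (int j) / 6 - 1 \<le> 0" by (simp add: algebra_simps)
    then have "2 powr (- (real r - 1) * real_of_int (int j) / 6 - 1) \<le> 2 powr 0" by (intro powr_mono) auto
    then show ?thesis by simp
  qed
  have 4: "real_of_int (a * b) powr (- 1/2) \<le> 1"
  proof -
    have "1 * 1 \<le> a * b" using a b by (intro mult_mono) auto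
    then have "1 \<le> real_of_int (a * b)" by linarith
    then have "real_of_int (a * b) powr (- 1/2) \<le> real_of_int (a * b) powr 0" by (intro powr_mono) auto
    also have "\<dots> \<le> 1" by simp
    finally show ?thesis .
  qed
  have "lehman_U N r (int j) a b \<le> 2 ^ ((r + 2) * len) * 2 ^ len * 1 * 1"
    unfolding lehman_U_def by (intro mult_mono 1 2 3 4 mult_nonneg_nonneg) auto
  also have "\<dots> = 2 ^ ((r + 2) * len + len)" by (simp only: power_add mult_1_right)
  also have "(r + 2) * len + len = (r + 3) * len" by (simp add: algebra_simps)
  finally show ?thesis .
qed

lemma G_U_small:
  assumes "int j \<le> jmax" "1 \<le> a" "a \<le> amax (int j)" "1 \<le> b" "b \<le> bmax (int j)"
  shows "lehman_G N r a b + lehman_U N r (int j) a b + 1 \<le> 2 ^ ((r + 4) * len)"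
proof -
  have "lehman_G N r a b \<le> 2 ^ ((r + 3) * len)"
    by (rule order_trans[OF G_small[OF assms] power_increasing]) (use r_gt_1 in auto)
  moreover have "lehman_U N r (int j) a b \<le> 2 ^ ((r + 3) * len)" by (intro U_small assms)
  moreover have "1 \<le> (2::real) ^ ((r + 3) * len)" by simp
  ultimately have "lehman_G N r a b + lehman_U N r (int j) a b + 1 \<le> 4 * 2 ^ ((r + 3) * len)" by linarith
  also have "(4::real) = 2 ^ 2" by simp
  also have "2 ^ 2 * 2 ^ ((r + 3) * len) \<le> 2 ^ len * (2::real) ^ ((r + 3) * len)"
    using r_less_len r_gt_1 by (intro mult_right_mono power_increasing) auto
  also have "\<dots> = 2 ^ (len + (r + 3) * len)" by (simp only: power_add)
  also have "len + (r + 3) * len = (r + 4) * len" by (simp add: algebra_simps)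
  finally show ?thesis .
qed

lemma G_nonneg: "0 \<le> lehman_G N r a b"
  by (simp add: lehman_G_def)

lemma U_nonneg: "0 \<le> lehman_U N r j a b"
  by (simp add: lehman_U_def)

lemma G_power:
  assumes "1 \<le> a" "1 \<le> b"
  shows "lehman_G N r a b ^ (r + 1) = real_of_int ((int r + 1) ^ (r + 1) * (a * b ^ r * N))"
proof -
  have "0 < a * b ^ r * N" using assms N_gt_1 by simp
  then have pos: "0 < real_of_int (a * b ^ r * N)" by (simp only: of_int_0_less_iff)
  have "(real_of_int (a * b ^ r * N) powr (1 / (real r + 1))) ^ (r + 1) = real_of_int (a * b ^ r * N) ^ 1"
    by (rule powr_power_eq_power[OF pos]) (simp add: field_simps)
  then show ?thesis unfolding lehman_G_def power_mult_distrib by simp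
qed

text \<open>
  Numerator and denominator of \<open>U\<^bsup>6(r+2)\<^esup>\<close>; raising \<open>U\<close> to this power makes all exponents in its
  definition integral.
\<close>

definition U_num :: int where
  "U_num = int r ^ (3 * (r + 2) * (2 * r + 3)) * N ^ 3"

definition U_den :: "nat \<Rightarrow> int \<Rightarrow> int \<Rightarrow> int" where
  "U_den j a b = (a * b) ^ (3 * (r + 2)) * 2 ^ ((r - 1) * (r + 2) * j + 6 * (r + 2))"

lemma U_den_pos: "1 \<le> a \<Longrightarrow> 1 \<le> b \<Longrightarrow> 0 < U_den j a b"
  by (simp add: U_den_def)

lemma U_power:
  assumes "1 \<le> a" "1 \<le> b"
  shows "lehman_U N r (int j) a b ^ (6 * (r + 2)) = real_of_int U_num / real_of_int (U_den j a b)"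
proof -
  have "0 < a * b" using assms by simp
  then have pos: "0 < real_of_int (a * b)" by (simp only: of_int_0_less_iff)
  have 1: "(real r powr (real r + 3/2)) ^ (6 * (r + 2)) = real r ^ (3 * (r + 2) * (2 * r + 3))"
    using r_gt_1 by (intro powr_power_eq_power) (auto simp: algebra_simps)
  have 2: "(real_of_int N powr (1 / (2 * (real r + 2)))) ^ (6 * (r + 2)) = real_of_int N ^ 3"
    using N_gt_1 by (intro powr_power_eq_power) (auto simp: field_simps)
  have 3: "(2 powr (- (real r - 1) * real_of_int (int j) / 6 - 1)) ^ (6 * (r + 2))
      = 1 / 2 ^ ((r - 1) * (r + 2) * j + 6 * (r + 2))"
    using r_gt_1 by (intro powr_power_eq_inverse_power) (auto simp: field_simps of_nat_diff)
  have 4: "(real_of_int (a * b) powr (- 1/2)) ^ (6 * (r + 2)) = 1 / real_of_int (a * b) ^ (3 * (r + 2))"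
    by (rule powr_power_eq_inverse_power[OF pos]) (simp add: field_simps)
  show ?thesis unfolding lehman_U_def power_mult_distrib 1 2 3 4 U_num_def U_den_def by (simp add: power_mult_distrib)
qed

lemma U_den_small:
  assumes j: "int j \<le> jmax" and a: "1 \<le> a" "a \<le> amax (int j)" and b: "1 \<le> b" "b \<le> bmax (int j)"
  shows "U_den j a b \<le> 2 ^ (16 * (r + 2) * len)"
proof -
  have "a * b \<le> 2 ^ (2 * len) * 2 ^ len"
    using a_small[OF j a(2)] b_small[OF b(2)] N_less a b by (intro mult_mono) auto
  also have "\<dots> = 2 ^ (2 * len + len)" by (simp only: power_add)
  also have "2 * len + len = 3 * len" by simp
  finally have "(a * b) ^ (3 * (r + 2)) \<le> (2 ^ (3 * len)) ^ (3 * (r + 2))" using a b by (intro power_mono) auto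
  then have "U_den j a b \<le> (2 ^ (3 * len)) ^ (3 * (r + 2)) * 2 ^ ((r - 1) * (r + 2) * j + 6 * (r + 2))"
    unfolding U_den_def by (intro mult_right_mono) auto
  also have "\<dots> = 2 ^ (3 * len * (3 * (r + 2)) + ((r - 1) * (r + 2) * j + 6 * (r + 2)))"
    by (simp only: power_add power_mult)
  also have "3 * len * (3 * (r + 2)) + ((r - 1) * (r + 2) * j + 6 * (r + 2))
      = 9 * ((r + 2) * len) + (r - 1) * (r + 2) * j + 6 * (r + 2)" by (simp add: algebra_simps)
  also have "(2::int) ^ (9 * ((r + 2) * len) + (r - 1) * (r + 2) * j + 6 * (r + 2)) \<le> 2 ^ (16 * ((r + 2) * len))"
  proof (intro power_increasing)
    have "(r - 1) * (r + 2) * j \<le> r * (r + 2) * j" by (intro mult_right_mono) auto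
    also have "\<dots> \<le> len" by (rule j_small[OF j])
    also have "len \<le> (r + 2) * len" by simp
    finally have "(r - 1) * (r + 2) * j \<le> (r + 2) * len" .
    moreover have "(r + 2) * 1 \<le> (r + 2) * len" using r_less_len by (intro mult_left_mono) auto
    ultimately show "9 * ((r + 2) * len) + (r - 1) * (r + 2) * j + 6 * (r + 2) \<le> 16 * ((r + 2) * len)" by linarith
  qed auto
  finally show ?thesis by (simp only: mult.assoc)
qed

text \<open>
  Only \<open>u \<le> G + U + 1\<close> needs a proof. Then all quantities in \<open>root_sum_separation\<close> are powers of \<open>2\<close> with exponents
  that are polynomials in \<open>r\<close> times \<open>len\<close>; the total exponent stays below \<open>22 (r + 2)\<^sup>4 len\<close>.
\<close>

lemma G_U_separated:
  assumes j: "int j \<le> jmax" and a: "1 \<le> a" "a \<le> amax (int j)" and b: "1 \<le> b" "b \<le> bmax (int j)"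
    and u: "lehman_G N r a b + lehman_U N r (int j) a b < real_of_int u"
  shows "1 < 2 ^ precision r len * (real_of_int u - (lehman_G N r a b + lehman_U N r (int j) a b))"
proof (cases "real_of_int u \<le> lehman_G N r a b + lehman_U N r (int j) a b + 1")
  case False
  define \<epsilon> where "\<epsilon> = real_of_int u - (lehman_G N r a b + lehman_U N r (int j) a b)"
  have "1 < \<epsilon>" using False by (simp add: \<epsilon>_def)
  also have "1 * \<epsilon> \<le> 2 ^ precision r len * \<epsilon>" using \<open>1 < \<epsilon>\<close> by (intro mult_right_mono) auto
  finally show ?thesis by (simp add: \<epsilon>_def)
next
  case True
  define \<epsilon> where "\<epsilon> = real_of_int u - (lehman_G N r a b + lehman_U N r (int j) a b)"
  define m where "m = 6 * (r + 2)"
  have \<epsilon>: "0 < \<epsilon>" using u by (simp add: \<epsilon>_def)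
  have u0: "0 \<le> real_of_int u" using u G_nonneg[of a b] U_nonneg[of "int j" a b] by linarith
  have Q: "real_of_int (U_den j a b) \<le> 2 ^ (16 * (r + 2) * len)"
    using U_den_small[OF j a b] by (metis of_int_le_iff of_int_numeral of_int_power)
  have Q0: "0 < U_den j a b" using U_den_pos a b by simp
  have u_le: "real_of_int u \<le> 2 ^ ((r + 4) * len)" using True G_U_small[OF j a b] by linarith
  have len1: "1 \<le> len" using r_less_len by simp
  have sep: "1 \<le> real m * \<epsilon> * (2 * real_of_int (U_den j a b) * (2 * real_of_int u) ^ m) ^ (r + 1)"
    unfolding \<epsilon>_def
  proof (rule root_sum_separation)
    show "lehman_G N r a b ^ (r + 1) = real_of_int ((int r + 1) ^ (r + 1) * (a * b ^ r * N))"
      using a b by (intro G_power) auto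
    show "real_of_int (U_den j a b) * lehman_U N r (int j) a b ^ m = real_of_int U_num"
      using U_power[of a b j] a b Q0 by (simp add: m_def)
    show "0 < (int r + 1) ^ (r + 1) * (a * b ^ r * N)" using a b N_gt_1 by simp
  qed (use Q0 u G_nonneg U_nonneg in \<open>auto simp: m_def\<close>)
  have exponent: "len + 16 * (r + 2) * len + (len + (r + 4) * len) * m \<le> 16 * (r + 2) ^ 2 * len"
  proof -
    define s where "s = r - 2"
    have r: "r = s + 2" using r_gt_1 by (simp add: s_def)
    have "1 + 16 * (r + 2) + (r + 5) * m \<le> 16 * (r + 2) ^ 2"
      unfolding r m_def by (simp add: power2_eq_square algebra_simps)
    then have "(1 + 16 * (r + 2) + (r + 5) * m) * len \<le> 16 * (r + 2) ^ 2 * len" by (rule mult_right_mono) simp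
    then show ?thesis by (simp add: algebra_simps)
  qed
  have "2 * real_of_int (U_den j a b) * (2 * real_of_int u) ^ m
      \<le> 2 ^ len * 2 ^ (16 * (r + 2) * len) * (2 ^ len * 2 ^ ((r + 4) * len)) ^ m"
  proof (intro mult_mono power_mono)
    show "(2::real) \<le> 2 ^ len" using len1 power_increasing[of 1 len "2::real"] by simp
    then show "(2::real) \<le> 2 ^ len" .
  qed (use Q Q0 u0 u_le in auto)
  also have "\<dots> = 2 ^ (len + 16 * (r + 2) * len + (len + (r + 4) * len) * m)"
    by (simp only: power_add power_mult)
  also have "\<dots> \<le> 2 ^ (16 * (r + 2) ^ 2 * len)"
    by (rule power_increasing[OF exponent]) simp
  finally have "(2 * real_of_int (U_den j a b) * (2 * real_of_int u) ^ m) ^ (r + 1) \<le> (2 ^ (16 * (r + 2) ^ 2 * len)) ^ (r + 1)"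
    using Q0 u0 by (intro power_mono) auto
  also have "\<dots> = 2 ^ (16 * (r + 2) ^ 2 * len * (r + 1))" by (simp only: power_mult)
  finally have "real m * (2 * real_of_int (U_den j a b) * (2 * real_of_int u) ^ m) ^ (r + 1)
      \<le> 2 ^ m * 2 ^ (16 * (r + 2) ^ 2 * len * (r + 1))"
    by (intro mult_mono) (use Q0 u0 in \<open>auto simp: less_imp_le\<close>)
  also have "\<dots> < 2 ^ precision r len"
    unfolding power_add[symmetric]
  proof (intro power_strict_increasing)
    define R where "R = r + 2"
    have R1: "1 \<le> R" by (simp add: R_def)
    have R4: "R * len \<le> R ^ 4 * len" using R1 by (intro mult_right_mono) (auto simp: self_le_power)
    have "16 * R ^ 2 * len * (r + 1) \<le> 16 * R ^ 2 * len * R" by (simp add: R_def)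
    also have "\<dots> = 16 * (R ^ 3 * len)" by (simp add: power2_eq_square power3_eq_cube)
    also have "R ^ 3 * len \<le> R ^ 4 * len" using R1 by (intro mult_right_mono power_increasing) auto
    finally have 1: "16 * R ^ 2 * len * (r + 1) \<le> 16 * (R ^ 4 * len)" by simp
    have "R * 1 \<le> R * len" using len1 by (intro mult_left_mono) auto
    then have 2: "m \<le> 6 * (R ^ 4 * len)" using R4 by (simp add: m_def R_def)
    have "0 < R ^ 4 * len" using R1 len1 by simp
    moreover have "precision r len = 1000 * (R ^ 4 * len)" by (simp add: precision_def R_def)
    ultimately have "m + 16 * R ^ 2 * len * (r + 1) < precision r len" using 1 2 by linarith
    then show "m + 16 * (r + 2) ^ 2 * len * (r + 1) < precision r len" by (simp only: R_def)
  qed auto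
  finally have "real m * (2 * real_of_int (U_den j a b) * (2 * real_of_int u) ^ m) ^ (r + 1) * \<epsilon> < 2 ^ precision r len * \<epsilon>"
    using \<epsilon> by (rule mult_strict_right_mono)
  with sep show ?thesis unfolding \<epsilon>_def[symmetric] by (simp add: mult_ac)
qed

lemma result_upper_end:
  assumes j: "int j \<le> jmax" and a: "1 \<le> a" "a \<le> amax (int j)" and b: "1 \<le> b" "b \<le> bmax (int j)"
    and A: "A = (int r + 1) ^ (r + 1) * (a * b ^ r * N)"
  shows "result (upper_end M N r (int j) a b A) = \<lfloor>lehman_G N r a b + lehman_U N r (int j) a b\<rfloor>"
proof -
  define k where "k = precision r len"
  define m where "m = 6 * (r + 2)"
  define G where "G = lehman_G N r a b"
  define U where "U = lehman_U N r (int j) a b"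
  have g: "result (floor_root M (r + 1) (A * 2 ^ (k * (r + 1)))) = \<lfloor>2 ^ k * G\<rfloor>"
  proof (rule result_floor_root)
    have "(2 ^ k * G) ^ (r + 1) = real_of_int (A * 2 ^ (k * (r + 1)))"
      unfolding power_mult_distrib G_def G_power[OF a(1) b(1)] A by (simp add: power_mult[symmetric] mult.commute del: power_Suc)
    then show "A * 2 ^ (k * (r + 1)) = \<lfloor>(2 ^ k * G) ^ (r + 1)\<rfloor>" by (simp only: floor_of_int)
  qed (use G_nonneg in \<open>auto simp: G_def\<close>)
  have Q: "0 < U_den j a b" using U_den_pos a b by simp
  have P: "0 \<le> U_num * 2 ^ (m * k)" using N_gt_1 by (simp add: U_num_def)
  have v: "result (floor_root M m (U_num * 2 ^ (m * k) div U_den j a b)) = \<lfloor>2 ^ k * U\<rfloor>"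
  proof (rule result_floor_root)
    have "(2 ^ k * U) ^ m = real_of_int (U_num * 2 ^ (m * k)) / real_of_int (U_den j a b)"
      unfolding power_mult_distrib U_def m_def U_power[OF a(1) b(1)] by (simp add: power_mult[symmetric] mult.commute)
    then show "U_num * 2 ^ (m * k) div U_den j a b = \<lfloor>(2 ^ k * U) ^ m\<rfloor>"
      by (simp only: floor_divide_of_int_eq)
  qed (use U_nonneg in \<open>auto simp: U_def m_def\<close>)
  have e: "nat (int ((r - 1) * (r + 2)) * int j) = (r - 1) * (r + 2) * j"
    by (simp only: of_nat_mult[symmetric] nat_int)
  have "result (upper_end M N r (int j) a b A)
      = (result (floor_root M (r + 1) (A * 2 ^ (k * (r + 1))))
        + result (floor_root M m (fst (result (idivmod (U_num * 2 ^ (m * k)) (U_den j a b))))) + 1) div 2 ^ k"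
    unfolding upper_end_def Let_def by (simp only: result_bind_costed result_elementary result_ipow e k_def m_def U_num_def U_den_def)
  also have "\<dots> = (\<lfloor>2 ^ k * G\<rfloor> + \<lfloor>2 ^ k * U\<rfloor> + 1) div 2 ^ k"
    using result_idivmod[OF P Q] by (simp only: g v fst_conv)
  also have "\<dots> = \<lfloor>G + U\<rfloor>"
    unfolding G_def U_def k_def using G_U_separated[OF j a b] by (rule floor_sum_from_scaled_floors)
  finally show ?thesis unfolding G_def U_def .
qed

lemma result_search_ab:
  assumes j: "int j \<le> jmax" and a: "1 \<le> a" "a \<le> amax (int j)" and b: "1 \<le> b" "b \<le> bmax (int j)"
    and F: "F = \<lfloor>(real r + 1) * lehman_L N r (int j)\<rfloor>"
  shows "result (search_ab M N r (int j) F a b) = first_some (\<lambda>u. lehman_test N r (int j) a b u)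
      [\<lceil>lehman_G N r a b\<rceil>..\<lfloor>lehman_G N r a b + lehman_U N r (int j) a b\<rfloor>]"
proof -
  define A where "A = (int r + 1) ^ (r + 1) * (a * b ^ r * N)"
  define K where "K = int r ^ r * (a * b ^ r * N)"
  have lo: "result (ceiling_root M (r + 1) A) = \<lceil>lehman_G N r a b\<rceil>"
    using G_power[OF a(1) b(1)] G_nonneg by (intro result_ceiling_root) (auto simp: A_def)
  have hi: "result (upper_end M N r (int j) a b A) = \<lfloor>lehman_G N r a b + lehman_U N r (int j) a b\<rfloor>"
    using j a b A_def by (rule result_upper_end)
  have "result (search_ab M N r (int j) F a b) =
      first_some (\<lambda>u. result (test_u M N r F K u)) [\<lceil>lehman_G N r a b\<rceil>..\<lfloor>lehman_G N r a b + lehman_U N r (int j) a b\<rfloor>]"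
    unfolding search_ab_def
    by (simp only: result_bind_costed result_elementary result_ipow result_for_loop A_def[symmetric] K_def[symmetric] lo hi)
  also have "\<dots> = first_some (\<lambda>u. lehman_test N r (int j) a b u)
      [\<lceil>lehman_G N r a b\<rceil>..\<lfloor>lehman_G N r a b + lehman_U N r (int j) a b\<rfloor>]"
  proof (intro first_some_cong result_test_u)
    fix u assume "u \<in> set [\<lceil>lehman_G N r a b\<rceil>..\<lfloor>lehman_G N r a b + lehman_U N r (int j) a b\<rfloor>]"
    then have "lehman_G N r a b \<le> real_of_int u" by (simp add: ceiling_le_iff)
    then have "0 \<le> real_of_int u" using G_nonneg[of a b] by linarith
    then show "0 \<le> u" by simp
  qed (use r_gt_1 N_gt_1 a b F in \<open>auto simp: K_def\<close>)
  finally show ?thesis .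
qed

lemma result_scaled_radius: "result (floor_root M 12 (int r ^ 12 * N ^ 3 div 2 ^ (4 * j))) = \<lfloor>(real r + 1) * lehman_L N r (int j)\<rfloor>"
proof (rule result_floor_root)
  have "(real_of_int N powr (1/4)) ^ 12 = real_of_int N ^ 3"
    using N_gt_1 by (intro powr_power_eq_power) auto
  moreover have "(2 powr (- real_of_int (int j) / 3)) ^ 12 = 1 / 2 ^ (4 * j)"
    by (intro powr_power_eq_inverse_power) auto
  moreover have "(real r + 1) * lehman_L N r (int j) = real r * real_of_int N powr (1/4) * 2 powr (- real_of_int (int j) / 3)"
    by (simp add: lehman_L_def)
  ultimately have "((real r + 1) * lehman_L N r (int j)) ^ 12 = real r ^ 12 * real_of_int N ^ 3 * (1 / 2 ^ (4 * j))"
    by (simp only: power_mult_distrib)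
  then have "((real r + 1) * lehman_L N r (int j)) ^ 12 = real_of_int (int r ^ 12 * N ^ 3) / real_of_int (2 ^ (4 * j))"
    by simp
  then show "int r ^ 12 * N ^ 3 div 2 ^ (4 * j) = \<lfloor>((real r + 1) * lehman_L N r (int j)) ^ 12\<rfloor>"
    by (simp only: floor_divide_of_int_eq)
qed (auto simp: lehman_L_def)

lemma result_amax: "result (ceiling_root M 3 (2 ^ ((r + 2) * j + 3 * (r + 1)))) = amax (int j)"
  unfolding amax_def
proof (rule result_ceiling_root)
  show "real_of_int (2 ^ ((r + 2) * j + 3 * (r + 1))) = (2 powr ((real r + 2) * real_of_int (int j) / 3 + real r + 1)) ^ 3"
    by (subst powr_power_eq_power[where k = "(r + 2) * j + 3 * (r + 1)"]) (auto simp: field_simps)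
qed auto

lemma result_bmax: "result (floor_root M (3 * (r + 2)) (N ^ 3 div 2 ^ ((2 * r + 1) * (r + 2) * j))) = bmax (int j)"
  unfolding bmax_def
proof (rule result_floor_root)
  have "(real_of_int N powr (1 / (real r + 2))) ^ (3 * (r + 2)) = real_of_int N ^ 3"
    using N_gt_1 by (intro powr_power_eq_power) (auto simp: field_simps)
  moreover have "(2 powr (- (2 * real r + 1) * real_of_int (int j) / 3)) ^ (3 * (r + 2)) = 1 / 2 ^ ((2 * r + 1) * (r + 2) * j)"
    by (intro powr_power_eq_inverse_power) (auto simp: field_simps)
  ultimately have "(real_of_int N powr (1 / (real r + 2)) * 2 powr (- (2 * real r + 1) * real_of_int (int j) / 3)) ^ (3 * (r + 2))
      = real_of_int (N ^ 3) / real_of_int (2 ^ ((2 * r + 1) * (r + 2) * j))"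
    by (simp only: power_mult_distrib) simp
  then show "N ^ 3 div 2 ^ ((2 * r + 1) * (r + 2) * j)
    = \<lfloor>(real_of_int N powr (1 / (real r + 2)) * 2 powr (- (2 * real r + 1) * real_of_int (int j) / 3)) ^ (3 * (r + 2))\<rfloor>"
    by (simp only: floor_divide_of_int_eq)
qed auto

lemma result_search_j:
  assumes j: "int j \<le> jmax"
  shows "result (search_j M N r (int j)) =
    first_some (\<lambda>a. first_some (\<lambda>b. first_some (\<lambda>u. lehman_test N r (int j) a b u)
             [\<lceil>lehman_G N r a b\<rceil>..\<lfloor>lehman_G N r a b + lehman_U N r (int j) a b\<rfloor>]) [1..bmax (int j)]) [1..amax (int j)]"
proof -
  define F where "F = \<lfloor>(real r + 1) * lehman_L N r (int j)\<rfloor>"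
  have F: "result (floor_root M 12 (int r ^ 12 * N ^ 3 div 2 ^ (4 * j))) = F"
    unfolding F_def by (rule result_scaled_radius)
  have e: "nat (4 * int j) = 4 * j" "nat (int (r + 2) * int j) = (r + 2) * j"
    "nat (int ((2 * r + 1) * (r + 2)) * int j) = (2 * r + 1) * (r + 2) * j"
  proof -
    have "4 * int j = int (4 * j)" by simp
    then show "nat (4 * int j) = 4 * j" by (simp only: nat_int)
  qed (simp_all only: of_nat_mult[symmetric] nat_int)
  have "result (search_j M N r (int j)) = first_some (\<lambda>a. first_some (\<lambda>b. result (search_ab M N r (int j) F a b)) [1..bmax (int j)]) [1..amax (int j)]"
    unfolding search_j_def
    by (simp only: result_bind_costed result_elementary result_ipow result_for_loop e mult_1 F result_amax result_bmax)
  also have "\<dots> = first_some (\<lambda>a. first_some (\<lambda>b. first_some (\<lambda>u. lehman_test N r (int j) a b u)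
             [\<lceil>lehman_G N r a b\<rceil>..\<lfloor>lehman_G N r a b + lehman_U N r (int j) a b\<rfloor>]) [1..bmax (int j)]) [1..amax (int j)]"
    by (intro first_some_cong result_search_ab) (use j F_def in auto)
  finally show ?thesis .
qed

lemma first_some_guard:
  "first_some (\<lambda>n. if P n then Some n else None) xs = find P xs"
  by (induction xs) auto

lemma result_nmax: "result (floor_root M (r + 2) N) = \<lfloor>real_of_int N powr (1 / (real r + 2))\<rfloor>"
proof (rule result_floor_root)
  have "(real_of_int N powr (1 / (real r + 2))) ^ (r + 2) = real_of_int N ^ 1"
    using N_gt_1 r_gt_1 by (intro powr_power_eq_power) auto
  then show "N = \<lfloor>(real_of_int N powr (1 / (real r + 2))) ^ (r + 2)\<rfloor>" by simp
qed (use r_gt_1 in auto)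

lemma result_lehman_program: "result (lehman_program M N r) = lehman N r"
proof -
  have s: "result (floor_root M r N) = \<lfloor>real_of_int N powr (1 / real r)\<rfloor>"
  proof (rule result_floor_root)
    have "(real_of_int N powr (1 / real r)) ^ r = real_of_int N ^ 1"
      using N_gt_1 r_gt_1 by (intro powr_power_eq_power) auto
    then show "N = \<lfloor>(real_of_int N powr (1 / real r)) ^ r\<rfloor>" by simp
  qed (use r_gt_1 in auto)
  have jm: "fst (result (idivmod (int len - 1) (int (r * (r + 2))))) = jmax"
    unfolding jmax_eq using r_less_len period_pos by (subst result_idivmod) simp_all
  have small: "first_some (\<lambda>n. if snd (result (idivmod N n)) = 0 then Some n else None)
      [2..\<lfloor>real_of_int N powr (1 / (real r + 2))\<rfloor>] = find (\<lambda>n. n dvd N) [2..\<lfloor>real_of_int N powr (1 / (real r + 2))\<rfloor>]"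
    unfolding first_some_guard[symmetric]
  proof (rule first_some_cong)
    fix n assume "n \<in> set [2..\<lfloor>real_of_int N powr (1 / (real r + 2))\<rfloor>]"
    then have "0 < n" by simp
    then show "(if snd (result (idivmod N n)) = 0 then Some n else None) = (if n dvd N then Some n else None)"
      using N_gt_1 result_idivmod[of N n] by (simp add: dvd_eq_mod_eq_0)
  qed
  have main: "first_some (\<lambda>j. result (search_j M N r j)) [0..jmax] = lehman_main N r"
    unfolding lehman_main_def jmax_def[symmetric]
  proof (rule first_some_cong)
    fix j assume "j \<in> set [0..jmax]"
    then obtain i where "j = int i" "int i \<le> jmax" by (auto intro: nonneg_int_cases)
    then show "result (search_j M N r j) =
       first_some (\<lambda>a.
         first_some (\<lambda>b.
           first_some (\<lambda>u. lehman_test N r j a b u)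
             [\<lceil>lehman_G N r a b\<rceil>..\<lfloor>lehman_G N r a b + lehman_U N r j a b\<rfloor>])
           [1..\<lfloor>real_of_int N powr (1 / (real r + 2))
                * 2 powr (- (2 * real r + 1) * real_of_int j / 3)\<rfloor>])
         [1..\<lceil>2 powr ((real r + 2) * real_of_int j / 3 + real r + 1)\<rceil>]"
      using result_search_j[of i M] unfolding amax_def bmax_def by simp
  qed
  show ?thesis
    unfolding lehman_program_def lehman_def Let_def
    by (simp only: result_bind_costed result_elementary result_ipow result_for_loop result_return s result_nmax small jm main
       if_distrib[of result] option.case_distrib[of result])
qed

end

section \<open>Bit operations of the arithmetic subroutines\<close>

lemma bits_pos: "1 \<le> bits x"
  by (simp add: bits_def)

lemma bits_leI: "\<bar>x\<bar> < 2 ^ n \<Longrightarrow> 1 \<le> n \<Longrightarrow> bits x \<le> n"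
proof -
  assume *: "\<bar>x\<bar> < 2 ^ n" "1 \<le> n"
  then have "nat \<bar>x\<bar> < 2 ^ n" by (simp add: nat_less_iff)
  then have "floorlog 2 (nat \<bar>x\<bar>) \<le> n" by (intro floorlog_leI) auto
  then show ?thesis using *(2) by (simp add: bits_def)
qed

lemma abs_less_two_power_bits: "\<bar>x\<bar> < 2 ^ bits x"
  using less_two_power_bits[of "\<bar>x\<bar>"] by (simp add: bits_def)

lemma bits_mono: "\<bar>x\<bar> \<le> \<bar>y\<bar> \<Longrightarrow> bits x \<le> bits y"
  using abs_less_two_power_bits[of y] by (intro bits_leI bits_pos) linarith

lemma bits_mono_nonneg: "0 \<le> x \<Longrightarrow> x \<le> y \<Longrightarrow> bits x \<le> bits y"
  by (intro bits_mono) simp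

lemma bits_mult: "bits (x * y) \<le> bits x + bits y"
proof (rule bits_leI)
  have "\<bar>x\<bar> * \<bar>y\<bar> < 2 ^ bits x * 2 ^ bits y"
    by (intro mult_strict_mono abs_less_two_power_bits) auto
  then show "\<bar>x * y\<bar> < 2 ^ (bits x + bits y)" by (simp add: abs_mult power_add)
qed (use bits_pos[of x] in simp)

lemma bits_power_le: "bits (x ^ k) \<le> max 1 (k * bits x)"
proof (induction k)
  case 0
  then show ?case by (intro bits_leI) auto
next
  case (Suc k)
  show ?case
  proof (cases "k = 0")
    case False
    have "bits (x ^ Suc k) \<le> bits x + bits (x ^ k)" by (simp add: bits_mult)
    moreover have "1 \<le> k * bits x" using False bits_pos[of x] by simp
    ultimately show ?thesis using Suc by simp
  qed simp
qed

lemma bits_power: "1 \<le> k \<Longrightarrow> bits (x ^ k) \<le> k * bits x"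
  using bits_power_le[of x k] bits_pos[of x] mult_le_mono[of 1 k 1 "bits x"] by simp

lemma bits_add: "bits (x + y) \<le> max (bits x) (bits y) + 1"
proof (rule bits_leI)
  have "(2::int) ^ bits x \<le> 2 ^ max (bits x) (bits y)" "(2::int) ^ bits y \<le> 2 ^ max (bits x) (bits y)"
    by (intro power_increasing; simp)+
  moreover have "(2::int) ^ (max (bits x) (bits y) + 1) = 2 * 2 ^ max (bits x) (bits y)" by simp
  ultimately show "\<bar>x + y\<bar> < 2 ^ (max (bits x) (bits y) + 1)"
    using abs_less_two_power_bits[of x] abs_less_two_power_bits[of y] by linarith
qed simp

lemma bits_uminus: "bits (- x) = bits x"
  by (simp add: bits_def)

lemma bits_diff: "bits (x - y) \<le> max (bits x) (bits y) + 1"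
  using bits_add[of x "- y"] by (simp add: bits_uminus)

lemma bits_diff_nonneg:
  assumes "0 \<le> x" "0 \<le> y"
  shows "bits (x - y) \<le> max (bits x) (bits y)"
proof (rule bits_leI)
  have "(2::int) ^ bits x \<le> 2 ^ max (bits x) (bits y)" "(2::int) ^ bits y \<le> 2 ^ max (bits x) (bits y)"
    by (intro power_increasing; simp)+
  then show "\<bar>x - y\<bar> < 2 ^ max (bits x) (bits y)"
    using abs_less_two_power_bits[of x] abs_less_two_power_bits[of y] assms by linarith
qed (use bits_pos[of x] in simp)

lemma bits_two_power: "bits (2 ^ k) \<le> k + 1"
  by (intro bits_leI) auto

lemma bits_shift: "bits (x * 2 ^ k) \<le> bits x + k"
proof (rule bits_leI)
  have "\<bar>x\<bar> * 2 ^ k < 2 ^ bits x * 2 ^ k" by (intro mult_strict_right_mono abs_less_two_power_bits) auto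
  then show "\<bar>x * 2 ^ k\<bar> < 2 ^ (bits x + k)" by (simp add: abs_mult power_add)
qed (use bits_pos[of x] in simp)

lemma bits_div: "0 \<le> x \<Longrightarrow> 0 < y \<Longrightarrow> bits (x div y) \<le> bits x"
proof (rule bits_mono_nonneg)
  assume xy: "0 \<le> x" "0 < y"
  show "0 \<le> x div y" using xy by (simp add: pos_imp_zdiv_nonneg_iff)
  show "x div y \<le> x" using xy by (cases "x = 0") (auto intro: int_div_le_self)
qed

lemma bits_of_nat: "bits (int k) \<le> max 1 k"
proof (rule bits_leI)
  have "k < 2 ^ k" by (rule less_exp)
  also have "(2::nat) ^ k \<le> 2 ^ max 1 k" by (intro power_increasing) auto
  finally have "int k < int (2 ^ max 1 k)" by (simp only: of_nat_less_iff)
  then show "\<bar>int k\<bar> < 2 ^ max 1 k" by simp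
qed simp

lemma bit_operations_elementary [simp]:
  "bit_operations (return x) = 0"
  "bit_operations (iadd a b) = max (bits a) (bits b)" "bit_operations (isub a b) = max (bits a) (bits b)"
  "bit_operations (ileq a b) = max (bits a) (bits b)" "bit_operations (ieq a b) = max (bits a) (bits b)"
  "bit_operations (ishl a k) = bits a + k" "bit_operations (ishr a k) = bits a"
  "bit_operations (ilen a) = bits a" "bit_operations (imul M a b) = M (max (bits a) (bits b))"
  by (simp_all add: return_def iadd_def isub_def ileq_def ieq_def ishl_def ishr_def ilen_def imul_def)

lemma bits_one [simp]: "bits 1 = 1" and bits_zero [simp]: "bits 0 = 1" and bits_minus_one [simp]: "bits (- 1) = 1"
  using bits_leI[of 1 1] bits_pos[of 1] bits_leI[of 0 1] bits_pos[of 0] bits_uminus[of 1] by simp_all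

lemma cost_idivmod_loop:
  assumes "0 < y" "0 \<le> m" "bits m \<le> w" "bits y + i \<le> w" "0 \<le> q" "q + 2 ^ i \<le> 2 ^ w"
  shows "bit_operations (idivmod_loop i y q m) \<le> i * (5 * w)"
  using assms(2-)
proof (induction i arbitrary: q m)
  case (Suc i)
  have q: "bits q \<le> w"
  proof (rule bits_leI)
    have "0 < (2::int) ^ Suc i" by simp
    then show "\<bar>q\<bar> < 2 ^ w" using Suc.prems(4,5) by linarith
  qed (use Suc.prems in simp)
  have s: "bits (y * 2 ^ i) \<le> w" using bits_shift[of y i] Suc.prems(3) by simp
  have t: "bits (2 ^ i) \<le> w" using bits_two_power[of i] Suc.prems(3) bits_pos[of y] by simp
  show ?case
  proof (cases "y * 2 ^ i \<le> m")
    case True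
    have "bits (m - y * 2 ^ i) \<le> bits m" using True assms(1) Suc.prems(1) by (intro bits_mono_nonneg) auto
    then have "bit_operations (idivmod_loop i y (q + 2 ^ i) (m - y * 2 ^ i)) \<le> i * (5 * w)"
      using True Suc.prems by (intro Suc.IH) auto
    then show ?thesis using True q s t Suc.prems bits_pos[of y] by simp
  next
    case False
    have "q + 2 ^ i \<le> 2 ^ w" using Suc.prems(5) by (simp add: order_trans[rotated])
    then have "bit_operations (idivmod_loop i y q m) \<le> i * (5 * w)"
      using Suc.prems by (intro Suc.IH) auto
    then show ?thesis using False q s t Suc.prems by simp
  qed
qed simp

text \<open>
  The factor \<open>bits x - bits y + 1\<close>, rather than \<open>n\<close>, is what makes the Euclidean algorithm quadratic.
\<close>

lemma cost_idivmod:
  assumes "0 \<le> x" "0 < y" "bits x + 1 \<le> n" "bits y + 1 \<le> n"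
  shows "bit_operations (idivmod x y) \<le> 2 * n + (bits x - bits y + 1) * (5 * n)"
proof -
  have "bit_operations (idivmod_loop (bits x - bits y + 1) y 0 x) \<le> (bits x - bits y + 1) * (5 * n)"
  proof (rule cost_idivmod_loop)
    show "bits y + (bits x - bits y + 1) \<le> n" using assms by linarith
    show "0 + 2 ^ (bits x - bits y + 1) \<le> (2::int) ^ n" unfolding add_0
      using assms by (intro power_increasing) auto
  qed (use assms in auto)
  then show ?thesis using assms by (simp add: idivmod_def del: idivmod_loop.simps)
qed

lemma cost_idivmod_square:
  assumes "0 \<le> x" "0 < y" "bits x + 1 \<le> n" "bits y + 1 \<le> n"
  shows "bit_operations (idivmod x y) \<le> 7 * (n * n)"
proof -
  have "(bits x - bits y + 1) * (5 * n) \<le> n * (5 * n)" using assms bits_pos[of y] by (intro mult_right_mono) auto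
  moreover have "1 * n \<le> n * n" using assms by (intro mult_right_mono) auto
  ultimately show ?thesis using cost_idivmod[OF assms] by simp
qed

lemma cost_igcd_unfold:
  assumes "0 < y"
  shows "bit_operations (igcd x y) = max (bits y) 1 + bit_operations (idivmod x y) + bit_operations (igcd y (snd (result (idivmod x y))))"
  using assms by (subst igcd_unfold) simp

text \<open>
  The bit length with \<open>blen 0 = 0\<close>; unlike \<^const>\<open>bits\<close> it drops in the last step of the Euclidean algorithm too.
\<close>

definition blen :: "int \<Rightarrow> nat" where
  "blen x = floorlog 2 (nat x)"

lemma bits_eq_blen: "0 < x \<Longrightarrow> bits x = blen x"
  using floorlog_bounds[of "nat x" 2] by (auto simp: bits_def blen_def floorlog_def)

lemma blen_le_bits: "0 \<le> x \<Longrightarrow> blen x \<le> bits x"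
  by (simp add: bits_def blen_def)

lemma blen_half_less:
  assumes "0 \<le> z" "2 * z < x"
  shows "blen z + 1 \<le> blen x"
proof -
  have x: "0 < x" using assms by linarith
  then have "blen x \<ge> 1" using bits_pos[of x] by (simp add: bits_eq_blen)
  moreover have "x < 2 ^ blen x" using less_two_power_bits[of x] x by (simp add: bits_eq_blen)
  ultimately have "2 * z < 2 * 2 ^ (blen x - 1)" using assms by (simp flip: power_Suc)
  then have "nat z < 2 ^ (blen x - 1)" using assms(1) by (simp add: nat_less_iff)
  then have "blen z \<le> blen x - 1" unfolding blen_def by (intro floorlog_leI) auto
  then show ?thesis using \<open>blen x \<ge> 1\<close> by simp
qed

lemma blen_mono:
  assumes "0 \<le> z" "z \<le> x"
  shows "blen z \<le> blen x"
  unfolding blen_def using assms by (intro floorlog_mono) auto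

text \<open>
  Amortized analysis with the potential \<open>blen x + blen y\<close>. One step replaces \<open>(x, y)\<close> by \<open>(y, x mod y)\<close>, so the
  potential drops by \<open>blen x - blen (x mod y)\<close>. This is at least \<open>1\<close>, because \<open>x mod y < x/2\<close>, and at least
  \<open>blen x - blen y\<close>, hence it pays for the division.
\<close>

lemma cost_igcd_ordered:
  assumes "0 \<le> y" "y \<le> x" "0 < x" "bits x + 1 \<le> n"
  shows "bit_operations (igcd x y) \<le> n + 13 * n * (blen x + blen y)"
  using assms
proof (induction "nat y" arbitrary: x y rule: less_induct)
  case less
  show ?case
  proof (cases "y = 0")
    case True
    then show ?thesis using less.prems by (subst igcd_unfold) simp
  next
    case False
    then have y: "0 < y" using less.prems by simp
    define z where "z = x mod y"
    have z: "0 \<le> z" "z < y" using y by (auto simp: z_def)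
    have "2 * z < x"
    proof -
      have "1 \<le> x div y" using y less.prems by (simp add: pos_imp_zdiv_pos_iff int_one_le_iff_zero_less)
      then have "y * 1 \<le> y * (x div y)" using y by (intro mult_left_mono) auto
      moreover have "x = y * (x div y) + z" by (simp add: z_def)
      ultimately show ?thesis using z by linarith
    qed
    then have D1: "blen z + 1 \<le> blen x" using z by (intro blen_half_less)
    have D2: "blen z \<le> blen y" "blen y \<le> blen x" using z less.prems by (auto intro: blen_mono)
    have by_n: "bits y + 1 \<le> n" using less.prems bits_mono_nonneg[of y x] by simp
    have IH: "bit_operations (igcd y z) \<le> n + 13 * n * (blen y + blen z)"
      using less.prems y z by_n by (intro less.hyps) auto
    have dm: "bit_operations (idivmod x y) \<le> 2 * n + (blen x - blen y + 1) * (5 * n)"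
      using cost_idivmod[of x y n] less.prems y by_n by (simp add: bits_eq_blen)
    have "bit_operations (igcd x y) \<le> n + (2 * n + (blen x - blen y + 1) * (5 * n)) + (n + 13 * n * (blen y + blen z))"
      using cost_igcd_unfold[OF y, of x] dm IH by_n less.prems y by (simp add: result_idivmod z_def)
    also have "\<dots> = n * (4 + (blen x - blen y + 1) * 5 + 13 * (blen y + blen z))" by (simp add: algebra_simps)
    also have "\<dots> \<le> n * (1 + 13 * (blen x + blen y))" using D1 D2 by (intro mult_left_mono) auto
    finally show ?thesis by (simp add: algebra_simps)
  qed
qed

lemma cost_igcd:
  assumes "0 < x" "0 \<le> y" "bits x + 1 \<le> n" "bits y + 1 \<le> n"
  shows "bit_operations (igcd x y) \<le> 40 * (n * n)"
proof -
  have n: "1 * n \<le> n * n" using assms by (intro mult_right_mono) auto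
  have ordered: "bit_operations (igcd x y) \<le> 27 * (n * n)" if "0 \<le> y" "y \<le> x" "0 < x" "bits x + 1 \<le> n" for x y
  proof -
    have "blen x + blen y \<le> 2 * n" using that blen_le_bits[of x] blen_mono[of y x] by simp
    then have "13 * n * (blen x + blen y) \<le> 13 * n * (2 * n)" by (rule mult_left_mono) simp
    also have "\<dots> = 26 * (n * n)" by simp
    finally show ?thesis using cost_igcd_ordered[OF that] n by linarith
  qed
  show ?thesis
  proof (cases "y \<le> x")
    case True
    then show ?thesis using ordered[of y x] assms by simp
  next
    case False
    then have "x < y" by simp
    then have "bit_operations (igcd x y) = max (bits y) 1 + bit_operations (idivmod x y) + bit_operations (igcd y x)"
      using assms cost_igcd_unfold[of y x] by (simp add: result_idivmod)
    moreover have "bit_operations (igcd y x) \<le> 27 * (n * n)" using assms \<open>x < y\<close> by (intro ordered) auto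
    moreover have "bit_operations (idivmod x y) \<le> 7 * (n * n)" using assms \<open>x < y\<close> by (intro cost_idivmod_square) auto
    moreover have "max (bits y) 1 \<le> n" using assms by simp
    ultimately show ?thesis using n by linarith
  qed
qed

lemma le_of_mult_le: "1 \<le> k \<Longrightarrow> k * w \<le> n \<Longrightarrow> w \<le> n" for k w n :: nat
  using mult_le_mono1[of 1 k w] by linarith

text \<open>
  All operands will have at most \<open>n\<close> bits, and \<open>m\<close> bounds the cost of one multiplication of such operands. The
  bounds below are multiples of \<open>n m\<close>, that is, of \<open>n\<close> multiplications.
\<close>

locale mult_cost =
  fixes M :: "nat \<Rightarrow> nat" and n m :: nat
  assumes M_le: "1 \<le> i \<Longrightarrow> i \<le> n \<Longrightarrow> M i \<le> m" and n_le_m: "n \<le> m" and n_pos: "1 \<le> n"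
begin

lemma n_le: "n \<le> n * m" and m_le: "m \<le> n * m" and one_le: "1 \<le> n * m" and sq_le: "n * n \<le> n * m"
proof -
  show m: "m \<le> n * m" using n_pos by simp
  show "n \<le> n * m" "1 \<le> n * m" using m n_le_m n_pos by linarith+
  show "n * n \<le> n * m" using n_le_m by simp
qed

lemma cost_imul: "bits x \<le> n \<Longrightarrow> bits y \<le> n \<Longrightarrow> bit_operations (imul M x y) \<le> m"
  using bits_pos[of x] by (simp add: M_le)

lemma cost_ipow: "k * bits x \<le> n \<Longrightarrow> bit_operations (ipow M x k) \<le> k * m"
proof (induction k)
  case (Suc k)
  have "bits (x ^ k) \<le> n" using bits_power_le[of x k] Suc.prems n_pos by auto
  then have "bit_operations (imul M (x ^ k) x) \<le> m" using Suc.prems by (intro cost_imul) auto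
  then show ?case using Suc by simp
qed simp

lemma cost_floor_root_loop:
  assumes "0 \<le> x" "x + 2 ^ i \<le> 2 ^ w" "k * w \<le> n" "bits v \<le> n" "1 \<le> k"
  shows "bit_operations (floor_root_loop M k v i x) \<le> i * ((k + 3) * m)"
  using assms(1,2)
proof (induction i arbitrary: x)
  case (Suc i)
  have "(2::int) ^ Suc i \<le> 2 ^ w" using Suc.prems by linarith
  then have iw: "Suc i \<le> w" by (rule power_le_imp_le_exp[rotated]) simp
  have wn: "w \<le> n" using assms(5,3) by (rule le_of_mult_le)
  have y: "x + 2 ^ i < 2 ^ w" using Suc.prems by (simp add: algebra_simps) (smt (verit) zero_less_power)
  have by_w: "bits (x + 2 ^ i) \<le> w" using y Suc.prems iw by (intro bits_leI) auto
  have bx: "bits x \<le> w" using bits_mono_nonneg[of x "x + 2 ^ i"] Suc.prems(1) by_w by simp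
  have "k * bits (x + 2 ^ i) \<le> n" using by_w assms(3) by (meson le_trans mult_le_mono2)
  then have pw: "bit_operations (ipow M (x + 2 ^ i) k) \<le> k * m" "bits ((x + 2 ^ i) ^ k) \<le> n"
    using cost_ipow bits_power[OF assms(5), of "x + 2 ^ i"] by (auto intro: le_trans)
  have two: "bits (2 ^ i) \<le> n" using bits_two_power[of i] iw wn by linarith
  have small: "bit_operations (floor_root_loop M k v i x) \<le> i * ((k + 3) * m)"
    using Suc.prems by (intro Suc.IH) (auto simp: order_trans[rotated])
  have big: "bit_operations (floor_root_loop M k v i (x + 2 ^ i)) \<le> i * ((k + 3) * m)"
    using Suc.prems by (intro Suc.IH) auto
  define rest where "rest = (if (x + 2 ^ i) ^ k \<le> v then bit_operations (floor_root_loop M k v i (x + 2 ^ i))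
      else bit_operations (floor_root_loop M k v i x))"
  have "bit_operations (floor_root_loop M k v (Suc i) x) = (1 + i) + max (bits x) (bits (2 ^ i))
      + bit_operations (ipow M (x + 2 ^ i) k) + max (bits ((x + 2 ^ i) ^ k)) (bits v) + rest"
    by (simp add: rest_def)
  moreover have "1 + i \<le> m" "max (bits x) (bits (2 ^ i)) \<le> m" "max (bits ((x + 2 ^ i) ^ k)) (bits v) \<le> m"
    using iw wn bx two pw(2) assms(4) n_le_m by auto
  moreover have "rest \<le> i * ((k + 3) * m)" using small big by (simp add: rest_def)
  moreover have "Suc i * ((k + 3) * m) = k * m + 3 * m + i * ((k + 3) * m)" by (simp add: algebra_simps)
  ultimately show ?case using pw(1) by linarith
qed simp

lemma cost_floor_root:
  assumes "k * bits v \<le> n" "1 \<le> k"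
  shows "bit_operations (floor_root M k v) \<le> (k + 4) * (n * m)"
proof -
  have bv: "bits v \<le> n" using assms(2,1) by (rule le_of_mult_le)
  have "bit_operations (floor_root_loop M k v (bits v) 0) \<le> bits v * ((k + 3) * m)"
    using assms bv by (intro cost_floor_root_loop) auto
  also have "\<dots> \<le> n * ((k + 3) * m)" using bv by (rule mult_right_mono) simp
  finally have "bit_operations (floor_root M k v) \<le> n + n * ((k + 3) * m)" using bv by (simp add: floor_root_def)
  moreover have "n * ((k + 3) * m) + n * m = (k + 4) * (n * m)" by (simp add: algebra_simps)
  ultimately show ?thesis using n_le by linarith
qed

lemma bits_floor_root:
  assumes "0 \<le> v" "1 \<le> k"
  shows "bits (result (floor_root M k v)) \<le> bits v"
proof -
  define s where "s = result (floor_root M k v)"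
  have s: "0 \<le> s" "s ^ k \<le> v" using result_floor_root_bounds[of k v M] assms by (auto simp: s_def)
  have "s \<le> v"
  proof (cases "s = 0")
    case False
    then have "s ^ 1 \<le> s ^ k" using s(1) assms(2) by (intro power_increasing) auto
    then show ?thesis using s(2) by simp
  qed (use assms in simp)
  then show ?thesis unfolding s_def[symmetric] using s(1) by (intro bits_mono_nonneg)
qed

lemma cost_ceiling_root:
  assumes "k * bits v \<le> n" "1 \<le> k" "0 \<le> v"
  shows "bit_operations (ceiling_root M k v) \<le> (2 * k + 6) * (n * m)"
proof -
  define s where "s = result (floor_root M k v)"
  have bv: "bits v \<le> n" using assms(2,1) by (rule le_of_mult_le)
  have bs: "bits s \<le> bits v" unfolding s_def using assms by (intro bits_floor_root)
  then have "k * bits s \<le> n" using assms(1) by (meson le_trans mult_le_mono2)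
  then have "bit_operations (ipow M s k) \<le> k * m" "bits (s ^ k) \<le> n"
    using cost_ipow bits_power[OF assms(2), of s] by (auto intro: le_trans)
  moreover have "max (bits (s ^ k)) (bits v) \<le> n" "max (bits s) 1 \<le> n" using calculation(2) bs bv n_pos by auto
  moreover have "bit_operations (ceiling_root M k v)
      \<le> bit_operations (floor_root M k v) + bit_operations (ipow M s k) + max (bits (s ^ k)) (bits v) + max (bits s) 1"
    by (simp add: ceiling_root_def s_def[symmetric])
  moreover have "k * m \<le> k * (n * m)" using m_le by (rule mult_left_mono) simp
  moreover have "(k + 4) * (n * m) + k * (n * m) + 2 * (n * m) = (2 * k + 6) * (n * m)" by (simp add: algebra_simps)
  ultimately show ?thesis using n_le cost_floor_root[OF assms(1,2)] by linarith
qed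

lemma cost_bisect_unfold:
  "bit_operations (bisect right lo hi) = max (bits hi) (bits lo) + max (bits (hi - lo)) 1 + (if hi - lo \<le> 1 then 0
     else max (bits lo) (bits hi) + bits (lo + hi) + bit_operations (right ((lo + hi) div 2)) +
      (if result (right ((lo + hi) div 2)) then bit_operations (bisect right ((lo + hi) div 2) hi)
     else bit_operations (bisect right lo ((lo + hi) div 2))))"
  by (subst bisect.simps) simp

text \<open>
  Each step halves the length of the interval, so \<open>p\<close> steps reduce it from \<open>2\<^sup>p\<close> to \<open>1\<close>.
\<close>

lemma cost_bisect:
  assumes "0 \<le> lo" "lo \<le> hi" "hi - lo \<le> 2 ^ p" "bits hi + 1 \<le> n"
    and "\<And>x. lo \<le> x \<Longrightarrow> x \<le> hi \<Longrightarrow> bit_operations (right x) \<le> R"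
  shows "bit_operations (bisect right lo hi) \<le> (p + 1) * (4 * n + R)"
  using assms
proof (induction p arbitrary: lo hi)
  case 0
  have "bits lo \<le> bits hi" "bits (hi - lo) \<le> bits hi" using 0 by (auto intro: bits_mono_nonneg)
  then show ?case using 0 n_pos by (subst cost_bisect_unfold) auto
next
  case (Suc p)
  define mid where "mid = (lo + hi) div 2"
  have b: "bits lo \<le> bits hi" "bits (hi - lo) \<le> bits hi" using Suc.prems by (auto intro: bits_mono_nonneg)
  have "bits (lo + hi) \<le> n" using bits_add[of lo hi] b(1) Suc.prems(4) by simp
  then have step: "bit_operations (bisect right lo hi) \<le> 4 * n + (if hi - lo \<le> 1 then 0 else bit_operations (right mid) +
      (if result (right mid) then bit_operations (bisect right mid hi) else bit_operations (bisect right lo mid)))"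
    using b Suc.prems(4) n_pos by (subst cost_bisect_unfold) (auto simp: mid_def)
  show ?case
  proof (cases "hi - lo \<le> 1")
    case True
    then show ?thesis using step by (simp add: algebra_simps)
  next
    case False
    have mid: "lo < mid" "mid < hi" "hi - mid \<le> 2 ^ p" "mid - lo \<le> 2 ^ p"
      using False Suc.prems(3) by (auto simp: mid_def)
    have "bits mid \<le> bits hi" using mid Suc.prems(1) by (intro bits_mono_nonneg) auto
    have "bit_operations (bisect right mid hi) \<le> (p + 1) * (4 * n + R)"
      by (rule Suc.IH) (use mid Suc.prems in auto)
    moreover have "bit_operations (bisect right lo mid) \<le> (p + 1) * (4 * n + R)"
      by (rule Suc.IH) (use mid Suc.prems \<open>bits mid \<le> bits hi\<close> in auto)
    moreover have "bit_operations (right mid) \<le> R" using mid Suc.prems by auto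
    ultimately show ?thesis using step False by (auto split: if_splits)
  qed
qed

lemma cost_for_loop_unfold:
  "bit_operations (for_loop i hi body) = max (bits i) (bits hi) + (if i \<le> hi then bit_operations (body i) + (case result (body i) of
      Some y \<Rightarrow> 0 | None \<Rightarrow> max (bits i) 1 + bit_operations (for_loop (i + 1) hi body)) else 0)"
  by (subst for_loop.simps) (simp split: option.split)

lemma cost_for_loop:
  assumes "0 \<le> i" "bits i \<le> n" "bits hi + 1 \<le> n"
  shows "bit_operations (for_loop i hi body) \<le> n + (\<Sum>x\<in>{i..hi}. bit_operations (body x) + 2 * n)"
  using assms
proof (induction "nat (hi + 1 - i)" arbitrary: i)
  case 0
  then show ?case by (subst cost_for_loop_unfold) auto
next
  case (Suc d)
  then have i: "i \<le> hi" by simp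
  have "bits (i + 1) \<le> n" using bits_add[of i 1] bits_mono_nonneg[of i hi] i Suc.prems bits_pos[of i] by simp
  then have "bit_operations (for_loop (i + 1) hi body) \<le> n + (\<Sum>x\<in>{i + 1..hi}. bit_operations (body x) + 2 * n)"
    using Suc by (intro Suc.hyps(1)) auto
  moreover have "{i..hi} = insert i {i + 1..hi}" using i by auto
  then have "(\<Sum>x\<in>{i..hi}. bit_operations (body x) + 2 * n)
      = bit_operations (body i) + 2 * n + (\<Sum>x\<in>{i + 1..hi}. bit_operations (body x) + 2 * n)" by simp
  ultimately show ?case using Suc.prems n_pos i by (subst cost_for_loop_unfold) (auto split: option.split)
qed

lemma bits_trinomial:
  assumes "bits x \<le> s" "bits u \<le> s" "bits K + 1 \<le> n" "(r + 2) * (s + 1) \<le> n" "1 \<le> r"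
  shows "bits (x ^ r) \<le> n" "bits (x - u) \<le> n" "bits (x ^ r * (x - u)) + 1 \<le> n" "bits (x ^ r * (x - u) + K) \<le> n" "r * bits x \<le> n"
proof -
  have e: "(r + 2) * (s + 1) = r * s + s + s + r + 2" by (simp add: algebra_simps)
  have 1: "r * bits x \<le> r * s" using assms(1) by (rule mult_left_mono) simp
  then have 2: "bits (x ^ r) \<le> r * s" using bits_power[OF assms(5), of x] by linarith
  have 3: "bits (x - u) \<le> s + 1" using bits_diff[of x u] assms(1,2) by linarith
  have 4: "bits (x ^ r * (x - u)) \<le> r * s + s + 1" using bits_mult[of "x ^ r" "x - u"] 2 3 by linarith
  show "bits (x ^ r) \<le> n" "bits (x - u) \<le> n" "bits (x ^ r * (x - u)) + 1 \<le> n" "r * bits x \<le> n"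
    using 1 2 3 4 assms(4,5) unfolding e by linarith+
  then show "bits (x ^ r * (x - u) + K) \<le> n" using bits_add[of "x ^ r * (x - u)" K] assms(3) by linarith
qed

lemma cost_eval_poly:
  assumes "bits x \<le> s" "bits u \<le> s" "bits K + 1 \<le> n" "(r + 2) * (s + 1) \<le> n" "1 \<le> r"
  shows "bit_operations (eval_poly M r u K x) \<le> (r + 3) * m"
proof -
  note b = bits_trinomial[OF assms]
  have "bits x \<le> n" using assms(5) b(5) by (rule le_of_mult_le)
  moreover have "s \<le> n" using assms(4) by (simp add: algebra_simps)
  ultimately have "max (bits x) (bits u) \<le> m" "max (bits (x ^ r * (x - u))) (bits K) \<le> m"
    using b(3) assms(2,3) n_le_m by auto
  moreover have "bit_operations (eval_poly M r u K x) = bit_operations (ipow M x r) + max (bits x) (bits u)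
     + bit_operations (imul M (x ^ r) (x - u)) + max (bits (x ^ r * (x - u))) (bits K)"
    by (simp add: Defs.eval_poly_def)
  moreover have "(r + 3) * m = r * m + 3 * m" by (simp add: algebra_simps)
  ultimately show ?thesis using cost_ipow[OF b(5)] cost_imul[OF b(1,2)] by linarith
qed

lemma cost_try_candidate:
  assumes "bits x \<le> s" "bits u \<le> s" "bits K + 1 \<le> n" "(r + 2) * (s + 1) \<le> n" "1 \<le> r"
    and N: "1 < N" "bits N + 1 \<le> n" and x: "0 \<le> x"
  shows "bit_operations (try_candidate M N r u K x) \<le> (r + 46) * (n * m)"
proof -
  note b = bits_trinomial[OF assms(1-5)]
  define v where "v = x ^ r * (x - u) + K"
  have bv: "max (bits v) 1 \<le> n" using b(4) n_pos by (simp add: v_def)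
  have bx: "bits x + 1 \<le> n" using assms(1,4) by (simp add: algebra_simps)
  have g: "result (igcd N x) = gcd N x" using N x by (intro result_igcd) auto
  have "gcd N x \<le> N" using N by (intro zdvd_imp_le) auto
  then have bg: "max (bits (gcd N x)) 1 \<le> n" "max (bits N) (bits (gcd N x)) \<le> n"
    using bits_mono_nonneg[of "gcd N x" N] N(2) n_pos by auto
  have "bit_operations (try_candidate M N r u K x) \<le> bit_operations (eval_poly M r u K x) + max (bits v) 1
     + (bit_operations (igcd N x) + max (bits (gcd N x)) 1 + max (bits N) (bits (gcd N x)))"
    by (simp add: try_candidate_def g v_def)
  moreover have "bit_operations (igcd N x) \<le> 40 * (n * n)" using N x bx by (intro cost_igcd) auto
  moreover have "bit_operations (eval_poly M r u K x) \<le> (r + 3) * m" by (rule cost_eval_poly[OF assms(1-5)])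
  moreover have "(r + 3) * m \<le> (r + 3) * (n * m)" using m_le by (rule mult_left_mono) simp
  moreover have "(r + 46) * (n * m) = (r + 3) * (n * m) + 43 * (n * m)" by (simp add: algebra_simps)
  ultimately show ?thesis using bv bg n_le sq_le by linarith
qed

lemma cost_try_interval:
  assumes u: "bits u \<le> s" and K: "bits K + 1 \<le> n" and s: "(r + 2) * (s + 1) \<le> n" and r: "1 \<le> r"
    and N: "1 < N" "bits N + 1 \<le> n" and lo: "0 \<le> lo" "bits lo \<le> s" and hi: "bits hi \<le> s"
    and right: "\<And>x. lo \<le> x \<Longrightarrow> x \<le> hi \<Longrightarrow> bit_operations (right x) \<le> (r + 4) * m"
  shows "bit_operations (try_interval M N r u K right lo hi) \<le> (3 * r + 101) * (n * m)"
proof -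
  have sn: "s + 1 \<le> n" using s by (simp add: algebra_simps)
  have first: "max (bits lo) (bits hi) \<le> n" using lo hi sn by simp
  show ?thesis
  proof (cases "lo \<le> hi")
    case False
    then have "bit_operations (try_interval M N r u K right lo hi) = max (bits lo) (bits hi)"
      by (simp add: try_interval_def)
    also have "\<dots> \<le> 1 * (n * m)" using first n_le by linarith
    also have "\<dots> \<le> (3 * r + 101) * (n * m)" by (rule mult_right_mono) auto
    finally show ?thesis .
  next
    case True
    define xy where "xy = result (bisect right lo hi)"
    have xy: "lo \<le> fst xy" "fst xy \<le> snd xy" "snd xy \<le> hi"
      using result_bisect[OF True, of "\<lambda>_. False" right] by (simp_all add: xy_def)
    then have bxy: "bits (fst xy) \<le> s" "bits (snd xy) \<le> s"
      using bits_mono_nonneg[of "fst xy" hi] bits_mono_nonneg[of "snd xy" hi] lo hi by auto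
    have "bit_operations (bisect right lo hi) \<le> (s + 1) * (4 * n + (r + 4) * m)"
    proof (rule cost_bisect[OF lo(1) True])
      have "hi - lo < 2 ^ bits hi" using less_two_power_bits[of hi] lo by linarith
      also have "(2::int) ^ bits hi \<le> 2 ^ s" using hi by (intro power_increasing) auto
      finally show "hi - lo \<le> 2 ^ s" by simp
    qed (use hi sn right in auto)
    also have "\<dots> \<le> n * (4 * m + (r + 4) * m)" using sn n_le_m by (intro mult_mono add_mono) auto
    also have "\<dots> = (r + 8) * (n * m)" by (simp add: algebra_simps)
    finally have bis: "bit_operations (bisect right lo hi) \<le> (r + 8) * (n * m)" .
    have "bit_operations (try_candidate M N r u K (fst xy)) \<le> (r + 46) * (n * m)"
      "bit_operations (try_candidate M N r u K (snd xy)) \<le> (r + 46) * (n * m)"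
      using xy lo by (intro cost_try_candidate[OF bxy(1) u K s r N] cost_try_candidate[OF bxy(2) u K s r N]; simp)+
    moreover have "bit_operations (try_interval M N r u K right lo hi) \<le> max (bits lo) (bits hi) + bit_operations (bisect right lo hi)
      + bit_operations (try_candidate M N r u K (fst xy)) + bit_operations (try_candidate M N r u K (snd xy))"
      using True by (simp add: try_interval_def xy_def split: option.split)
    moreover have "(3 * r + 101) * (n * m) = n * m + (r + 8) * (n * m) + 2 * ((r + 46) * (n * m))"
      by (simp add: algebra_simps)
    ultimately show ?thesis using bis first n_le by linarith
  qed
qed

lemma cost_test_u:
  assumes r: "1 \<le> r" and N: "1 < N" "bits N + 1 \<le> n" and K: "bits K + 1 \<le> n"
    and u: "0 \<le> u" "bits u \<le> w" and F: "0 \<le> F" "bits F \<le> w" and rw: "r + 1 \<le> w"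
    and w: "(r + 2) * (2 * w + 3) \<le> n"
  shows "bit_operations (test_u M N r F K u) \<le> (6 * r + 240) * (n * m)"
proof -
  define s where "s = 2 * w + 2"
  have s: "(r + 2) * (s + 1) \<le> n" using w unfolding s_def by (simp only: add.assoc) simp
  have sn: "s + 1 \<le> n" using s by (simp add: algebra_simps)
  define t where "t = int r * u"
  have br: "bits (int r) \<le> w" "bits (int r + 1) \<le> w"
    using bits_of_nat[of r] bits_of_nat[of "r + 1"] rw r by (simp_all add: add.commute)
  have t0: "0 \<le> t" using u by (simp add: t_def)
  have bt: "bits t \<le> 2 * w" using bits_mult[of "int r" u] br u by (simp add: t_def)
  define lo where "lo = (if t - F \<le> 0 then 0 else (t - F + int r) div (int r + 1))"
  define cm where "cm = t div (int r + 1)"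
  define c' where "c' = (if t mod (int r + 1) = 0 then cm else cm + 1)"
  define hm where "hm = (t + F) div (int r + 1)"
  have d: "bits (t - F) \<le> 2 * w" using bits_diff_nonneg[OF t0 F(1)] bt F(2) by simp
  have d': "bits (t - F + int r) \<le> 2 * w + 1" using bits_add[of "t - F" "int r"] d br(1) by simp
  have e: "bits (t + F) \<le> 2 * w + 1" using bits_add[of t F] bt F(2) by simp
  have lo0: "0 \<le> lo" by (auto simp: lo_def div_int_pos_iff)
  have blo: "bits lo \<le> s"
    using bits_div[of "t - F + int r" "int r + 1"] d' by (auto simp: lo_def s_def)
  have cm0: "0 \<le> cm" unfolding cm_def using t0 by (simp add: pos_imp_zdiv_nonneg_iff)
  have bcm: "bits cm \<le> 2 * w" using bits_div[of t "int r + 1"] t0 bt by (simp add: cm_def)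
  have bc': "bits c' \<le> s" using bits_add[of cm 1] bcm by (auto simp: c'_def s_def)
  have c'0: "0 \<le> c'" using cm0 by (simp add: c'_def)
  have bhm: "bits hm \<le> s" using bits_div[of "t + F" "int r + 1"] t0 F(1) e by (simp add: hm_def s_def)
  have bu: "bits u \<le> s" using u by (simp add: s_def)
  let ?right1 = "\<lambda>x. bind_costed (eval_poly M r u K x) (\<lambda>v. ileq 1 v)"
  let ?right2 = "\<lambda>x. bind_costed (eval_poly M r u K x) (\<lambda>v. ileq v (-1))"
  have right: "bit_operations (?right1 x) \<le> (r + 4) * m" "bit_operations (?right2 x) \<le> (r + 4) * m" if "bits x \<le> s" for x
  proof -
    have "bits (x ^ r * (x - u) + K) \<le> n" by (rule bits_trinomial[OF that bu K s r])
    then have "max 1 (bits (x ^ r * (x - u) + K)) \<le> m" "max (bits (x ^ r * (x - u) + K)) 1 \<le> m"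
      using n_pos n_le_m by auto
    moreover have "bit_operations (?right1 x) = bit_operations (eval_poly M r u K x) + max 1 (bits (x ^ r * (x - u) + K))"
      "bit_operations (?right2 x) = bit_operations (eval_poly M r u K x) + max (bits (x ^ r * (x - u) + K)) 1" by simp_all
    moreover have "(r + 4) * m = (r + 3) * m + m" by (simp add: algebra_simps)
    ultimately show "bit_operations (?right1 x) \<le> (r + 4) * m" "bit_operations (?right2 x) \<le> (r + 4) * m"
      using cost_eval_poly[OF that bu K s r] by linarith+
  qed
  have I1: "bit_operations (try_interval M N r u K ?right1 lo cm) \<le> (3 * r + 101) * (n * m)"
  proof (rule cost_try_interval[OF bu K s r N lo0 blo])
    show "bits cm \<le> s" using bcm by (simp add: s_def)
    then show "bit_operations (?right1 x) \<le> (r + 4) * m" if "lo \<le> x" "x \<le> cm" for x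
      using right(1)[of x] bits_mono_nonneg[of x cm] that lo0 by linarith
  qed
  have I2: "bit_operations (try_interval M N r u K ?right2 c' hm) \<le> (3 * r + 101) * (n * m)"
  proof (rule cost_try_interval[OF bu K s r N c'0 bc' bhm])
    show "bit_operations (?right2 x) \<le> (r + 4) * m" if "c' \<le> x" "x \<le> hm" for x
      using right(2)[of x] bits_mono_nonneg[of x hm] that c'0 bhm by linarith
  qed
  have pos: "0 < int r + 1" by simp
  have div1: "bit_operations (idivmod (t - F + int r) (int r + 1)) \<le> 7 * (n * n)" if "0 \<le> t - F"
    using that d' br(2) sn by (intro cost_idivmod_square) (auto simp: s_def)
  have div2: "bit_operations (idivmod t (int r + 1)) \<le> 7 * (n * n)"
    using t0 bt br(2) sn by (intro cost_idivmod_square) (auto simp: s_def)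
  have div3: "bit_operations (idivmod (t + F) (int r + 1)) \<le> 7 * (n * n)"
    using t0 F(1) e br(2) sn by (intro cost_idivmod_square) (auto simp: s_def)
  have res1: "fst (result (idivmod (t - F + int r) (int r + 1))) = (t - F + int r) div (int r + 1)" if "0 \<le> t - F"
    using that by (simp add: result_idivmod)
  have res2: "result (idivmod t (int r + 1)) = (cm, t mod (int r + 1))"
    using t0 by (simp add: result_idivmod cm_def)
  have res3: "fst (result (idivmod (t + F) (int r + 1))) = hm"
    using t0 F(1) by (simp add: result_idivmod hm_def)
  have bmod: "bits (t mod (int r + 1)) \<le> w"
  proof -
    have "t mod (int r + 1) < int r + 1" "0 \<le> t mod (int r + 1)"
      using pos_mod_bound[OF pos] pos_mod_sign[OF pos] by auto
    then show ?thesis using bits_mono_nonneg[of "t mod (int r + 1)" "int r + 1"] br(2) by linarith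
  qed
  define lo_cost where "lo_cost = (if t - F \<le> 0 then 0 else max (bits (t - F)) (bits (int r)) + bit_operations (idivmod (t - F + int r) (int r + 1)))"
  have lo_cost: "lo_cost \<le> n + 7 * (n * n)" using div1 d br(1) sn by (auto simp: lo_cost_def s_def)
  have "bit_operations (test_u M N r F K u) \<le> bit_operations (imul M (int r) u) + max (bits t) (bits F) + max (bits (t - F)) 1
     + lo_cost + bit_operations (idivmod t (int r + 1)) + max (bits (t mod (int r + 1))) 1 + max (bits cm) 1 + max (bits t) (bits F)
     + bit_operations (idivmod (t + F) (int r + 1)) + bit_operations (try_interval M N r u K ?right1 lo cm)
     + bit_operations (try_interval M N r u K ?right2 c' hm)"
    unfolding test_u_def
    by (cases "t - F \<le> 0"; cases "t mod (int r + 1) = 0")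
      (simp_all add: t_def[symmetric] lo_def c'_def lo_cost_def res1 res2 res3 split: option.split)
  moreover have "max (bits t) (bits F) \<le> n" "max (bits (t - F)) 1 \<le> n" "max (bits (t mod (int r + 1))) 1 \<le> n" "max (bits cm) 1 \<le> n"
    using bt F(2) d bmod bcm sn by (auto simp: s_def)
  moreover have "bit_operations (imul M (int r) u) \<le> m"
    using br(1) u(2) sn by (intro cost_imul) (auto simp: s_def)
  moreover have "(6 * r + 240) * (n * m) = 2 * ((3 * r + 101) * (n * m)) + 38 * (n * m)" by (simp add: algebra_simps)
  ultimately show ?thesis using I1 I2 div2 div3 lo_cost n_le m_le sq_le by linarith
qed

end

section \<open>Bit operations of the search\<close>

text \<open>
  The largest number whose size matters is the radicand of the root that yields \<open>U\<close>. Scaled by the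
  \<open>6 (r + 2)\<close>-th power of \<open>2\<^bsup>precision r len\<^esup>\<close>, it has about \<open>6000 (r + 2)\<^sup>5 len\<close> bits, and the powers formed
  while its root is extracted are \<open>6 (r + 2)\<close> times as long.
\<close>

locale lehman_cost = lehman_input N r + mult_cost M n m
  for N :: int and r :: nat and M :: "nat \<Rightarrow> nat" and n m :: nat +
  assumes n_eq: "n = 40000 * ((r + 2) ^ 6 * bits N)"
begin

text \<open>
  A constant of its own, so that its powers stay atomic in linear arithmetic.
\<close>

definition \<rho> :: nat where "\<rho> = r + 2"

lemma rho_pos: "1 \<le> \<rho>" by (simp add: \<rho>_def)

lemma len_pos: "1 \<le> len" using r_less_len by simp

lemma n_rho: "n = 40000 * (\<rho> ^ 6 * len)"
  by (simp add: n_eq \<rho>_def)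

lemma rho_power_mono: "i \<le> j \<Longrightarrow> \<rho> ^ i * len \<le> \<rho> ^ j * len"
  using rho_pos by (intro mult_right_mono power_increasing) auto

lemma rho_chain:
  "1 \<le> len" "len \<le> \<rho> * len" "\<rho> \<le> \<rho> * len" "\<rho> * len \<le> \<rho> ^ 2 * len" "\<rho> ^ 2 * len \<le> \<rho> ^ 5 * len" "\<rho> ^ 5 * len \<le> \<rho> ^ 6 * len"
  "r * len + 2 * len = \<rho> * len" "40000 * (\<rho> ^ 6 * len) = n" "r + 2 = \<rho>" "r + 1 \<le> len"
proof -
  show "1 \<le> len" by (rule len_pos)
  show "\<rho> \<le> \<rho> * len" using len_pos by simp
  show "len \<le> \<rho> * len" using rho_pos by simp
  show "\<rho> * len \<le> \<rho> ^ 2 * len" using rho_power_mono[of 1 2] by simp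
  show "\<rho> ^ 2 * len \<le> \<rho> ^ 5 * len" "\<rho> ^ 5 * len \<le> \<rho> ^ 6 * len" by (rule rho_power_mono, simp)+
  show "r * len + 2 * len = \<rho> * len" by (simp add: \<rho>_def algebra_simps)
  show "40000 * (\<rho> ^ 6 * len) = n" by (simp only: n_rho)
  show "r + 2 = \<rho>" by (simp only: \<rho>_def)
  show "r + 1 \<le> len" using r_less_len by simp
qed

lemma rho_le_square: "\<rho> \<le> \<rho> ^ 2"
  using rho_pos by (simp add: power2_eq_square)

lemma rho_powers: "\<rho> ^ 6 = \<rho> * \<rho> ^ 5" "\<rho> ^ 5 = \<rho> * \<rho> ^ 4"
  using power_Suc[of \<rho> 5] power_Suc[of \<rho> 4] by simp_all

lemma precision_times_rho: "precision r len * \<rho> = 1000 * (\<rho> ^ 5 * len)"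
  by (simp only: precision_def rho_powers \<rho>_def[symmetric] ac_simps)

lemma bits_r: "bits (int r) \<le> len" "bits (int r + 1) \<le> len"
  using bits_of_nat[of r] bits_of_nat[of "r + 1"] r_less_len by (simp_all add: add.commute)

lemma bits_N_le_n: "len + 1 \<le> n"
  using rho_chain by linarith

lemma bits_le_of_real:
  assumes "0 \<le> x" "real_of_int x \<le> 2 ^ e"
  shows "bits x \<le> e + 1"
proof (rule bits_leI)
  have "(2::real) ^ e < 2 ^ (e + 1)" by simp
  then have "real_of_int x < 2 ^ (e + 1)" using assms(2) by linarith
  then have "real_of_int x < real_of_int (2 ^ (e + 1))" by (simp only: of_int_power of_int_numeral)
  then show "\<bar>x\<bar> < 2 ^ (e + 1)" using assms(1) by (simp only: of_int_less_iff abs_of_nonneg)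
qed simp

lemma bits_j:
  assumes "int j \<le> jmax"
  shows "j \<le> len" "bits (int j) \<le> len" "(r - 1) * (r + 2) * j \<le> len" "(r + 2) * j \<le> len"
proof -
  have "1 * j \<le> r * (r + 2) * j" using r_gt_1 by (intro mult_right_mono) (auto simp: Suc_le_eq)
  then show "j \<le> len" using j_small[OF assms] by linarith
  then show "bits (int j) \<le> len" using bits_of_nat[of j] len_pos by linarith
  have "(r - 1) * (r + 2) * j \<le> r * (r + 2) * j" by (intro mult_right_mono) auto
  then show "(r - 1) * (r + 2) * j \<le> len" using j_small[OF assms] by linarith
  have "1 * (r + 2) * j \<le> r * (r + 2) * j" using r_gt_1 by (intro mult_right_mono) auto
  then show "(r + 2) * j \<le> len" using j_small[OF assms] by linarith
qed

lemma bits_a: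
  assumes "int j \<le> jmax" "1 \<le> a" "a \<le> amax (int j)"
  shows "bits a \<le> 3 * len"
proof -
  have "bits a \<le> bits (2 ^ (2 * len))" using a_small[OF assms(1,3)] assms(2) by (intro bits_mono_nonneg) auto
  then show ?thesis using bits_two_power[of "2 * len"] len_pos by linarith
qed

lemma bits_b:
  assumes "1 \<le> b" "b \<le> bmax (int j)"
  shows "bits b \<le> len"
  using b_small[OF assms(2)] assms(1) by (intro bits_mono_nonneg) auto

lemma bits_abN:
  assumes j: "int j \<le> jmax" and a: "1 \<le> a" "a \<le> amax (int j)" and b: "1 \<le> b" "b \<le> bmax (int j)"
  shows "bits (b ^ r) \<le> r * len" "bits (a * b ^ r) \<le> r * len + 3 * len" "bits (a * b ^ r * N) \<le> r * len + 4 * len"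
    "bits (int r ^ r) \<le> r * len" "bits (int r ^ r * (a * b ^ r * N)) \<le> 2 * (r * len) + 4 * len"
    "bits ((int r + 1) ^ (r + 1)) \<le> r * len + len" "bits ((int r + 1) ^ (r + 1) * (a * b ^ r * N)) \<le> 2 * (r * len) + 5 * len"
proof -
  have r1: "1 \<le> r" using r_gt_1 by simp
  have "r * bits b \<le> r * len" using bits_b[OF b] by (rule mult_left_mono) simp
  then show 1: "bits (b ^ r) \<le> r * len" using bits_power[OF r1, of b] by linarith
  then show 2: "bits (a * b ^ r) \<le> r * len + 3 * len" using bits_mult[of a "b ^ r"] bits_a[OF j a] by linarith
  then show 3: "bits (a * b ^ r * N) \<le> r * len + 4 * len" using bits_mult[of "a * b ^ r" N] by linarith
  have "r * bits (int r) \<le> r * len" using bits_r(1) by (rule mult_left_mono) simp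
  then show 4: "bits (int r ^ r) \<le> r * len" using bits_power[OF r1, of "int r"] by linarith
  show "bits (int r ^ r * (a * b ^ r * N)) \<le> 2 * (r * len) + 4 * len"
    using bits_mult[of "int r ^ r" "a * b ^ r * N"] 3 4 by linarith
  have "(r + 1) * bits (int r + 1) \<le> (r + 1) * len" using bits_r(2) by (rule mult_left_mono) simp
  then show 5: "bits ((int r + 1) ^ (r + 1)) \<le> r * len + len"
    using bits_power[of "r + 1" "int r + 1"] by (simp only: add_mult_distrib mult_1) simp
  show "bits ((int r + 1) ^ (r + 1) * (a * b ^ r * N)) \<le> 2 * (r * len) + 5 * len"
    using bits_mult[of "(int r + 1) ^ (r + 1)" "a * b ^ r * N"] 3 5 by linarith
qed

lemma cost_upper_end:
  assumes j: "int j \<le> jmax" and a: "1 \<le> a" "a \<le> amax (int j)" and b: "1 \<le> b" "b \<le> bmax (int j)"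
  shows "bit_operations (upper_end M N r (int j) a b ((int r + 1) ^ (r + 1) * (a * b ^ r * N))) \<le> 60 * \<rho> ^ 2 * (n * m)"
proof -
  define A where "A = (int r + 1) ^ (r + 1) * (a * b ^ r * N)"
  define k where "k = precision r len"
  define kr where "kr = k * (r + 1)"
  define A' where "A' = A * 2 ^ kr"
  define e1 where "e1 = 3 * (r + 2) * (2 * r + 3)"
  define r' where "r' = int r ^ e1"
  define P where "P = r' * N ^ 3"
  define mk where "mk = 6 * (r + 2) * k"
  define P' where "P' = P * 2 ^ mk"
  define e where "e = (r - 1) * (r + 2) * j"
  define ab where "ab = a * b"
  define ab' where "ab' = ab ^ (3 * (r + 2))"
  define Q where "Q = ab' * 2 ^ (e + 6 * (r + 2))"
  define w where "w = P' div Q"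
  define g where "g = result (floor_root M (r + 1) A')"
  define v where "v = result (floor_root M (6 * (r + 2)) w)"
  note chain = rho_chain
  have A0: "0 \<le> A" using a b N_gt_1 by (simp add: A_def)
  have bA: "bits A \<le> 3 * (\<rho> * len)" unfolding A_def using bits_abN(7)[OF j a b] chain by linarith
  have kr: "kr \<le> 1000 * (\<rho> ^ 5 * len)"
  proof -
    have "kr \<le> k * \<rho>" by (simp add: kr_def \<rho>_def)
    also have "\<dots> = 1000 * (\<rho> ^ 5 * len)" unfolding k_def by (rule precision_times_rho)
    finally show ?thesis .
  qed
  have bA': "bits A' \<le> 1003 * (\<rho> ^ 5 * len)" using bits_shift[of A kr] bA kr chain unfolding A'_def by linarith
  have rA': "(r + 1) * bits A' \<le> n"
  proof -
    have "(r + 1) * bits A' \<le> \<rho> * (1003 * (\<rho> ^ 5 * len))" using bA' by (intro mult_mono) (auto simp: \<rho>_def)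
    also have "\<dots> = 1003 * (\<rho> ^ 6 * len)" by (simp only: rho_powers ac_simps)
    finally show ?thesis using chain by linarith
  qed
  have bN3: "bits (N ^ 3) \<le> 3 * len" using bits_power[of 3 N] by simp
  have e1: "e1 \<le> 6 * \<rho> ^ 2"
  proof -
    have "e1 \<le> 3 * \<rho> * (2 * \<rho>)" unfolding e1_def \<rho>_def by (intro mult_mono) auto
    then show ?thesis by (simp add: power2_eq_square)
  qed
  have e1r: "e1 * bits (int r) \<le> 6 * (\<rho> ^ 2 * len)"
  proof -
    have "e1 * bits (int r) \<le> 6 * \<rho> ^ 2 * len" using e1 bits_r(1) by (intro mult_mono) auto
    then show ?thesis by simp
  qed
  have br': "bits r' \<le> 6 * (\<rho> ^ 2 * len)"
    unfolding r'_def using bits_power[of e1 "int r"] e1r by (simp add: e1_def)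
  have bP: "bits P \<le> 9 * (\<rho> ^ 2 * len)" unfolding P_def using bits_mult[of r' "N ^ 3"] br' bN3 chain by linarith
  have mk: "mk = 6000 * (\<rho> ^ 5 * len)"
  proof -
    have "mk = 6 * (k * \<rho>)" by (simp only: mk_def \<rho>_def ac_simps)
    then show ?thesis using precision_times_rho by (simp add: k_def)
  qed
  have bP': "bits P' \<le> 6009 * (\<rho> ^ 5 * len)" unfolding P'_def using bits_shift[of P mk] bP mk chain by linarith
  have be: "bits (int ((r - 1) * (r + 2))) \<le> n"
  proof -
    have "(r - 1) * (r + 2) \<le> \<rho> * \<rho>" unfolding \<rho>_def by (intro mult_mono) auto
    also have "\<dots> \<le> \<rho> ^ 2 * len" using len_pos by (simp add: power2_eq_square)
    finally show ?thesis using bits_of_nat[of "(r - 1) * (r + 2)"] chain by linarith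
  qed
  have e: "e \<le> len" unfolding e_def by (rule bits_j(3)[OF j])
  have bab: "bits ab \<le> 4 * len" unfolding ab_def using bits_mult[of a b] bits_a[OF j a] bits_b[OF b] by linarith
  have three_pos: "1 \<le> 3 * (r + 2)" by simp
  have rab: "3 * (r + 2) * bits ab \<le> 12 * (\<rho> * len)"
  proof -
    have "3 * (r + 2) * bits ab \<le> 3 * \<rho> * (4 * len)" using bab by (intro mult_mono) (auto simp: \<rho>_def)
    then show ?thesis by simp
  qed
  have bab': "bits ab' \<le> 12 * (\<rho> * len)" unfolding ab'_def using bits_power[of "3 * (r + 2)" ab, OF three_pos] rab by linarith
  have six: "6 * (r + 2) \<le> 6 * (\<rho> * len)" unfolding chain(9) using chain(3) by simp
  have bQ: "bits Q \<le> 19 * (\<rho> * len)"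
    unfolding Q_def using bits_shift[of ab' "e + 6 * (r + 2)"] bab' e six chain(1-8) by linarith
  have Q0: "0 < Q" using a b by (simp add: Q_def ab'_def ab_def)
  have P0: "0 \<le> P'" using N_gt_1 by (simp add: P'_def P_def r'_def)
  have bw: "bits w \<le> 6009 * (\<rho> ^ 5 * len)" unfolding w_def using bits_div[OF P0 Q0] bP' by linarith
  have rw: "6 * (r + 2) * bits w \<le> n"
  proof -
    have "6 * (r + 2) * bits w \<le> 6 * \<rho> * (6009 * (\<rho> ^ 5 * len))" using bw by (intro mult_mono) (auto simp: \<rho>_def)
    also have "\<dots> = 36054 * (\<rho> ^ 6 * len)" by (simp add: rho_powers)
    finally show ?thesis using chain by linarith
  qed
  have w0: "0 \<le> w" unfolding w_def using P0 Q0 by (simp add: pos_imp_zdiv_nonneg_iff)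
  have bg: "bits g \<le> bits A'" unfolding g_def using A0 by (intro bits_floor_root) (auto simp: A'_def)
  have bv: "bits v \<le> bits w" unfolding v_def using w0 by (intro bits_floor_root) auto
  have bs1: "bits (g + v) \<le> 6010 * (\<rho> ^ 5 * len)"
    using bits_add[of g v] bg bv bA' bw chain(1-8) by linarith
  have "bits (g + v + 1) \<le> max (bits (g + v)) 1 + 1" using bits_add[of "g + v" 1] by simp
  then have bs2: "bits (g + v + 1) \<le> 6011 * (\<rho> ^ 5 * len)" using bs1 chain(1-8) by linarith
  have nat_e: "nat (int ((r - 1) * (r + 2)) * int j) = e"
    unfolding e_def by (simp only: of_nat_mult[symmetric] nat_int)
  have divmod: "fst (result (idivmod P' Q)) = w" unfolding w_def using P0 Q0 by (simp add: result_idivmod)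
  have "bit_operations (upper_end M N r (int j) a b A) = len + (bits A + kr) + bit_operations (floor_root M (r + 1) A')
     + bit_operations (ipow M N 3) + bit_operations (ipow M (int r) e1) + bit_operations (imul M r' (N ^ 3)) + (bits P + mk)
     + bit_operations (imul M (int ((r - 1) * (r + 2))) (int j)) + bit_operations (imul M a b) + bit_operations (ipow M ab (3 * (r + 2)))
     + (bits ab' + (e + 6 * (r + 2))) + bit_operations (idivmod P' Q) + bit_operations (floor_root M (6 * (r + 2)) w)
     + max (bits g) (bits v) + max (bits (g + v)) 1 + bits (g + v + 1)"
    unfolding upper_end_def Let_def
    by (simp only: bit_operations_bind_costed result_bind_costed result_elementary result_ipow bit_operations_elementary bits_one nat_e
      k_def[symmetric] kr_def[symmetric] A'_def[symmetric] e1_def[symmetric] r'_def[symmetric] P_def[symmetric] mk_def[symmetric] P'_def[symmetric]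
      ab_def[symmetric] ab'_def[symmetric] Q_def[symmetric] divmod g_def[symmetric] v_def[symmetric] add.assoc)
  moreover have "len + (bits A + kr) \<le> n" using bA kr chain by linarith
  moreover have "bit_operations (floor_root M (r + 1) A') \<le> (r + 5) * (n * m)" using cost_floor_root[OF rA'] by (simp add: add.commute)
  moreover have "bit_operations (ipow M N 3) \<le> 3 * m" using chain by (intro cost_ipow) linarith
  moreover have "bit_operations (ipow M (int r) e1) \<le> 6 * \<rho> ^ 2 * m"
  proof -
    have "e1 * bits (int r) \<le> n" using e1r chain by linarith
    then have "bit_operations (ipow M (int r) e1) \<le> e1 * m" by (rule cost_ipow)
    also have "\<dots> \<le> 6 * \<rho> ^ 2 * m" using e1 by (rule mult_right_mono) simp
    finally show ?thesis .
  qed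
  moreover have "bit_operations (imul M r' (N ^ 3)) \<le> m" using br' bN3 chain by (intro cost_imul) linarith+
  moreover have "bits P + mk \<le> n" using bP mk chain by linarith
  moreover have "bit_operations (imul M (int ((r - 1) * (r + 2))) (int j)) \<le> m" using be bits_j(2)[OF j] chain by (intro cost_imul) linarith+
  moreover have "bit_operations (imul M a b) \<le> m" using bits_a[OF j a] bits_b[OF b] chain by (intro cost_imul) linarith+
  moreover have "bit_operations (ipow M ab (3 * (r + 2))) \<le> 3 * \<rho> * m"
  proof -
    have "3 * (r + 2) * bits ab \<le> n" using rab chain by linarith
    then show ?thesis unfolding \<rho>_def by (rule cost_ipow)
  qed
  moreover have "bits ab' + (e + 6 * (r + 2)) \<le> n" using bab' e six chain(1-8) by linarith
  moreover have "bit_operations (idivmod P' Q) \<le> 7 * (n * n)" using P0 Q0 bP' bQ chain by (intro cost_idivmod_square) linarith+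
  moreover have "bit_operations (floor_root M (6 * (r + 2)) w) \<le> (6 * \<rho> + 4) * (n * m)"
    unfolding \<rho>_def by (rule cost_floor_root[OF rw]) simp
  moreover have "max (bits g) (bits v) \<le> n" "max (bits (g + v)) 1 \<le> n" "bits (g + v + 1) \<le> n"
    using bg bv bA' bw bs1 bs2 chain(1-8) by linarith+
  moreover have "6 * \<rho> ^ 2 * m \<le> 6 * \<rho> ^ 2 * (n * m)" "3 * \<rho> * m \<le> 3 * \<rho> * (n * m)" using m_le by (intro mult_left_mono; simp)+
  moreover have "(r + 5) * (n * m) + (6 * \<rho> + 4) * (n * m) + 6 * \<rho> ^ 2 * (n * m) + 3 * \<rho> * (n * m) + 20 * (n * m) \<le> 60 * \<rho> ^ 2 * (n * m)"
  proof -
    have "\<rho> * 1 \<le> \<rho> * \<rho>" using rho_pos by (rule mult_left_mono) simp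
    then have "\<rho> \<le> \<rho> ^ 2" by (simp add: power2_eq_square)
    moreover have "4 \<le> \<rho>" using r_gt_1 by (simp add: \<rho>_def)
    moreover have "r + 2 = \<rho>" by (simp add: \<rho>_def)
    ultimately have "(r + 5) + (6 * \<rho> + 4) + 6 * \<rho> ^ 2 + 3 * \<rho> + 20 \<le> 60 * \<rho> ^ 2" by linarith
    then have "((r + 5) + (6 * \<rho> + 4) + 6 * \<rho> ^ 2 + 3 * \<rho> + 20) * (n * m) \<le> 60 * \<rho> ^ 2 * (n * m)" by (rule mult_right_mono) simp
    then show ?thesis by (simp only: add_mult_distrib)
  qed
  ultimately show ?thesis unfolding A_def[symmetric] using n_le m_le sq_le by linarith
qed

lemma F_range:
  "0 \<le> \<lfloor>(real r + 1) * lehman_L N r (int j)\<rfloor>" "bits \<lfloor>(real r + 1) * lehman_L N r (int j)\<rfloor> \<le> 2 * len"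
proof -
  define F where "F = \<lfloor>(real r + 1) * lehman_L N r (int j)\<rfloor>"
  show 0: "0 \<le> \<lfloor>(real r + 1) * lehman_L N r (int j)\<rfloor>" by (simp add: lehman_L_def)
  have "(real r + 1) * lehman_L N r (int j) = real r * (real_of_int N powr (1/4) * 2 powr (- real_of_int (int j) / 3))"
    by (simp add: lehman_L_def)
  also have "\<dots> \<le> real r * (real_of_int N powr 1 * 2 powr 0)"
    using N_gt_1 by (intro mult_left_mono mult_mono powr_mono) auto
  also have "\<dots> = real_of_int (int r * N)" using N_gt_1 by simp
  finally have "F \<le> int r * N" unfolding F_def by linarith
  then have "bits F \<le> bits (int r * N)" using 0 unfolding F_def[symmetric] by (intro bits_mono_nonneg)
  then show "bits \<lfloor>(real r + 1) * lehman_L N r (int j)\<rfloor> \<le> 2 * len"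
    unfolding F_def[symmetric] using bits_mult[of "int r" N] bits_r(1) by linarith
qed

text \<open>
  The constant part of \<open>2 + U\<close> pays for computing the end points of the loop and for one \<open>u\<close>; the loop runs
  through at most \<open>U + 1\<close> values of \<open>u\<close>.
\<close>

lemma cost_search_ab:
  assumes j: "int j \<le> jmax" and a: "1 \<le> a" "a \<le> amax (int j)" and b: "1 \<le> b" "b \<le> bmax (int j)"
    and F: "F = \<lfloor>(real r + 1) * lehman_L N r (int j)\<rfloor>"
  shows "real (bit_operations (search_ab M N r (int j) F a b)) \<le> 350 * real \<rho> ^ 2 * real (n * m) * (2 + lehman_U N r (int j) a b)"
proof -
  define A where "A = (int r + 1) ^ (r + 1) * (a * b ^ r * N)"
  define K where "K = int r ^ r * (a * b ^ r * N)"
  define lo where "lo = \<lceil>lehman_G N r a b\<rceil>"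
  define hi where "hi = \<lfloor>lehman_G N r a b + lehman_U N r (int j) a b\<rfloor>"
  note chain = rho_chain
  note B = bits_abN[OF j a b]
  have lo: "result (ceiling_root M (r + 1) A) = lo"
    using G_power[OF a(1) b(1)] G_nonneg unfolding lo_def by (intro result_ceiling_root) (auto simp: A_def)
  have hi: "result (upper_end M N r (int j) a b A) = hi"
    unfolding hi_def using j a b A_def by (rule result_upper_end)
  have GU: "lehman_G N r a b + lehman_U N r (int j) a b + 1 \<le> 2 ^ ((r + 4) * len)" by (rule G_U_small[OF j a b])
  have G0: "0 \<le> lehman_G N r a b" and U0: "0 \<le> lehman_U N r (int j) a b" by (rule G_nonneg, rule U_nonneg)
  have lo0: "0 \<le> lo" using G0 unfolding lo_def by linarith
  have hi0: "0 \<le> hi" using G0 U0 unfolding hi_def by simp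
  define w where "w = (r + 4) * len + 1"
  have w: "w \<le> 3 * (\<rho> * len)" using chain by (simp add: w_def \<rho>_def algebra_simps)
  have blo: "bits lo \<le> w" unfolding w_def using lo0 GU U0 by (intro bits_le_of_real) (unfold lo_def, linarith+)
  have bhi: "bits hi \<le> w" unfolding w_def using hi0 GU by (intro bits_le_of_real) (unfold hi_def, linarith+)
  have test: "bit_operations (test_u M N r F K u) \<le> (6 * r + 240) * (n * m)" if "u \<in> {lo..hi}" for u
  proof (rule cost_test_u)
    show "bits K + 1 \<le> n" using B(5) chain unfolding K_def by linarith
    show "bits u \<le> w" using that lo0 bhi bits_mono_nonneg[of u hi] by simp
    have "2 * len \<le> (r + 4) * len" by (rule mult_right_mono) auto
    then show "bits F \<le> w" using F_range(2)[of j] unfolding F w_def by linarith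
    have "r * 1 \<le> r * len" using len_pos by (rule mult_left_mono) simp
    moreover have "w = r * len + 4 * len + 1" by (simp add: w_def algebra_simps)
    ultimately show "r + 1 \<le> w" by linarith
    have "(r + 2) * (2 * w + 3) \<le> \<rho> * (9 * (\<rho> * len))"
      using w chain by (intro mult_mono) (auto simp: \<rho>_def)
    also have "\<dots> = 9 * (\<rho> ^ 2 * len)" by (simp add: power2_eq_square)
    finally show "(r + 2) * (2 * w + 3) \<le> n" using chain by linarith
    show "0 \<le> F" unfolding F by (rule F_range)
  qed (use that lo0 r_gt_1 N_gt_1 bits_N_le_n in auto)
  have "bit_operations (for_loop lo hi (\<lambda>u. test_u M N r F K u)) \<le> n + (\<Sum>u\<in>{lo..hi}. bit_operations (test_u M N r F K u) + 2 * n)"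
    using lo0 blo bhi w chain by (intro cost_for_loop) linarith+
  also have "\<dots> \<le> n + (\<Sum>u\<in>{lo..hi}. (6 * r + 240) * (n * m) + 2 * (n * m))"
    using test n_le by (intro add_left_mono sum_mono add_mono) auto
  also have "\<dots> = n + card {lo..hi} * ((6 * r + 242) * (n * m))" by (simp add: algebra_simps)
  finally have loop: "bit_operations (for_loop lo hi (\<lambda>u. test_u M N r F K u)) \<le> n + card {lo..hi} * ((6 * r + 242) * (n * m))" .
  have rA: "(r + 1) * bits A \<le> n"
  proof -
    have "bits A \<le> 3 * (\<rho> * len)" using B(7) chain unfolding A_def by linarith
    then have "(r + 1) * bits A \<le> \<rho> * (3 * (\<rho> * len))" by (intro mult_mono) (auto simp: \<rho>_def)
    also have "\<dots> = 3 * (\<rho> ^ 2 * len)" by (simp add: power2_eq_square)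
    finally show ?thesis using chain by linarith
  qed
  have bb: "r * bits b \<le> r * len" "r * bits (int r) \<le> r * len" "(r + 1) * bits (int r + 1) \<le> (r + 1) * len"
    using bits_b[OF b] bits_r by (intro mult_left_mono; simp)+
  have "bit_operations (search_ab M N r (int j) F a b) = bit_operations (ipow M b r) + bit_operations (imul M a (b ^ r))
     + bit_operations (imul M (a * b ^ r) N) + bit_operations (ipow M (int r) r) + bit_operations (imul M (int r ^ r) (a * b ^ r * N))
     + bit_operations (ipow M (int r + 1) (r + 1)) + bit_operations (imul M ((int r + 1) ^ (r + 1)) (a * b ^ r * N))
     + bit_operations (ceiling_root M (r + 1) A) + bit_operations (upper_end M N r (int j) a b A)
     + bit_operations (for_loop lo hi (\<lambda>u. test_u M N r F K u))"
    unfolding search_ab_def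
    by (simp only: bit_operations_bind_costed result_bind_costed result_elementary result_ipow A_def[symmetric] K_def[symmetric] lo hi add.assoc)
  moreover have "bit_operations (ipow M b r) \<le> r * m" using bb chain by (intro cost_ipow) linarith
  moreover have "bit_operations (imul M a (b ^ r)) \<le> m" using B bits_a[OF j a] chain by (intro cost_imul) linarith+
  moreover have "bit_operations (imul M (a * b ^ r) N) \<le> m" using B chain by (intro cost_imul) linarith+
  moreover have "bit_operations (ipow M (int r) r) \<le> r * m" using bb chain by (intro cost_ipow) linarith
  moreover have "bit_operations (imul M (int r ^ r) (a * b ^ r * N)) \<le> m" using B chain by (intro cost_imul) linarith+
  moreover have "bit_operations (ipow M (int r + 1) (r + 1)) \<le> (r + 1) * m"
  proof -
    have "(r + 1) * len = r * len + len" by simp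
    then have "(r + 1) * bits (int r + 1) \<le> n" using bb(3) chain by linarith
    then show ?thesis by (rule cost_ipow)
  qed
  moreover have "bit_operations (imul M ((int r + 1) ^ (r + 1)) (a * b ^ r * N)) \<le> m" using B chain by (intro cost_imul) linarith+
  moreover have "bit_operations (ceiling_root M (r + 1) A) \<le> (2 * (r + 1) + 6) * (n * m)"
    using a b N_gt_1 by (intro cost_ceiling_root rA) (auto simp: A_def)
  moreover have "bit_operations (upper_end M N r (int j) a b A) \<le> 60 * \<rho> ^ 2 * (n * m)"
    unfolding A_def by (rule cost_upper_end[OF j a b])
  moreover have "r * m \<le> r * (n * m)" "(r + 1) * m \<le> (r + 1) * (n * m)" using m_le by (intro mult_left_mono; simp)+
  moreover have const: "2 * (r * (n * m)) + (r + 1) * (n * m) + (2 * (r + 1) + 6) * (n * m) + 5 * (n * m) + 60 * \<rho> ^ 2 * (n * m) \<le> 350 * \<rho> ^ 2 * (n * m)"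
    "(6 * r + 242) * (n * m) \<le> 350 * \<rho> ^ 2 * (n * m)"
  proof -
    have arith: "2 * r + (r + 1) + (2 * (r + 1) + 6) + 5 + 60 * q \<le> 350 * q" "6 * r + 242 \<le> 350 * q" if "\<rho> \<le> q" for q
    proof -
      have "r + 2 \<le> q" using that by (simp only: chain(9))
      then show "2 * r + (r + 1) + (2 * (r + 1) + 6) + 5 + 60 * q \<le> 350 * q" "6 * r + 242 \<le> 350 * q" by simp_all
    qed
    have "2 * r + (r + 1) + (2 * (r + 1) + 6) + 5 + 60 * \<rho> ^ 2 \<le> 350 * \<rho> ^ 2" by (rule arith(1)[OF rho_le_square])
    then have "(2 * r + (r + 1) + (2 * (r + 1) + 6) + 5 + 60 * \<rho> ^ 2) * (n * m) \<le> 350 * \<rho> ^ 2 * (n * m)" by (rule mult_right_mono) simp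
    then show "2 * (r * (n * m)) + (r + 1) * (n * m) + (2 * (r + 1) + 6) * (n * m) + 5 * (n * m) + 60 * \<rho> ^ 2 * (n * m) \<le> 350 * \<rho> ^ 2 * (n * m)"
      by (simp only: add_mult_distrib mult.assoc)
    have "6 * r + 242 \<le> 350 * \<rho> ^ 2" by (rule arith(2)[OF rho_le_square])
    then show "(6 * r + 242) * (n * m) \<le> 350 * \<rho> ^ 2 * (n * m)" by (rule mult_right_mono) simp
  qed
  ultimately have "bit_operations (search_ab M N r (int j) F a b) \<le> 350 * \<rho> ^ 2 * (n * m) + card {lo..hi} * ((6 * r + 242) * (n * m))"
    using loop n_le m_le by linarith
  also have "\<dots> \<le> 350 * \<rho> ^ 2 * (n * m) + card {lo..hi} * (350 * \<rho> ^ 2 * (n * m))"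
    using const(2) by (intro add_left_mono mult_left_mono) auto
  also have "\<dots> = 350 * \<rho> ^ 2 * (n * m) * (1 + card {lo..hi})" by (simp only: distrib_left mult_1_right mult.commute[of "card {lo..hi}"])
  finally have "real (bit_operations (search_ab M N r (int j) F a b)) \<le> real (350 * \<rho> ^ 2 * (n * m) * (1 + card {lo..hi}))"
    by (simp only: of_nat_le_iff)
  also have "\<dots> = 350 * real \<rho> ^ 2 * real (n * m) * (1 + real (card {lo..hi}))" by (simp only: of_nat_mult of_nat_add of_nat_power of_nat_numeral of_nat_1)
  also have "\<dots> \<le> 350 * real \<rho> ^ 2 * real (n * m) * (2 + lehman_U N r (int j) a b)"
  proof (intro mult_left_mono)
    have "real_of_int hi \<le> lehman_G N r a b + lehman_U N r (int j) a b" "lehman_G N r a b \<le> real_of_int lo"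
      by (simp_all add: hi_def lo_def)
    then show "1 + real (card {lo..hi}) \<le> 2 + lehman_U N r (int j) a b" using U0 by (cases "lo \<le> hi + 1") auto
  qed simp
  finally show ?thesis .
qed

text \<open>
  The second summand is the overhead of the loop over \<open>a\<close>. It is kept apart, with \<open>n\<close> in place of \<open>n m\<close>:
  estimating the bound on \<open>a\<close> by \<open>O(X)\<close> for each of up to \<open>len\<close> values of \<open>j\<close> wastes a factor \<open>len\<close>, which is at most \<open>m\<close>.
\<close>

lemma cost_search_j:
  assumes j: "int j \<le> jmax"
  shows "real (bit_operations (search_j M N r (int j))) \<le> 60 * real \<rho> ^ 2 * real (n * m) + 3 * real n * real_of_int (amax (int j))
    + 352 * real \<rho> ^ 2 * real (n * m) * (\<Sum>a\<in>{1..amax (int j)}. \<Sum>b\<in>{1..bmax (int j)}. 2 + lehman_U N r (int j) a b)"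
proof -
  define F where "F = \<lfloor>(real r + 1) * lehman_L N r (int j)\<rfloor>"
  define A where "A = amax (int j)"
  define B where "B = bmax (int j)"
  define x where "x = int r ^ 12 * N ^ 3"
  define x' where "x' = x div 2 ^ (4 * j)"
  define y where "y = (2::int) ^ ((r + 2) * j + 3 * (r + 1))"
  define z where "z = N ^ 3 div 2 ^ ((2 * r + 1) * (r + 2) * j)"
  note chain = rho_chain
  have F: "result (floor_root M 12 x') = F" and am: "result (ceiling_root M 3 y) = A" and bm: "result (floor_root M (3 * (r + 2)) z) = B"
    unfolding F_def A_def B_def x'_def x_def y_def z_def by (rule result_scaled_radius, rule result_amax, rule result_bmax)
  have e: "nat (4 * int j) = 4 * j" "nat (int (r + 2) * int j) = (r + 2) * j"
    "nat (int ((2 * r + 1) * (r + 2)) * int j) = (2 * r + 1) * (r + 2) * j"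
  proof -
    have "4 * int j = int (4 * j)" by simp
    then show "nat (4 * int j) = 4 * j" by (simp only: nat_int)
  qed (simp_all only: of_nat_mult[symmetric] nat_int)
  have bN3: "bits (N ^ 3) \<le> 3 * len" using bits_power[of 3 N] by simp
  have br: "bits (int r ^ 12) \<le> 12 * len" using bits_power[of 12 "int r"] bits_r(1) by simp
  have bx: "bits x \<le> 15 * len" unfolding x_def using bits_mult[of "int r ^ 12" "N ^ 3"] bN3 br by linarith
  have x0: "0 \<le> x" using N_gt_1 by (simp add: x_def)
  have bx': "bits x' \<le> 15 * len" unfolding x'_def using bits_div[OF x0, of "2 ^ (4 * j)"] bx by simp
  define ex where "ex = (r + 2) * j + 3 * (r + 1)"
  have ex: "ex \<le> 4 * len"
  proof -
    have "3 * (r + 1) \<le> 3 * len" using chain(10) by (rule mult_left_mono) simp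
    then show ?thesis unfolding ex_def using bits_j(4)[OF j] by (rule add_mono[rotated, THEN order_trans]) simp
  qed
  have by_y: "bits y \<le> 5 * len" unfolding y_def ex_def[symmetric] using bits_two_power[of ex] ex chain(1) by linarith
  have y0: "0 \<le> y" by (simp add: y_def)
  have bz: "bits z \<le> 3 * len" unfolding z_def using bits_div[of "N ^ 3" "2 ^ ((2 * r + 1) * (r + 2) * j)"] bN3 N_gt_1 by simp
  have A0: "0 \<le> A" and B0: "0 \<le> B" unfolding A_def B_def by (rule amax_nonneg, rule bmax_nonneg)
  have bA: "bits A + 1 \<le> n"
  proof -
    have "bits A \<le> bits (2 ^ (2 * len))" using a_small[OF j, of A] A0 by (intro bits_mono_nonneg) (auto simp: A_def)
    then show ?thesis using bits_two_power[of "2 * len"] chain by linarith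
  qed
  have bB: "bits B + 1 \<le> n"
  proof -
    have "bits B \<le> len" using b_small[of B j] B0 by (intro bits_mono_nonneg) (auto simp: B_def)
    then show ?thesis using chain by linarith
  qed
  have rz: "3 * (r + 2) * bits z \<le> n"
  proof -
    have "3 * (r + 2) * bits z \<le> 3 * \<rho> * (3 * len)" using bz by (intro mult_mono) (auto simp: \<rho>_def)
    also have "\<dots> = 9 * (\<rho> * len)" by simp
    finally show ?thesis using chain by linarith
  qed
  have b_const: "bits (int (r + 2)) \<le> n" "bits (int ((2 * r + 1) * (r + 2))) \<le> n" "bits (4::int) \<le> n"
  proof -
    have "(2 * r + 1) * (r + 2) \<le> 2 * \<rho> * \<rho>" unfolding \<rho>_def by (intro mult_mono) auto
    also have "\<dots> = 2 * \<rho> ^ 2" by (simp add: power2_eq_square)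
    also have "\<dots> \<le> 2 * (\<rho> ^ 2 * len)" using len_pos by simp
    finally show "bits (int ((2 * r + 1) * (r + 2))) \<le> n" using bits_of_nat[of "(2 * r + 1) * (r + 2)"] chain by linarith
    show "bits (int (r + 2)) \<le> n" using bits_of_nat[of "r + 2"] chain unfolding \<rho>_def by linarith
    have "bits (4::int) \<le> 4" using bits_of_nat[of 4] by simp
    then show "bits (4::int) \<le> n" using chain by linarith
  qed
  have bj: "bits (int j) \<le> n" using bits_j(2)[OF j] chain by linarith
  define S where "S a = (\<Sum>b\<in>{1..B}. bit_operations (search_ab M N r (int j) F a b) + 2 * n)" for a
  have inner: "bit_operations (for_loop 1 B (\<lambda>b. search_ab M N r (int j) F a b)) \<le> n + S a" for a
    unfolding S_def using bB n_pos by (intro cost_for_loop) auto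
  have "bit_operations (for_loop 1 A (\<lambda>a. for_loop 1 B (\<lambda>b. search_ab M N r (int j) F a b)))
     \<le> n + (\<Sum>a\<in>{1..A}. bit_operations (for_loop 1 B (\<lambda>b. search_ab M N r (int j) F a b)) + 2 * n)"
    using bA n_pos by (intro cost_for_loop) auto
  also have "\<dots> \<le> n + (\<Sum>a\<in>{1..A}. n + S a + 2 * n)" using inner by (intro add_left_mono sum_mono add_right_mono)
  also have "\<dots> = n + 3 * n * card {1..A} + (\<Sum>a\<in>{1..A}. S a)" by (simp add: sum.distrib)
  also have "card {1..A} = nat A" by simp
  finally have loop: "bit_operations (for_loop 1 A (\<lambda>a. for_loop 1 B (\<lambda>b. search_ab M N r (int j) F a b)))
      \<le> n + 3 * n * nat A + (\<Sum>a\<in>{1..A}. S a)" .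
  have "bit_operations (search_j M N r (int j)) = bit_operations (ipow M N 3) + bit_operations (ipow M (int r) 12)
    + bit_operations (imul M (int r ^ 12) (N ^ 3)) + bit_operations (imul M 4 (int j)) + bits x + bit_operations (floor_root M 12 x')
    + bit_operations (imul M (int (r + 2)) (int j)) + (1 + ((r + 2) * j + 3 * (r + 1))) + bit_operations (ceiling_root M 3 y)
    + bit_operations (imul M (int ((2 * r + 1) * (r + 2))) (int j)) + bits (N ^ 3) + bit_operations (floor_root M (3 * (r + 2)) z)
    + bit_operations (for_loop 1 A (\<lambda>a. for_loop 1 B (\<lambda>b. search_ab M N r (int j) F a b)))"
    unfolding search_j_def
    by (simp only: bit_operations_bind_costed result_bind_costed result_elementary result_ipow bit_operations_elementary(2-8) bits_one e
      mult_1 x_def[symmetric] x'_def[symmetric] y_def[symmetric] z_def[symmetric] F am bm add.assoc)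
  moreover have "bit_operations (ipow M N 3) \<le> 3 * m" using chain by (intro cost_ipow) linarith
  moreover have "bit_operations (ipow M (int r) 12) \<le> 12 * m" using bits_r(1) chain by (intro cost_ipow) linarith
  moreover have "bit_operations (imul M (int r ^ 12) (N ^ 3)) \<le> m" using br bN3 chain by (intro cost_imul) linarith+
  moreover have "bit_operations (imul M 4 (int j)) \<le> m" "bit_operations (imul M (int (r + 2)) (int j)) \<le> m"
    "bit_operations (imul M (int ((2 * r + 1) * (r + 2))) (int j)) \<le> m" using b_const bj by (intro cost_imul; simp)+
  moreover have "bits x \<le> n" "bits (N ^ 3) \<le> n" using bx bN3 chain by linarith+
  moreover have "1 + ((r + 2) * j + 3 * (r + 1)) \<le> n" unfolding ex_def[symmetric] using ex chain by linarith
  moreover have "bit_operations (floor_root M 12 x') \<le> 16 * (n * m)"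
  proof -
    have "12 * bits x' \<le> n" using bx' chain by linarith
    from cost_floor_root[OF this] show ?thesis by simp
  qed
  moreover have "bit_operations (ceiling_root M 3 y) \<le> 12 * (n * m)"
  proof -
    have "3 * bits y \<le> n" using by_y chain by linarith
    from cost_ceiling_root[OF this _ y0] show ?thesis by simp
  qed
  moreover have "bit_operations (floor_root M (3 * (r + 2)) z) \<le> (3 * \<rho> + 4) * (n * m)"
    unfolding \<rho>_def by (rule cost_floor_root[OF rz]) simp
  moreover have "(3 * \<rho> + 4) * (n * m) + 52 * (n * m) \<le> 60 * \<rho> ^ 2 * (n * m)"
  proof -
    have "\<rho> * 1 \<le> \<rho> * \<rho>" using rho_pos by (rule mult_left_mono) simp
    then have "3 * \<rho> + 4 + 52 \<le> 60 * \<rho> ^ 2" using rho_pos r_gt_1 by (simp add: power2_eq_square \<rho>_def)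
    then have "(3 * \<rho> + 4 + 52) * (n * m) \<le> 60 * \<rho> ^ 2 * (n * m)" by (rule mult_right_mono) simp
    then show ?thesis by (simp only: add_mult_distrib)
  qed
  ultimately have "bit_operations (search_j M N r (int j)) \<le> 60 * \<rho> ^ 2 * (n * m) + 3 * n * nat A + (\<Sum>a\<in>{1..A}. S a)"
    using loop n_le m_le by linarith
  then have "real (bit_operations (search_j M N r (int j))) \<le> real (60 * \<rho> ^ 2 * (n * m) + 3 * n * nat A + (\<Sum>a\<in>{1..A}. S a))"
    by (simp only: of_nat_le_iff)
  also have "\<dots> = 60 * real \<rho> ^ 2 * real (n * m) + 3 * real n * real_of_int A + (\<Sum>a\<in>{1..A}. real (S a))"
    using A0 by simp
  also have "(\<Sum>a\<in>{1..A}. real (S a)) \<le> (\<Sum>a\<in>{1..A}. \<Sum>b\<in>{1..B}. 352 * real \<rho> ^ 2 * real (n * m) * (2 + lehman_U N r (int j) a b))"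
    unfolding S_def of_nat_sum
  proof (intro sum_mono)
    fix a b assume ab: "a \<in> {1..A}" "b \<in> {1..B}"
    have "real (bit_operations (search_ab M N r (int j) F a b)) \<le> 350 * real \<rho> ^ 2 * real (n * m) * (2 + lehman_U N r (int j) a b)"
      using ab j F_def by (intro cost_search_ab) (auto simp: A_def B_def)
    moreover have "real (2 * n) \<le> 2 * real \<rho> ^ 2 * real (n * m) * (2 + lehman_U N r (int j) a b)"
    proof -
      have "real n \<le> real (n * m)" using n_le by (simp only: of_nat_le_iff)
      then have "real (2 * n) \<le> 2 * 1 * real (n * m) * 1" by simp
      also have "\<dots> \<le> 2 * real \<rho> ^ 2 * real (n * m) * (2 + lehman_U N r (int j) a b)"
        using rho_pos U_nonneg[of "int j" a b] by (intro mult_mono) (auto simp: one_le_power)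
      finally show ?thesis .
    qed
    moreover have "352 * real \<rho> ^ 2 * real (n * m) * (2 + lehman_U N r (int j) a b)
        = 350 * real \<rho> ^ 2 * real (n * m) * (2 + lehman_U N r (int j) a b) + 2 * real \<rho> ^ 2 * real (n * m) * (2 + lehman_U N r (int j) a b)"
      by (simp add: algebra_simps)
    ultimately show "real (bit_operations (search_ab M N r (int j) F a b) + 2 * n) \<le> 352 * real \<rho> ^ 2 * real (n * m) * (2 + lehman_U N r (int j) a b)"
      unfolding of_nat_add by linarith
  qed
  also have "\<dots> = 352 * real \<rho> ^ 2 * real (n * m) * (\<Sum>a\<in>{1..A}. \<Sum>b\<in>{1..B}. 2 + lehman_U N r (int j) a b)"
    by (simp only: sum_distrib_left)
  finally show ?thesis unfolding A_def B_def by simp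
qed

lemma cost_lehman_program:
  "real (bit_operations (lehman_program M N r)) \<le> real (n * m) * (5 * real \<rho> + 20 + 10 * real_of_int N powr (1 / (real r + 2)) + 2 * real (nat (jmax + 1)))
    + (\<Sum>j\<in>{0..jmax}. real (bit_operations (search_j M N r j)))"
proof -
  define s where "s = result (floor_root M r N)"
  define nmax where "nmax = result (floor_root M (r + 2) N)"
  define X where "X = real_of_int N powr (1 / (real r + 2))"
  note chain = rho_chain
  have r1: "1 \<le> r" using r_gt_1 by simp
  have N0: "0 \<le> N" using N_gt_1 by simp
  have X: "nmax = \<lfloor>X\<rfloor>" unfolding nmax_def X_def by (rule result_nmax)
  have bs: "bits s \<le> len" unfolding s_def using N0 r1 by (intro bits_floor_root)
  have bn: "bits nmax \<le> len" unfolding nmax_def using N0 by (intro bits_floor_root) auto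
  have rs: "r * bits s \<le> r * len" using bs by (rule mult_left_mono) simp
  have bsr: "bits (s ^ r) \<le> r * len" using bits_power[OF r1, of s] rs by linarith
  let ?body = "\<lambda>k. bind_costed (idivmod N k) (\<lambda>qm. bind_costed (ieq (snd qm) 0) (\<lambda>divides. return (if divides then Some k else None)))"
  have small: "bit_operations (for_loop 2 nmax ?body) \<le> n + card {2..nmax} * (10 * (n * m))"
  proof -
    have "bits (2::int) \<le> 2" using bits_of_nat[of 2] by simp
    then have "bits (2::int) \<le> n" using chain by linarith
    then have "bit_operations (for_loop 2 nmax ?body) \<le> n + (\<Sum>k\<in>{2..nmax}. bit_operations (?body k) + 2 * n)"
      using bn chain by (intro cost_for_loop) linarith+
    also have "\<dots> \<le> n + (\<Sum>k\<in>{2..nmax}. 10 * (n * m))"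
    proof (intro add_left_mono sum_mono)
      fix k assume k: "k \<in> {2..nmax}"
      then have bk: "bits k \<le> len" using bits_mono_nonneg[of k nmax] bn by simp
      have md: "snd (result (idivmod N k)) = N mod k" using k N0 by (simp add: result_idivmod)
      have bkn: "bits k + 1 \<le> n" using bk chain by linarith
      have k0: "0 < k" using k by simp
      have "bits (N mod k) \<le> bits k"
        using pos_mod_bound[OF k0, of N] pos_mod_sign[OF k0, of N] by (intro bits_mono_nonneg) auto
      then have "max (bits (N mod k)) 1 \<le> n" using bkn by simp
      moreover have "bit_operations (idivmod N k) \<le> 7 * (n * n)" by (rule cost_idivmod_square[OF N0 k0 bits_N_le_n bkn])
      moreover have "bit_operations (?body k) = bit_operations (idivmod N k) + max (bits (N mod k)) 1" by (simp add: md)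
      ultimately show "bit_operations (?body k) + 2 * n \<le> 10 * (n * m)" using n_le sq_le by linarith
    qed
    finally show ?thesis by simp
  qed
  have jm: "fst (result (idivmod (int len - 1) (int (r * (r + 2))))) = jmax"
    unfolding jmax_eq using r_less_len period_pos by (subst result_idivmod) simp_all
  have j0: "0 \<le> jmax" unfolding jmax_eq by (subst pos_imp_zdiv_nonneg_iff[OF period_pos]) (use r_less_len in simp)
  have bl: "bits (int len - 1) \<le> len" using bits_of_nat[of len] bits_mono_nonneg[of "int len - 1" "int len"] len_pos by simp
  have bj: "bits jmax \<le> len"
    unfolding jmax_eq using bits_div[OF _ period_pos, of "int len - 1"] bl len_pos by simp
  have bper: "bits (int (r * (r + 2))) + 1 \<le> n"
  proof -
    have "r * (r + 2) \<le> \<rho> * \<rho>" unfolding \<rho>_def by (intro mult_mono) auto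
    also have "\<dots> \<le> \<rho> ^ 2 * len" using len_pos by (simp add: power2_eq_square)
    finally show ?thesis using bits_of_nat[of "r * (r + 2)"] chain by linarith
  qed
  have main: "bit_operations (for_loop 0 jmax (\<lambda>j. search_j M N r j)) \<le> n + (\<Sum>j\<in>{0..jmax}. bit_operations (search_j M N r j) + 2 * n)"
  proof -
    have "bits jmax + 1 \<le> n" using bj chain by linarith
    then show ?thesis using n_pos by (intro cost_for_loop) auto
  qed
  have prog: "bit_operations (lehman_program M N r) = bit_operations (floor_root M r N) + (bit_operations (ipow M s r) + (max (bits (s ^ r)) len
    + (if s ^ r = N then 0 else bit_operations (floor_root M (r + 2) N) + (bit_operations (for_loop 2 nmax ?body)
      + (case result (for_loop 2 nmax ?body) of Some k \<Rightarrow> 0 | None \<Rightarrow> len + (bit_operations (idivmod (int len - 1) (int (r * (r + 2))))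
        + bit_operations (for_loop 0 jmax (\<lambda>j. search_j M N r j))))))))"
    unfolding lehman_program_def
    by (simp only: bit_operations_bind_costed result_bind_costed result_elementary bit_operations_elementary result_ipow
      s_def[symmetric] nmax_def[symmetric] jm if_distrib[of bit_operations] option.case_distrib[of bit_operations])
  have "bit_operations (lehman_program M N r) \<le> bit_operations (floor_root M r N) + bit_operations (ipow M s r) + max (bits (s ^ r)) len
    + (bit_operations (floor_root M (r + 2) N) + bit_operations (for_loop 2 nmax ?body)
    + (len + bit_operations (idivmod (int len - 1) (int (r * (r + 2)))) + bit_operations (for_loop 0 jmax (\<lambda>j. search_j M N r j))))"
    unfolding prog by (cases "s ^ r = N"; cases "result (for_loop 2 nmax ?body)") simp_all
  moreover have "bit_operations (floor_root M r N) \<le> (r + 4) * (n * m)" using chain r1 by (intro cost_floor_root) linarith+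
  moreover have "bit_operations (ipow M s r) \<le> r * m" using rs chain by (intro cost_ipow) linarith
  moreover have "r * m \<le> r * (n * m)" using m_le by (rule mult_left_mono) simp
  moreover have "max (bits (s ^ r)) len \<le> n" using bsr chain by linarith
  moreover have "bit_operations (floor_root M (r + 2) N) \<le> (\<rho> + 4) * (n * m)"
  proof -
    have "(r + 2) * bits N \<le> n" unfolding chain(9) using chain by linarith
    from cost_floor_root[OF this] show ?thesis by (simp add: \<rho>_def)
  qed
  moreover have "bit_operations (idivmod (int len - 1) (int (r * (r + 2)))) \<le> 7 * (n * n)"
    using bl bper period_pos len_pos chain by (intro cost_idivmod_square) linarith+
  moreover have "(r + 4) * (n * m) + r * (n * m) + (\<rho> + 4) * (n * m) + 12 * (n * m) = (2 * r + \<rho> + 20) * (n * m)" by (simp add: algebra_simps)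
  moreover have "len \<le> n" using chain by linarith
  ultimately have "bit_operations (lehman_program M N r) \<le> (2 * r + \<rho> + 20) * (n * m) + card {2..nmax} * (10 * (n * m))
     + (\<Sum>j\<in>{0..jmax}. bit_operations (search_j M N r j) + 2 * n)"
    using small main n_le sq_le by linarith
  also have "\<dots> \<le> (5 * \<rho> + 20) * (n * m) + card {2..nmax} * (10 * (n * m))
     + (\<Sum>j\<in>{0..jmax}. bit_operations (search_j M N r j) + 2 * (n * m))"
    using n_le by (intro add_mono mult_right_mono sum_mono) (auto simp: \<rho>_def)
  also have "\<dots> = (5 * \<rho> + 20) * (n * m) + card {2..nmax} * (10 * (n * m))
     + nat (jmax + 1) * (2 * (n * m)) + (\<Sum>j\<in>{0..jmax}. bit_operations (search_j M N r j))"
    by (simp add: sum.distrib)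
  finally have "real (bit_operations (lehman_program M N r)) \<le> real ((5 * \<rho> + 20) * (n * m) + card {2..nmax} * (10 * (n * m))
     + nat (jmax + 1) * (2 * (n * m)) + (\<Sum>j\<in>{0..jmax}. bit_operations (search_j M N r j)))"
    by (simp only: of_nat_le_iff)
  also have "\<dots> = (5 * real \<rho> + 20) * real (n * m) + real (card {2..nmax}) * (10 * real (n * m))
     + real (nat (jmax + 1)) * (2 * real (n * m)) + (\<Sum>j\<in>{0..jmax}. real (bit_operations (search_j M N r j)))"
    by simp
  also have "real (card {2..nmax}) * (10 * real (n * m)) \<le> X * (10 * real (n * m))"
  proof (intro mult_right_mono)
    have "0 \<le> X" by (simp add: X_def)
    then show "real (card {2..nmax}) \<le> X" unfolding X by (cases "2 \<le> \<lfloor>X\<rfloor>") (simp_all, linarith)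
  qed simp
  finally show ?thesis unfolding X_def by (simp add: algebra_simps)
qed

end

section \<open>Summation over the loops\<close>

lemma powr_minus_half: "x powr (- 1/2) = 1 / sqrt x" if "0 \<le> x" for x :: real
  using powr_minus_divide[of x "1/2"] that by (simp add: powr_half_sqrt)

lemma half_le_ln_2: "1 / 2 \<le> ln (2::real)" and one_less_ln_4: "1 < ln (4::real)"
proof -
  have "exp 1 < (4::real)" using exp_le by linarith
  then have "ln (exp 1) < ln (4::real)" by (subst ln_less_cancel_iff) auto
  then show "1 < ln (4::real)" by simp
  moreover have "ln (4::real) = 2 * ln 2" using ln_realpow[of 2 2] by simp
  ultimately show "1 / 2 \<le> ln (2::real)" by simp
qed

text \<open>
  Telescoping with \<open>1/\<surd>(k + 1) \<le> 2 (\<surd>(k + 1) - \<surd>k)\<close>.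
\<close>

lemma sum_inverse_sqrt_le: "(\<Sum>a\<in>{1..int k}. real_of_int a powr (- 1/2)) \<le> 2 * sqrt (real k)"
proof (induction k)
  case (Suc k)
  have "(\<Sum>a\<in>{1..int (Suc k)}. real_of_int a powr (- 1/2)) = real (Suc k) powr (- 1/2) + (\<Sum>a\<in>{1..int k}. real_of_int a powr (- 1/2))"
  proof -
    have "{1..int (Suc k)} = insert (int (Suc k)) {1..int k}" by auto
    then show ?thesis by simp
  qed
  also have "\<dots> \<le> 1 / sqrt (real (Suc k)) + 2 * sqrt (real k)"
    using Suc powr_minus_half[of "real (Suc k)"] by simp
  also have "\<dots> \<le> 2 * sqrt (real (Suc k))"
  proof -
    define p q where "p = sqrt (real (Suc k))" and "q = sqrt (real k)"
    have pq: "0 < p" "0 \<le> q" "q \<le> p" "p\<^sup>2 = q\<^sup>2 + 1" by (simp_all add: p_def q_def)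
    have "0 \<le> (p - q)\<^sup>2" by simp
    then have "1 + 2 * q * p \<le> 2 * p * p" using pq(4) by (simp add: power2_eq_square algebra_simps)
    then have "1 / p + 2 * q \<le> 2 * p" using pq(1) by (simp add: field_simps)
    then show ?thesis by (simp add: p_def q_def)
  qed
  finally show ?case .
qed simp

lemma sum_geometric_le:
  fixes q :: real
  assumes "0 < q" "q < 1"
  shows "(\<Sum>j\<in>{0..J::int}. q powr real_of_int j) \<le> 1 / (1 - q)"
proof -
  have "(\<Sum>j\<in>{0..J}. q powr real_of_int j) = (\<Sum>i<nat (J + 1). q ^ i)"
    by (rule sum.reindex_bij_witness[of _ int nat]) (use assms in \<open>auto simp: powr_realpow[symmetric]\<close>)
  also have "\<dots> = (1 - q ^ nat (J + 1)) / (1 - q)"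
    using assms by (simp add: sum_gp_strict)
  also have "\<dots> \<le> 1 / (1 - q)" using assms by (intro divide_right_mono) auto
  finally show ?thesis .
qed

context lehman_input
begin

definition trial_bound :: real where "trial_bound = real_of_int N powr (1 / (real r + 2))"

lemma trial_bound_ge_1: "1 \<le> trial_bound"
  unfolding trial_bound_def using N_gt_1 by (intro ge_one_powr_ge_zero) auto

lemma trial_bound_eq: "trial_bound = 2 powr (log 2 (real_of_int N) / (real r + 2))"
proof -
  have "real_of_int N = 2 powr (log 2 (real_of_int N))" using N_gt_1 by simp
  then have "trial_bound = (2 powr (log 2 (real_of_int N))) powr (1 / (real r + 2))" unfolding trial_bound_def by simp
  then show ?thesis by (simp only: powr_powr times_divide_eq_right mult_1_right)
qed

lemma amax_le:
  "real_of_int (amax (int j)) \<le> 2 powr ((real r + 2) * real j / 3) * 2 ^ (r + 2)"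
proof -
  define e where "e = (real r + 2) * real j / 3 + real r + 1"
  have "0 \<le> e" by (simp add: e_def)
  then have "1 \<le> 2 powr e" by (intro ge_one_powr_ge_zero) auto
  moreover have "real_of_int (amax (int j)) \<le> 2 powr e + 1" unfolding amax_def e_def of_int_of_nat_eq by linarith
  ultimately have "real_of_int (amax (int j)) \<le> 2 * 2 powr e" by linarith
  also have "\<dots> = 2 powr ((real r + 2) * real j / 3 + real (r + 2))"
  proof -
    have "2 * 2 powr e = 2 powr (1 + e)" by (simp only: powr_add) simp
    then show ?thesis by (simp add: e_def algebra_simps)
  qed
  also have "\<dots> = 2 powr ((real r + 2) * real j / 3) * 2 ^ (r + 2)"
    by (subst powr_add, subst powr_realpow) auto
  finally show ?thesis .
qed

lemma bmax_le: "real_of_int (bmax (int j)) \<le> trial_bound * 2 powr (- (2 * real r + 1) * real j / 3)"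
  unfolding bmax_def trial_bound_def of_int_of_nat_eq by (rule of_int_floor_le)

lemma amax_le_trial_bound:
  assumes "int j \<le> jmax"
  shows "real_of_int (amax (int j)) \<le> trial_bound * 2 ^ (r + 2)"
proof -
  define y where "y = log 2 (real_of_int N)"
  have y0: "0 \<le> y" using N_gt_1 by (simp add: y_def)
  have "real j \<le> 1 / (real r * (real r + 2)) * y"
    using assms unfolding jmax_def y_def by (simp add: le_floor_iff)
  then have "(real r + 2) * real j / 3 \<le> (real r + 2) * (1 / (real r * (real r + 2)) * y) / 3"
    by (intro divide_right_mono mult_left_mono) auto
  also have "\<dots> = y / (3 * real r)"
  proof -
    have "real r + 2 \<noteq> 0" by linarith
    then show ?thesis by (simp add: divide_simps)
  qed
  also have "\<dots> \<le> y / (real r + 2)" using y0 r_gt_1 by (intro divide_left_mono) auto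
  finally have "2 powr ((real r + 2) * real j / 3) \<le> trial_bound"
    unfolding trial_bound_eq y_def by (intro powr_mono) auto
  then have "2 powr ((real r + 2) * real j / 3) * 2 ^ (r + 2) \<le> trial_bound * 2 ^ (r + 2)" by (rule mult_right_mono) simp
  then show ?thesis using amax_le[of j] by linarith
qed

text \<open>
  Used to absorb the cost of the outer loop itself, which has up to \<open>len\<close> rounds.
\<close>

lemma len_le_trial_bound: "real len \<le> 3 * (real r + 2) * trial_bound"
proof -
  define y where "y = log 2 (real_of_int N) / (real r + 2)"
  have trial_bound: "trial_bound = exp (y * ln 2)" unfolding trial_bound_eq y_def[symmetric] by (simp add: powr_def)
  have y0: "0 \<le> y" using N_gt_1 by (simp add: y_def)
  have "y * (1/2) \<le> y * ln 2" using y0 half_le_ln_2 by (intro mult_left_mono) auto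
  also have "\<dots> \<le> trial_bound" unfolding trial_bound using exp_ge_add_one_self[of "y * ln 2"] by linarith
  finally have "y \<le> 2 * trial_bound" by simp
  have "int len - 1 \<le> log 2 (real_of_int N)" using floor_log2_eq_bits[of N] N_gt_1 by linarith
  also have "\<dots> = (real r + 2) * y" by (simp add: y_def)
  also have "\<dots> \<le> (real r + 2) * (2 * trial_bound)" using \<open>y \<le> 2 * trial_bound\<close> by (rule mult_left_mono) simp
  finally have "real len \<le> 1 + (real r + 2) * (2 * trial_bound)" by simp
  also have "\<dots> \<le> (real r + 2) * trial_bound + (real r + 2) * (2 * trial_bound)"
  proof -
    have "1 * 1 \<le> (real r + 2) * trial_bound" using trial_bound_ge_1 by (intro mult_mono) auto
    then show ?thesis by linarith
  qed
  finally show ?thesis by (simp add: algebra_simps)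
qed

lemma card_j_le: "nat (jmax + 1) \<le> len"
proof -
  have "jmax \<le> int len - 1"
    unfolding jmax_eq using r_less_len r_gt_1 by (intro int_div_le_self) simp
  then show ?thesis by simp
qed

definition pair_const :: real where "pair_const = 2 ^ (r + 3) * (1 + real r ^ (r + 2))"

lemma pair_const_nonneg: "0 \<le> pair_const" by (simp add: pair_const_def)

text \<open>
  The number of pairs is at most the product of the two loop bounds. For the sum of \<open>U\<close>,
  \<open>\<Sum> (a b)\<^bsup>-1/2\<^esup>\<close> is at most \<open>4\<close> times the square root of that product, and the prefactor of \<open>U\<close> is again of the
  order of this square root.
\<close>

lemma sum_pairs_le:
  "(\<Sum>a\<in>{1..amax (int j)}. \<Sum>b\<in>{1..bmax (int j)}. 2 + lehman_U N r (int j) a b) \<le> pair_const * trial_bound * 2 powr (- real j / 3)"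
proof -
  define A where "A = nat (amax (int j))"
  define B where "B = nat (bmax (int j))"
  have AB: "amax (int j) = int A" "bmax (int j) = int B"
    using amax_nonneg[of "int j"] bmax_nonneg[of "int j"] by (simp_all add: A_def B_def)
  define t where "t = 2 powr (- (real r - 1) * real j / 6)"
  define s where "s = sqrt trial_bound"
  have T0: "0 < trial_bound" using trial_bound_ge_1 by linarith
  have s2: "s * s = trial_bound" using T0 by (simp add: s_def)
  have s0: "0 \<le> s" using T0 by (simp add: s_def)
  have t0: "0 \<le> t" by (simp add: t_def)
  have "real A * real B \<le> (2 powr ((real r + 2) * real j / 3) * 2 ^ (r + 2)) * (trial_bound * 2 powr (- (2 * real r + 1) * real j / 3))"
    using amax_le[of j] bmax_le[of j] unfolding AB by (intro mult_mono) auto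
  also have "\<dots> = 2 ^ (r + 2) * trial_bound * (2 powr ((real r + 2) * real j / 3) * 2 powr (- (2 * real r + 1) * real j / 3))" by (simp add: mult_ac)
  also have "2 powr ((real r + 2) * real j / 3) * 2 powr (- (2 * real r + 1) * real j / 3) = t * t"
    unfolding t_def powr_add[symmetric] by (rule arg_cong[where f = "\<lambda>x. 2 powr x"]) (simp add: field_simps)
  finally have prod: "real A * real B \<le> 2 ^ (r + 2) * trial_bound * (t * t)" .
  have tt: "t * t \<le> 2 powr (- real j / 3)"
  proof -
    have "t * t = 2 powr (- (real r - 1) * real j / 3)"
      unfolding t_def powr_add[symmetric] by (rule arg_cong[where f = "\<lambda>x. 2 powr x"]) (simp add: field_simps)
    moreover have "1 * real j \<le> (real r - 1) * real j" using r_gt_1 by (intro mult_right_mono) auto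
    ultimately show ?thesis by (simp add: algebra_simps)
  qed
  have "sqrt (real A * real B) \<le> sqrt (2 ^ (r + 2) * trial_bound * (t * t))" using prod by (rule real_sqrt_le_mono)
  also have "\<dots> = sqrt (2 ^ (r + 2)) * s * t" using t0 by (simp add: real_sqrt_mult s_def)
  also have "\<dots> \<le> 2 ^ (r + 2) * s * t"
  proof (intro mult_right_mono)
    define z where "z = (2::real) ^ (r + 2)"
    have "1 \<le> z" unfolding z_def by (rule one_le_power) simp
    then have "sqrt z \<le> z" by (intro real_le_lsqrt) (auto simp: power2_eq_square)
    then show "sqrt (2 ^ (r + 2)) \<le> (2::real) ^ (r + 2)" by (simp only: z_def)
  qed (use s0 t0 in auto)
  finally have root: "sqrt (real A * real B) \<le> 2 ^ (r + 2) * s * t" .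
  define \<kappa> where "\<kappa> = real r powr (real r + 3/2) * s * t / 2"
  have \<kappa>: "0 \<le> \<kappa>" "\<kappa> \<le> real r ^ (r + 2) * s * t / 2"
  proof -
    show "0 \<le> \<kappa>" using s0 t0 by (simp add: \<kappa>_def)
    have "real r powr (real r + 3/2) \<le> real r powr (real (r + 2))" using r_gt_1 by (intro powr_mono) auto
    also have "\<dots> = real r ^ (r + 2)" using r_gt_1 by (subst powr_realpow) auto
    finally show "\<kappa> \<le> real r ^ (r + 2) * s * t / 2"
      unfolding \<kappa>_def using s0 t0 by (intro divide_right_mono mult_right_mono) auto
  qed
  have U: "lehman_U N r (int j) a b = \<kappa> * (real_of_int a powr (- 1/2) * real_of_int b powr (- 1/2))"
    if "a \<in> {1..int A}" "b \<in> {1..int B}" for a b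
  proof -
    have "real_of_int N powr (1 / (2 * (real r + 2))) = s"
    proof -
      have "s = trial_bound powr (1/2)" using T0 by (simp add: s_def powr_half_sqrt)
      also have "\<dots> = real_of_int N powr (1 / (2 * (real r + 2)))" unfolding trial_bound_def by (simp add: powr_powr algebra_simps)
      finally show ?thesis by simp
    qed
    moreover have "2 powr (- (real r - 1) * real_of_int (int j) / 6 - 1) = t / 2"
      by (simp add: t_def powr_diff)
    moreover have "real_of_int (a * b) powr (- 1/2) = real_of_int a powr (- 1/2) * real_of_int b powr (- 1/2)"
      using that by (simp add: powr_mult)
    ultimately show ?thesis unfolding lehman_U_def \<kappa>_def by simp
  qed
  have "(\<Sum>a\<in>{1..int A}. \<Sum>b\<in>{1..int B}. 2 + lehman_U N r (int j) a b)
     = 2 * (real A * real B) + (\<Sum>a\<in>{1..int A}. \<Sum>b\<in>{1..int B}. lehman_U N r (int j) a b)"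
    by (simp add: sum.distrib)
  also have "(\<Sum>a\<in>{1..int A}. \<Sum>b\<in>{1..int B}. lehman_U N r (int j) a b)
     = (\<Sum>a\<in>{1..int A}. \<Sum>b\<in>{1..int B}. \<kappa> * (real_of_int a powr (- 1/2) * real_of_int b powr (- 1/2)))"
    using U by (intro sum.cong) auto
  also have "\<dots> = \<kappa> * ((\<Sum>a\<in>{1..int A}. real_of_int a powr (- 1/2)) * (\<Sum>b\<in>{1..int B}. real_of_int b powr (- 1/2)))"
    by (subst sum_product) (simp only: sum_distrib_left)
  also have "\<dots> \<le> \<kappa> * ((2 * sqrt (real A)) * (2 * sqrt (real B)))"
    using \<kappa>(1) by (intro mult_left_mono mult_mono sum_inverse_sqrt_le sum_nonneg) auto
  also have "\<dots> = 4 * \<kappa> * sqrt (real A * real B)" by (simp add: real_sqrt_mult)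
  also have "\<dots> \<le> 4 * (real r ^ (r + 2) * s * t / 2) * (2 ^ (r + 2) * s * t)"
    using \<kappa> root s0 t0 by (intro mult_mono) auto
  also have "\<dots> = 2 ^ (r + 3) * real r ^ (r + 2) * (s * s) * (t * t)" by (simp add: field_simps power_add)
  also have "2 * (real A * real B) + 2 ^ (r + 3) * real r ^ (r + 2) * (s * s) * (t * t) \<le> pair_const * trial_bound * (t * t)"
  proof -
    have "pair_const * trial_bound * (t * t) = 2 * (2 ^ (r + 2) * trial_bound * (t * t)) + 2 ^ (r + 3) * real r ^ (r + 2) * trial_bound * (t * t)"
      by (simp add: pair_const_def algebra_simps power_add)
    then show ?thesis using prod unfolding s2 by linarith
  qed
  also have "\<dots> \<le> pair_const * trial_bound * 2 powr (- real j / 3)"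
    using tt T0 pair_const_nonneg by (intro mult_left_mono) auto
  finally show ?thesis unfolding AB by simp
qed

end

context lehman_cost
begin

lemma cost_lehman_program_le:
  "real (bit_operations (lehman_program M N r)) \<le> (30 + 11 * (real r + 2) + 180 * (real r + 2) ^ 3 + 3 * 2 ^ (r + 2)
    + 352 * (real r + 2) ^ 2 * pair_const * (1 / (1 - 2 powr (- 1/3)))) * (real (n * m) * trial_bound)"
proof -
  define q where "q = 2 powr (- 1/3 :: real)"
  have q: "0 < q" "q < 1" by (simp_all add: q_def powr_less_one)
  define W where "W = real (n * m)"
  define R where "R = real r + 2"
  have R: "real \<rho> = R" by (simp add: R_def \<rho>_def)
  have T1: "1 \<le> trial_bound" by (rule trial_bound_ge_1)
  have W0: "0 \<le> W" by (simp add: W_def)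
  have R0: "0 \<le> R" by (simp add: R_def)
  have len: "real len \<le> 3 * R * trial_bound" unfolding R_def by (rule len_le_trial_bound)
  have cj: "real (nat (jmax + 1)) \<le> real len" using card_j_le by (simp only: of_nat_le_iff)
  have nW: "real n * real len \<le> W"
  proof -
    have "len \<le> m" using rho_chain(1-8) n_le_m by linarith
    then have "n * len \<le> n * m" by (rule mult_left_mono) simp
    then have "real (n * len) \<le> real (n * m)" by (simp only: of_nat_le_iff)
    then show ?thesis by (simp add: W_def)
  qed
  have each: "real (bit_operations (search_j M N r j)) \<le> 60 * R ^ 2 * W + 3 * real n * (trial_bound * 2 ^ (r + 2))
      + 352 * R ^ 2 * W * (pair_const * trial_bound * q powr real_of_int j)" if "j \<in> {0..jmax}" for j
  proof -
    obtain i where i: "j = int i" "int i \<le> jmax" using \<open>j \<in> {0..jmax}\<close> by (auto intro: nonneg_int_cases)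
    have "real (bit_operations (search_j M N r j)) \<le> 60 * R ^ 2 * W + 3 * real n * real_of_int (amax (int i))
      + 352 * R ^ 2 * W * (\<Sum>a\<in>{1..amax (int i)}. \<Sum>b\<in>{1..bmax (int i)}. 2 + lehman_U N r (int i) a b)"
      using cost_search_j[OF i(2)] unfolding i(1) W_def R .
    also have "\<dots> \<le> 60 * R ^ 2 * W + 3 * real n * (trial_bound * 2 ^ (r + 2)) + 352 * R ^ 2 * W * (pair_const * trial_bound * 2 powr (- real i / 3))"
      using amax_le_trial_bound[OF i(2)] sum_pairs_le[of i] W0 by (intro add_mono mult_left_mono) auto
    also have "2 powr (- real i / 3) = q powr real_of_int j" by (simp add: q_def i(1) powr_powr)
    finally show ?thesis .
  qed
  have "(\<Sum>j\<in>{0..jmax}. real (bit_operations (search_j M N r j))) \<le> (\<Sum>j\<in>{0..jmax}. 60 * R ^ 2 * W + 3 * real n * (trial_bound * 2 ^ (r + 2))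
      + 352 * R ^ 2 * W * (pair_const * trial_bound * q powr real_of_int j))"
    by (intro sum_mono each)
  also have "\<dots> = real (nat (jmax + 1)) * (60 * R ^ 2 * W) + real (nat (jmax + 1)) * (3 * real n * (trial_bound * 2 ^ (r + 2)))
      + 352 * R ^ 2 * W * (pair_const * trial_bound) * (\<Sum>j\<in>{0..jmax}. q powr real_of_int j)"
    by (simp add: sum.distrib sum_distrib_left algebra_simps)
  also have "\<dots> \<le> (3 * R * trial_bound) * (60 * R ^ 2 * W) + real len * (3 * real n * (trial_bound * 2 ^ (r + 2)))
      + 352 * R ^ 2 * W * (pair_const * trial_bound) * (1 / (1 - q))"
    using cj len T1 W0 R0 pair_const_nonneg sum_geometric_le[OF q, of jmax]
    by (intro add_mono mult_right_mono mult_left_mono mult_nonneg_nonneg) auto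
  also have "real len * (3 * real n * (trial_bound * 2 ^ (r + 2))) = 3 * 2 ^ (r + 2) * trial_bound * (real n * real len)" by (simp add: mult_ac)
  also have "\<dots> \<le> 3 * 2 ^ (r + 2) * trial_bound * W" using nW T1 by (intro mult_left_mono) auto
  finally have sum: "(\<Sum>j\<in>{0..jmax}. real (bit_operations (search_j M N r j)))
     \<le> (3 * R * trial_bound) * (60 * R ^ 2 * W) + 3 * 2 ^ (r + 2) * trial_bound * W + 352 * R ^ 2 * W * (pair_const * trial_bound) * (1 / (1 - q))" by simp
  have "real (bit_operations (lehman_program M N r)) \<le> W * (5 * R + 20 + 10 * trial_bound + 2 * real (nat (jmax + 1)))
    + (\<Sum>j\<in>{0..jmax}. real (bit_operations (search_j M N r j)))"
    using cost_lehman_program unfolding W_def R trial_bound_def .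
  also have "\<dots> \<le> W * ((5 * R + 20) * trial_bound + 10 * trial_bound + 2 * (3 * R * trial_bound)) + (\<Sum>j\<in>{0..jmax}. real (bit_operations (search_j M N r j)))"
  proof (intro add_right_mono mult_left_mono W0 add_mono)
    have "(5 * R + 20) * 1 \<le> (5 * R + 20) * trial_bound" using T1 R0 by (intro mult_left_mono) auto
    then show "5 * R + 20 \<le> (5 * R + 20) * trial_bound" by simp
  qed (use cj len in auto)
  also have "\<dots> \<le> W * ((5 * R + 20) * trial_bound + 10 * trial_bound + 2 * (3 * R * trial_bound))
     + ((3 * R * trial_bound) * (60 * R ^ 2 * W) + 3 * 2 ^ (r + 2) * trial_bound * W + 352 * R ^ 2 * W * (pair_const * trial_bound) * (1 / (1 - q)))"
    using sum by simp
  also have "\<dots> = (30 + 11 * R + 180 * R ^ 3 + 3 * 2 ^ (r + 2) + 352 * R ^ 2 * pair_const * (1 / (1 - q))) * (W * trial_bound)"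
    by (simp add: algebra_simps power2_eq_square power3_eq_cube)
  finally show ?thesis unfolding W_def R_def q_def .
qed

end

text \<open>
  The asymptotic bound, made valid for all positive arguments; \<open>ln (i + 2) \<ge> 1\<close> makes room for the finitely
  many exceptions.
\<close>

lemma multiplication_cost_bound:
  fixes M :: "nat \<Rightarrow> nat"
  assumes "(\<lambda>n. real (M n)) \<in> O(\<lambda>n. real n * ln (real n))"
  obtains c where "0 \<le> c" "\<And>i. 1 \<le> i \<Longrightarrow> real (M i) \<le> c * (real i * ln (real i + 2))"
proof -
  obtain d where d: "0 < d" "\<forall>\<^sub>F n in sequentially. norm (real (M n)) \<le> d * norm (real n * ln (real n))"
    using landau_o.bigE[OF assms] by blast
  then obtain n0 where n0: "\<And>n. n0 \<le> n \<Longrightarrow> real (M n) \<le> d * \<bar>real n * ln (real n)\<bar>"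
    by (auto simp: eventually_sequentially)
  define c where "c = d + (\<Sum>i<n0. real (M i))"
  have S0: "0 \<le> (\<Sum>i<n0. real (M i))" by (simp add: sum_nonneg)
  show thesis
  proof (rule that[of c])
    show "0 \<le> c" using d(1) S0 by (simp add: c_def)
    fix i :: nat assume i: "1 \<le> i"
    have "exp 1 \<le> (3::real)" by (rule exp_le)
    also have "\<dots> \<le> real i + 2" using i by simp
    finally have ln1: "1 \<le> ln (real i + 2)" using i by (subst ln_ge_iff) auto
    then have "1 * 1 \<le> real i * ln (real i + 2)" using i by (intro mult_mono) auto
    then have L: "1 \<le> real i * ln (real i + 2)" by simp
    show "real (M i) \<le> c * (real i * ln (real i + 2))"
    proof (cases "n0 \<le> i")
      case True
      have "0 \<le> ln (real i)" using i by simp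
      then have "real (M i) \<le> d * (real i * ln (real i))" using n0[OF True] by simp
      also have "\<dots> \<le> d * (real i * ln (real i + 2))" using i d(1) by (intro mult_left_mono) auto
      also have "\<dots> \<le> c * (real i * ln (real i + 2))" using S0 L by (intro mult_right_mono) (auto simp: c_def)
      finally show ?thesis .
    next
      case False
      then have "real (M i) \<le> (\<Sum>i<n0. real (M i))" by (intro member_le_sum) auto
      also have "\<dots> \<le> c * 1" using d(1) by (simp add: c_def)
      also have "\<dots> \<le> c * (real i * ln (real i + 2))" using L d(1) S0 by (intro mult_left_mono) (auto simp: c_def)
      finally show ?thesis .
    qed
  qed
qed

context lehman_input
begin

lemma N_ge_4: "4 \<le> N"
proof -
  have "2 \<le> log 2 (real_of_int N)" using r_le_lg r_gt_1 by linarith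
  then have "2 powr 2 \<le> real_of_int N" using N_gt_1 by (simp add: le_log_iff)
  then show ?thesis by simp
qed

lemma ln_N_gt_1: "1 < ln (4::real)" "ln 4 \<le> ln (real_of_int N)"
proof -
  show "1 < ln (4::real)" by (rule one_less_ln_4)
  show "ln 4 \<le> ln (real_of_int N)" using N_ge_4 by (subst ln_le_cancel_iff) auto
qed

lemma len_le_ln: "real len \<le> 3 * ln (real_of_int N)"
proof -
  have "int len - 1 \<le> log 2 (real_of_int N)" using floor_log2_eq_bits[of N] N_gt_1 by linarith
  then have "real len \<le> 1 + ln (real_of_int N) / ln 2" by (simp add: log_def)
  moreover have "ln (real_of_int N) / ln 2 \<le> ln (real_of_int N) / (1/2)"
    using half_le_ln_2 ln_N_gt_1 by (intro divide_left_mono) auto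
  ultimately show ?thesis using ln_N_gt_1 by simp
qed

text \<open>
  As \<open>N \<ge> 2\<^sup>r \<ge> 4\<close>, the number \<open>ln (ln N)\<close> is bounded away from \<open>0\<close>, so that additive constants can be absorbed.
\<close>

lemma ln_len_le: "ln (real len + 2) \<le> (ln 5 / ln (ln 4) + 1) * ln (ln (real_of_int N))"
proof -
  have l: "1 < ln (real_of_int N)" using ln_N_gt_1 by linarith
  have "0 < ln (ln (4::real))" using ln_N_gt_1(1) by simp
  moreover have ll: "ln (ln 4) \<le> ln (ln (real_of_int N))" using ln_N_gt_1 by (subst ln_le_cancel_iff) auto
  ultimately have "ln 5 * 1 \<le> ln 5 * (ln (ln (real_of_int N)) / ln (ln 4))"
    by (intro mult_left_mono) auto
  moreover have "real len + 2 \<le> 5 * ln (real_of_int N)" using len_le_ln l by linarith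
  then have "ln (real len + 2) \<le> ln (5 * ln (real_of_int N))" by (subst ln_le_cancel_iff) (use l in auto)
  moreover have "ln (5 * ln (real_of_int N)) = ln 5 + ln (ln (real_of_int N))" using l by (subst ln_mult) auto
  ultimately have "ln (real len + 2) \<le> ln 5 * (ln (ln (real_of_int N)) / ln (ln 4)) + ln (ln (real_of_int N))" by linarith
  then show ?thesis by (simp add: algebra_simps)
qed

end

lemma lehman_program_cost:
  fixes M :: "nat \<Rightarrow> nat" and r :: nat
  assumes M: "(\<lambda>n. real (M n)) \<in> O(\<lambda>n. real n * ln (real n))" and r: "1 < r"
  shows "\<exists>C. \<forall>N::int. 1 < N \<longrightarrow> real r \<le> log 2 (real_of_int N) \<longrightarrow>
       real (bit_operations (lehman_program M N r))
         \<le> C * (real_of_int N powr (1 / (real r + 2)) * (ln (real_of_int N))\<^sup>2 * ln (ln (real_of_int N)))"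
proof -
  obtain c where c: "0 \<le> c" "\<And>i. 1 \<le> i \<Longrightarrow> real (M i) \<le> c * (real i * ln (real i + 2))"
    using multiplication_cost_bound[OF M] by blast
  define K where "K = 30 + 11 * (real r + 2) + 180 * (real r + 2) ^ 3 + 3 * 2 ^ (r + 2)
    + 352 * (real r + 2) ^ 2 * (2 ^ (r + 3) * (1 + real r ^ (r + 2))) * (1 / (1 - 2 powr (- 1/3)))"
  define D where "D = real (40000 * (r + 2) ^ 6)"
  have D1: "1 \<le> D"
  proof -
    have "1 \<le> 40000 * (r + 2) ^ 6" by simp
    then have "real 1 \<le> D" unfolding D_def by (simp only: of_nat_le_iff)
    then show ?thesis by simp
  qed
  have K0: "0 \<le> K" unfolding K_def by (intro add_nonneg_nonneg mult_nonneg_nonneg) (auto simp: powr_less_one less_imp_le)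
  define E where "E = (c + 2) * D ^ 2 * (ln D + 1)"
  have E0: "0 \<le> E" using c(1) D1 by (simp add: E_def)
  define L where "L = ln 5 / ln (ln 4) + (1::real)"
  show ?thesis
  proof (intro exI[of _ "K * (E * 9 * L)"] allI impI)
    fix N :: int assume N: "1 < N" "real r \<le> log 2 (real_of_int N)"
    interpret lehman_input N r using N r by unfold_locales
    define n where "n = 40000 * ((r + 2) ^ 6 * bits N)"
    have len1: "1 \<le> real len" using r_less_len by simp
    have n: "real n = D * real len" by (simp add: n_def D_def)
    have n1: "1 \<le> n" using r_less_len by (simp add: n_def)
    define y where "y = real n * ln (real n + 2)"
    have ln1: "1 \<le> ln (real n + 2)"
    proof -
      have "exp 1 \<le> (3::real)" by (rule exp_le)
      also have "\<dots> \<le> real n + 2" using n1 by simp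
      finally show ?thesis using n1 by (subst ln_ge_iff) auto
    qed
    have y: "real n \<le> y" "1 \<le> y"
    proof -
      show "real n \<le> y" unfolding y_def using ln1 n1 by simp
      then show "1 \<le> y" using n1 by linarith
    qed
    define m where "m = n + nat \<lfloor>c * y\<rfloor>"
    have cy0: "0 \<le> c * y" using c(1) y by simp
    have m: "real m \<le> (c + 1) * y" "n \<le> m"
    proof -
      have "real (nat \<lfloor>c * y\<rfloor>) \<le> c * y" using cy0 by linarith
      then show "real m \<le> (c + 1) * y" using y by (simp add: m_def algebra_simps)
    qed (simp add: m_def)
    interpret lehman_cost N r M n m
    proof unfold_locales
      fix i assume i: "1 \<le> i" "i \<le> n"
      have "real (M i) \<le> c * (real i * ln (real i + 2))" using i by (intro c)
      also have "\<dots> \<le> c * y" unfolding y_def using i c(1) by (intro mult_left_mono mult_mono) auto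
      finally have "M i \<le> nat \<lfloor>c * y\<rfloor>" by (rule le_nat_floor)
      then show "M i \<le> m" by (simp add: m_def)
    qed (use m n1 n_def in auto)
    have "real n + 2 \<le> D * (real len + 2)" using D1 by (simp add: n algebra_simps)
    then have "ln (real n + 2) \<le> ln (D * (real len + 2))" by (intro ln_mono) auto
    also have "\<dots> = ln D + ln (real len + 2)" using D1 by (subst ln_mult) auto
    also have "\<dots> \<le> (ln D + 1) * ln (real len + 2)"
    proof -
      have "exp 1 \<le> (3::real)" by (rule exp_le)
      also have "\<dots> \<le> real len + 2" using len1 by simp
      finally have "1 \<le> ln (real len + 2)" by (subst ln_ge_iff) auto
      then have "ln D * 1 \<le> ln D * ln (real len + 2)" using D1 by (intro mult_left_mono) auto
      then show ?thesis by (simp add: algebra_simps)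
    qed
    finally have lnn: "ln (real n + 2) \<le> (ln D + 1) * ln (real len + 2)" .
    have "real (n * m) \<le> real n * ((c + 1) * y)" using m(1) by (simp add: mult_left_mono)
    also have "\<dots> \<le> (c + 2) * (real n * real n) * ln (real n + 2)"
      unfolding y_def using c(1) ln1 by (simp add: algebra_simps)
    also have "\<dots> \<le> (c + 2) * (real n * real n) * ((ln D + 1) * ln (real len + 2))"
      using lnn c(1) by (intro mult_left_mono) auto
    also have "\<dots> = E * (real len)\<^sup>2 * ln (real len + 2)" by (simp add: E_def n power2_eq_square algebra_simps)
    also have "\<dots> \<le> E * (3 * ln (real_of_int N))\<^sup>2 * (L * ln (ln (real_of_int N)))"
      unfolding L_def using E0 len_le_ln ln_len_le len1 by (intro mult_mono mult_left_mono power_mono) auto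
    also have "\<dots> = (E * 9 * L) * ((ln (real_of_int N))\<^sup>2 * ln (ln (real_of_int N)))" by (simp add: power_mult_distrib)
    finally have nm: "real (n * m) \<le> (E * 9 * L) * ((ln (real_of_int N))\<^sup>2 * ln (ln (real_of_int N)))" .
    have "real (bit_operations (lehman_program M N r)) \<le> K * (real (n * m) * trial_bound)"
      using cost_lehman_program_le unfolding pair_const_def K_def .
    also have "\<dots> \<le> K * ((E * 9 * L) * ((ln (real_of_int N))\<^sup>2 * ln (ln (real_of_int N))) * trial_bound)"
      using nm K0 trial_bound_ge_1 by (intro mult_left_mono mult_right_mono) auto
    also have "\<dots> = K * (E * 9 * L) * (real_of_int N powr (1 / (real r + 2)) * (ln (real_of_int N))\<^sup>2 * ln (ln (real_of_int N)))"
      by (simp add: trial_bound_def mult_ac)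
    finally show "real (bit_operations (lehman_program M N r))
         \<le> K * (E * 9 * L) * (real_of_int N powr (1 / (real r + 2)) * (ln (real_of_int N))\<^sup>2 * ln (ln (real_of_int N)))" .
  qed
qed

theorem theorem3p1:
  fixes M :: "nat \<Rightarrow> nat"
  assumes M: "(\<lambda>n. real (M n)) \<in> O(\<lambda>n. real n * ln (real n))"
  shows "\<forall>r::nat. 1 < r \<longrightarrow>
    (\<forall>N::int. 1 < N \<longrightarrow> real r \<le> log 2 (real_of_int N) \<longrightarrow>
       (case lehman N r of
          Some d \<Rightarrow> nontrivial_factor d N
        | None \<Rightarrow> power_free r N) \<and>
       result (lehman_program M N r) = lehman N r) \<and>
    (\<exists>C::real. \<forall>N::int. 1 < N \<longrightarrow> real r \<le> log 2 (real_of_int N) \<longrightarrow>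
       real (bit_operations (lehman_program M N r))
         \<le> C * (real_of_int N powr (1 / (real r + 2))
                 * (ln (real_of_int N))\<^sup>2 * ln (ln (real_of_int N))))"
proof (intro allI impI conjI)
  fix r :: nat and N :: int
  assume "1 < r" "1 < N" "real r \<le> log 2 (real_of_int N)"
  then interpret lehman_input N r by unfold_locales
  show "case lehman N r of Some d \<Rightarrow> nontrivial_factor d N | None \<Rightarrow> power_free r N"
    using r_gt_1 N_gt_1 by (rule lehman_correct)
  show "result (lehman_program M N r) = lehman N r" by (rule result_lehman_program)
qed (use lehman_program_cost[OF M] in blast)

end
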